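(* Let $b,\beta,\sigma,\vartheta:[0,T]\times\mathbb{R}\to\mathbb{R}$ be measurable functions, each of which, written generically as $g$, satisfies $$\mathrm{Lip}(g):=\sup_{t\in[0,T],\,x\neq y\in\mathbb{R}}\frac{|g(t,x)-g(t,y)|}{|x-y|}<+\infty\quad\text{and}\quad \sup_{t\in[0,T]}|g(t,0)|<+\infty .$$ Assume that at least one of the following two conditions holds: $(\mathcal{X})$: $\mathbf{a}_\sigma<+\infty$ and $b(t,\cdot)$ is convex for every $t\in[0,T]$; $(\mathcal{Y})$: $\mathbf{a}_\vartheta<+\infty$ and $\beta(t,\cdot)$ is convex for every $t\in[0,T]$. Consider the truncated Euler schemes $\widetilde X^m$ and $\widetilde Y^m$ defined in the context (for either of the two choices of coefficients given there), started respectively from $X_0,Y_0\in L^1(\mathbb{P})$, with $m\in\mathbb{N}$, $m\ge\mathbf{m}_{b,\sigma}$ and truncation level $\mathbf{s}_m\in\big[0,\frac{\sqrt m}{2\mathrm{Lip}(\sigma)\sqrt T}\big]$ if $(\mathcal{X})$ holds, or with $m\in\mathbb{N}$, $m\ge\mathbf{m}_{\beta,\vartheta}$ and truncation level $\mathbf{s}_m\in\big[0,\frac{\sqrt m}{2\mathrm{Lip}(\vartheta)\sqrt T}\big]$ if $(\mathcal{Y})$ holds. (a) (Non-decreasing directional convex ordering.) We have $$\big(b\le\beta\ \text{and}\ 0\le\sigma\le\vartheta\ \text{on}\ [0,T]\times\mathbb{R},\ \text{and}\ X_0\preceq_{icv}Y_0\big)\Longrightarrow(\widetilde X^m_{t_k})_{k=0,\dots,m}\preceq_{diricv}(\widetilde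 Y^m_{t_k})_{k=0,\dots,m}.$$ Moreover, when $(\mathcal{X})$ (resp. $(\mathcal{Y})$) holds (with the corresponding constraints on $m$ and $\mathbf{s}_m$), then for each directionally convex function $f:\mathbb{R}^{m+1}\to\mathbb{R}$ non-decreasing in each of its variables, the map $x\mapsto\mathbb{E}\,f\big((\widetilde X^{m,x}_{t_k})_{k=0,\dots,m}\big)\in\mathbb{R}\cup\{+\infty\}$ (resp. $y\mapsto\mathbb{E}\,f\big((\widetilde Y^{m,y}_{t_k})_{k=0,\dots,m}\big)\in\mathbb{R}\cup\{+\infty\}$) is non-decreasing and convex. (b) (Directional convex ordering.) Suppose $b(t,x)=\beta(t,x)=\lambda(t)+\mu(t)x$ for all $(t,x)\in[0,T]\times\mathbb{R}$, where $\lambda,\mu:[0,T]\to\mathbb{R}$ are bounded Borel functions. Then $$\big(0\le\sigma\le\vartheta\ \text{on}\ [0,T]\times\mathbb{R}\ \text{and}\ X_0\preceq_{cvx}Y_0\big)\Longrightarrow(\widetilde X^m_{t_k})_{k=0,\dots,m}\preceq_{dircvx}(\widetilde Y^m_{t_k})_{k=0,\dots,m}.$$ Moreover, when $(\mathcal{X})$ (resp. $(\mathcal{Y})$) holds (with the corresponding constraints on $m$ and $\mathbf{s}_m$), then for each directionally convex function $f:\mathbb{R}^{m+1}\to\mathbb{R}$, the map $x\mapsto\mathbb{E}\,f\big((\widetilde X^{m,x}_{t_k})_{k=0,\dots,m}\big)\in\mathbb{R}\cup\{+\infty\}$ (resp. $y\mapsto\mathbb{E}\,f\big((\widetilde Y^{m,y}_{t_k})_{k=0,\dots,m}\big)\in\mathbb{R}\cup\{+\infty\}$)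 is convex.
   Context: $T>0$ is fixed, $t_k=\frac{kT}{m}$. Let $G_1,\dots,G_m$ be i.i.d. standard Gaussian random variables independent of $(X_0,Y_0)$ and, for a truncation level $\mathbf{s}_m$, $Z^m_{k+1}=G_{k+1}\mathbf{1}_{\{|G_{k+1}|\le\mathbf{s}_m\}}$, $k=0,\dots,m-1$. Truncated Euler schemes: $\widetilde X^m_{0}=X_0$, $\widetilde Y^m_{0}=Y_0$ and, for $k=0,\dots,m-1$, $$\widetilde X^m_{t_{k+1}}=\widetilde X^m_{t_k}+\tfrac Tm\widetilde b^m_k(\widetilde X^m_{t_k})+\sqrt{\tfrac Tm}\,\widetilde\sigma^m_k(\widetilde X^m_{t_k})Z^m_{k+1},\qquad \widetilde Y^m_{t_{k+1}}=\widetilde Y^m_{t_k}+\tfrac Tm\widetilde\beta^m_k(\widetilde Y^m_{t_k})+\sqrt{\tfrac Tm}\,\widetilde\vartheta^m_k(\widetilde Y^m_{t_k})Z^m_{k+1},$$ where either, for all $k$, $(\widetilde b^m_k,\widetilde\sigma^m_k,\widetilde\beta^m_k,\widetilde\vartheta^m_k)(\cdot)$ equals $$\Big(\tfrac mT\int_{t_k}^{t_{k+1}}b(s,\cdot)ds,\ \sqrt{\tfrac mT\int_{t_k}^{t_{k+1}}\sigma^2(s,\cdot)ds},\ \tfrac mT\int_{t_k}^{t_{k+1}}\beta(s,\cdot)ds,\ \sqrt{\tfrac mT\int_{t_k}^{t_{k+1}}\vartheta^2(s,\cdot)ds}\Big),$$ or, for all $k$, it equals $(b(t_k,\cdot),\sigma(t_k,\cdot),\beta(t_k,\cdot),\vartheta(t_k,\cdot))$.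 For $x,y\in\mathbb{R}$, $\widetilde X^{m,x}$ and $\widetilde Y^{m,y}$ denote these schemes started from $\widetilde X^m_0=x$ and $\widetilde Y^m_0=y$. Constants: $\mathbf{a}_\sigma=\inf\{a\ge0:\ x\mapsto\sigma^2(t,x)+ax^2\text{ is convex for all }t\in[0,T]\}$, $\mathbf{c}_b=\inf\{c\ge0:\ x\mapsto b(t,x)+cx\text{ is non-decreasing for all }t\in[0,T]\}$ (with $\inf\emptyset=+\infty$), $\mathbf{c}_\sigma=\mathbf{a}_\sigma+(\mathrm{Lip}(\sigma))^2$, $\mathbf{m}_{b,\sigma}=\Big(\frac{2\mathbf{c}_b}{\sqrt{\mathbf{c}_\sigma+2\mathbf{c}_b}-\sqrt{\mathbf{c}_\sigma}}\Big)^2T$, where the ratio is understood as its limit $2\sqrt{\mathbf{c}_\sigma}$ when $\mathbf{c}_b=0$; $\mathbf{a}_\vartheta,\mathbf{c}_\beta,\mathbf{c}_\vartheta,\mathbf{m}_{\beta,\vartheta}$ are defined likewise with $(\beta,\vartheta)$ in place of $(b,\sigma)$. Convention: $\frac10=+\infty$ in the upper bounds for $\mathbf{s}_m$. Orders: for real $U,V\in L^1(\mathbb{P})$, $U\preceq_{cvx}V$ (resp. $U\preceq_{icv}V$) means $\mathbb{E}f(U)\le\mathbb{E}f(V)\in\mathbb{R}\cup\{+\infty\}$ for every convex (resp. non-decreasing convex) $f:\mathbb{R}\to\mathbb{R}$. A function $f:\mathbb{R}^d\to\mathbb{R}$ is directionally convex if it is Borel measurable and $f(x+y+z)-f(x+y)-f(x+z)+f(x)\ge0$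 for all $x\in\mathbb{R}^d$, $y,z\in\mathbb{R}^d_+$. For $\mathbb{R}^d$-valued $U,V\in L^1(\mathbb{P})$, $U\preceq_{dircvx}V$ (resp. $U\preceq_{diricv}V$) means $\mathbb{E}f(U)\le\mathbb{E}f(V)\in\mathbb{R}\cup\{+\infty\}$ for every directionally convex (resp. directionally convex and non-decreasing in each of its variables) $f:\mathbb{R}^d\to\mathbb{R}$.
   Formalization: In (b), E f may be undefined (positive and negative parts both of infinite mean); the expectation is taken to be +∞ whenever the positive part has infinite mean, and ordering and convexity are stated with this convention. *)

theory Defs
  imports "HOL-Probability.Probability"
begin

section \<open>Expectations with values in the extended reals\<close>

text \<open>
  \<open>ext_expectation M g\<close> is the expectation of the positive part of \<open>g\<close> minus that of the
  negative part. In \<^typ>\<open>ereal\<close> one has \<open>\<infinity> - \<infinity> = \<infinity>\<close>, so the value is \<open>\<infinity>\<close> as soon as the positive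
  part is not integrable. The expectation is well defined in \<open>\<real> \<union> {\<infinity>}\<close> in the usual sense, that
  is without this convention, exactly when \<open>neg_part_integrable M g\<close> holds (for measurable \<open>g\<close>).
\<close>

definition ext_expectation :: "'w measure \<Rightarrow> ('w \<Rightarrow> real) \<Rightarrow> ereal" where
  "ext_expectation M g =
     enn2ereal (\<integral>\<^sup>+ \<omega>. ennreal (g \<omega>) \<partial>M) - enn2ereal (\<integral>\<^sup>+ \<omega>. ennreal (- g \<omega>) \<partial>M)"

definition neg_part_integrable :: "'w measure \<Rightarrow> ('w \<Rightarrow> real) \<Rightarrow> bool" where
  "neg_part_integrable M g \<longleftrightarrow> (\<integral>\<^sup>+ \<omega>. ennreal (- g \<omega>) \<partial>M) < \<infinity>"

definition convex_ext :: "(real \<Rightarrow> ereal) \<Rightarrow> bool" where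
  "convex_ext \<phi> \<longleftrightarrow>
     (\<forall>x. \<phi> x \<noteq> - \<infinity>) \<and>
     (\<forall>x y u. 0 \<le> u \<and> u \<le> 1 \<longrightarrow>
        \<phi> ((1 - u) * x + u * y) \<le> ereal (1 - u) * \<phi> x + ereal u * \<phi> y)"

section \<open>Stochastic orders\<close>

text \<open>
  In the two univariate orders the expectations are automatically well defined in \<open>\<real> \<union> {\<infinity>}\<close>,
  because a convex function on the line has an affine minorant.
\<close>

definition le_cvx :: "'w measure \<Rightarrow> ('w \<Rightarrow> real) \<Rightarrow> ('w \<Rightarrow> real) \<Rightarrow> bool" where
  "le_cvx M U V \<longleftrightarrow> integrable M U \<and> integrable M V \<and>
     (\<forall>f::real \<Rightarrow> real. convex_on UNIV f \<longrightarrow>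
        ext_expectation M (\<lambda>\<omega>. f (U \<omega>)) \<le> ext_expectation M (\<lambda>\<omega>. f (V \<omega>)))"

definition le_icv :: "'w measure \<Rightarrow> ('w \<Rightarrow> real) \<Rightarrow> ('w \<Rightarrow> real) \<Rightarrow> bool" where
  "le_icv M U V \<longleftrightarrow> integrable M U \<and> integrable M V \<and>
     (\<forall>f::real \<Rightarrow> real. convex_on UNIV f \<and> mono f \<longrightarrow>
        ext_expectation M (\<lambda>\<omega>. f (U \<omega>)) \<le> ext_expectation M (\<lambda>\<omega>. f (V \<omega>)))"

text \<open>
  The space of real \<open>d\<close>-vectors is represented by the functions on \<open>{..<d}\<close> that are
  \<^const>\<open>undefined\<close> outside; its Borel sets are those of the finite product of \<^const>\<open>borel\<close>.
\<close>

definition Rd :: "nat \<Rightarrow> (nat \<Rightarrow> real) set" where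
  "Rd d = {..<d} \<rightarrow>\<^sub>E UNIV"

definition vadd :: "nat \<Rightarrow> (nat \<Rightarrow> real) \<Rightarrow> (nat \<Rightarrow> real) \<Rightarrow> nat \<Rightarrow> real" where
  "vadd d x y = (\<lambda>i\<in>{..<d}. x i + y i)"

definition dir_convex :: "nat \<Rightarrow> ((nat \<Rightarrow> real) \<Rightarrow> real) \<Rightarrow> bool" where
  "dir_convex d f \<longleftrightarrow>
     f \<in> borel_measurable (PiM {..<d} (\<lambda>_. borel)) \<and>
     (\<forall>x\<in>Rd d. \<forall>y\<in>Rd d. \<forall>z\<in>Rd d. (\<forall>i<d. 0 \<le> y i \<and> 0 \<le> z i) \<longrightarrow>
        f (vadd d (vadd d x y) z) - f (vadd d x y) - f (vadd d x z) + f x \<ge> 0)"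

definition nondecreasing_each :: "nat \<Rightarrow> ((nat \<Rightarrow> real) \<Rightarrow> real) \<Rightarrow> bool" where
  "nondecreasing_each d f \<longleftrightarrow> (\<forall>x\<in>Rd d. \<forall>i<d. \<forall>t. x i \<le> t \<longrightarrow> f x \<le> f (x(i := t)))"

text \<open>
  For an integrable vector and a directionally convex function that is non-decreasing in each
  variable, the negative part is integrable, and this is part of \<open>le_diricv\<close>. It can fail when
  the function is not monotone: for \<open>f (u, v) = u * v\<close>, \<open>U\<close> integrable but not square integrable and
  \<open>\<epsilon>\<close> an independent random sign, the positive and negative parts of \<open>f (U, 2 * \<epsilon> * U)\<close> both have
  infinite expectation. Therefore \<open>le_dircvx\<close> relies on the convention in \<open>ext_expectation\<close>.
\<close>

definition le_diricv ::
  "'w measure \<Rightarrow> nat \<Rightarrow> ('w \<Rightarrow> nat \<Rightarrow> real) \<Rightarrow> ('w \<Rightarrow> nat \<Rightarrow> real) \<Rightarrow> bool" where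
  "le_diricv M d U V \<longleftrightarrow>
     (\<forall>i<d. integrable M (\<lambda>\<omega>. U \<omega> i) \<and> integrable M (\<lambda>\<omega>. V \<omega> i)) \<and>
     (\<forall>f. dir_convex d f \<and> nondecreasing_each d f \<longrightarrow>
        neg_part_integrable M (\<lambda>\<omega>. f (U \<omega>)) \<and> neg_part_integrable M (\<lambda>\<omega>. f (V \<omega>)) \<and>
        ext_expectation M (\<lambda>\<omega>. f (U \<omega>)) \<le> ext_expectation M (\<lambda>\<omega>. f (V \<omega>)))"

definition le_dircvx ::
  "'w measure \<Rightarrow> nat \<Rightarrow> ('w \<Rightarrow> nat \<Rightarrow> real) \<Rightarrow> ('w \<Rightarrow> nat \<Rightarrow> real) \<Rightarrow> bool" where
  "le_dircvx M d U V \<longleftrightarrow>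
     (\<forall>i<d. integrable M (\<lambda>\<omega>. U \<omega> i) \<and> integrable M (\<lambda>\<omega>. V \<omega> i)) \<and>
     (\<forall>f. dir_convex d f \<longrightarrow>
        ext_expectation M (\<lambda>\<omega>. f (U \<omega>)) \<noteq> - \<infinity> \<and> ext_expectation M (\<lambda>\<omega>. f (V \<omega>)) \<noteq> - \<infinity> \<and>
        ext_expectation M (\<lambda>\<omega>. f (U \<omega>)) \<le> ext_expectation M (\<lambda>\<omega>. f (V \<omega>)))"

section \<open>Coefficients and their constants\<close>

text \<open>
  Functions on \<open>[0,T] \<times> \<real>\<close> are represented by total functions \<open>g\<close> of which only the values
  \<open>g t x\<close> with \<open>0 \<le> t \<le> T\<close> are used.
\<close>

definition lip_const :: "real \<Rightarrow> (real \<Rightarrow> real \<Rightarrow> real) \<Rightarrow> ereal" where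
  "lip_const T g =
     (SUP (t, x, y) \<in> {(t, x, y). t \<in> {0..T} \<and> x \<noteq> y}. ereal (\<bar>g t x - g t y\<bar> / \<bar>x - y\<bar>))"

definition regular_coeff :: "real \<Rightarrow> (real \<Rightarrow> real \<Rightarrow> real) \<Rightarrow> bool" where
  "regular_coeff T g \<longleftrightarrow>
     (\<lambda>(t, x). g t x) \<in> borel_measurable (restrict_space borel ({0..T} \<times> UNIV)) \<and>
     lip_const T g < \<infinity> \<and> (SUP t\<in>{0..T}. ereal \<bar>g t 0\<bar>) < \<infinity>"

definition a_const :: "real \<Rightarrow> (real \<Rightarrow> real \<Rightarrow> real) \<Rightarrow> ereal" where
  "a_const T \<sigma> =
     Inf (ereal ` {a. 0 \<le> a \<and> (\<forall>t\<in>{0..T}. convex_on UNIV (\<lambda>x. (\<sigma> t x)\<^sup>2 + a * x\<^sup>2))})"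

definition cb_const :: "real \<Rightarrow> (real \<Rightarrow> real \<Rightarrow> real) \<Rightarrow> ereal" where
  "cb_const T b = Inf (ereal ` {c. 0 \<le> c \<and> (\<forall>t\<in>{0..T}. mono (\<lambda>x. b t x + c * x))})"

definition cs_const :: "real \<Rightarrow> (real \<Rightarrow> real \<Rightarrow> real) \<Rightarrow> ereal" where
  "cs_const T \<sigma> = a_const T \<sigma> + (lip_const T \<sigma>)\<^sup>2"

text \<open>
  For regular coefficients with \<open>a_const T \<sigma> < \<infinity>\<close> (the only case in which \<open>m_const\<close> is used),
  both constants are finite and \<^const>\<open>real_of_ereal\<close> loses nothing.
\<close>

definition m_const :: "real \<Rightarrow> (real \<Rightarrow> real \<Rightarrow> real) \<Rightarrow> (real \<Rightarrow> real \<Rightarrow> real) \<Rightarrow> real" where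
  "m_const T b \<sigma> =
     (let c = real_of_ereal (cb_const T b); c' = real_of_ereal (cs_const T \<sigma>)
      in (if c = 0 then 2 * sqrt c' else 2 * c / (sqrt (c' + 2 * c) - sqrt c'))\<^sup>2 * T)"

definition cond_conv :: "real \<Rightarrow> (real \<Rightarrow> real \<Rightarrow> real) \<Rightarrow> (real \<Rightarrow> real \<Rightarrow> real) \<Rightarrow> bool" where
  "cond_conv T b \<sigma> \<longleftrightarrow> a_const T \<sigma> < \<infinity> \<and> (\<forall>t\<in>{0..T}. convex_on UNIV (b t))"

text \<open>
  The truncation level is extended real. If the Lipschitz constant is \<open>0\<close>, the upper bound is
  \<open>\<infinity>\<close>, because the quotient of a positive \<^typ>\<open>ereal\<close> by \<open>0\<close> is \<open>\<infinity>\<close>.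
\<close>

definition admissible ::
  "real \<Rightarrow> nat \<Rightarrow> ereal \<Rightarrow> (real \<Rightarrow> real \<Rightarrow> real) \<Rightarrow> (real \<Rightarrow> real \<Rightarrow> real) \<Rightarrow> bool" where
  "admissible T m s b \<sigma> \<longleftrightarrow>
     m_const T b \<sigma> \<le> real m \<and>
     0 \<le> s \<and> s \<le> ereal (sqrt (real m)) / (2 * lip_const T \<sigma> * ereal (sqrt T))"

section \<open>Truncated Euler schemes\<close>

definition grid :: "real \<Rightarrow> nat \<Rightarrow> nat \<Rightarrow> real" where
  "grid T m k = real k * T / real m"

datatype coeff_choice = Averaged | Frozen

definition drift_coeff ::
  "coeff_choice \<Rightarrow> real \<Rightarrow> nat \<Rightarrow> (real \<Rightarrow> real \<Rightarrow> real) \<Rightarrow> nat \<Rightarrow> real \<Rightarrow> real" where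
  "drift_coeff ch T m b k x =
     (case ch of
        Averaged \<Rightarrow> real m / T *
          set_lebesgue_integral lborel {grid T m k..grid T m (Suc k)} (\<lambda>t. b t x)
      | Frozen \<Rightarrow> b (grid T m k) x)"

definition diffusion_coeff ::
  "coeff_choice \<Rightarrow> real \<Rightarrow> nat \<Rightarrow> (real \<Rightarrow> real \<Rightarrow> real) \<Rightarrow> nat \<Rightarrow> real \<Rightarrow> real" where
  "diffusion_coeff ch T m \<sigma> k x =
     (case ch of
        Averaged \<Rightarrow> sqrt (real m / T *
          set_lebesgue_integral lborel {grid T m k..grid T m (Suc k)} (\<lambda>t. (\<sigma> t x)\<^sup>2))
      | Frozen \<Rightarrow> \<sigma> (grid T m k) x)"

definition truncate :: "ereal \<Rightarrow> real \<Rightarrow> real" where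
  "truncate s g = (if ereal \<bar>g\<bar> \<le> s then g else 0)"

primrec euler ::
  "coeff_choice \<Rightarrow> real \<Rightarrow> nat \<Rightarrow> ereal \<Rightarrow> (real \<Rightarrow> real \<Rightarrow> real) \<Rightarrow> (real \<Rightarrow> real \<Rightarrow> real) \<Rightarrow>
   (nat \<Rightarrow> real) \<Rightarrow> real \<Rightarrow> nat \<Rightarrow> real" where
  "euler ch T m s b \<sigma> g x 0 = x"
| "euler ch T m s b \<sigma> g x (Suc k) =
     euler ch T m s b \<sigma> g x k
     + T / real m * drift_coeff ch T m b k (euler ch T m s b \<sigma> g x k)
     + sqrt (T / real m) * diffusion_coeff ch T m \<sigma> k (euler ch T m s b \<sigma> g x k)
         * truncate s (g (Suc k))"

definition euler_path ::
  "coeff_choice \<Rightarrow> real \<Rightarrow> nat \<Rightarrow> ereal \<Rightarrow> (real \<Rightarrow> real \<Rightarrow> real) \<Rightarrow> (real \<Rightarrow> real \<Rightarrow> real) \<Rightarrow>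
   (nat \<Rightarrow> 'w \<Rightarrow> real) \<Rightarrow> ('w \<Rightarrow> real) \<Rightarrow> 'w \<Rightarrow> nat \<Rightarrow> real" where
  "euler_path ch T m s b \<sigma> G X0 \<omega> =
     (\<lambda>k\<in>{..<Suc m}. euler ch T m s b \<sigma> (\<lambda>j. G j \<omega>) (X0 \<omega>) k)"

end

theory Submission
  imports Defs
begin

text \<open>
  Write \<open>h = T/m\<close>, \<open>\<mu> k x = x + h * b k x\<close> and \<open>\<rho> k x = sqrt h * \<sigma> k x\<close>, so that one step of the scheme sends
  \<open>x\<close> to \<open>\<mu> k x + \<rho> k x * z\<close>. Integrating a functional \<open>f\<close> of the path against the last noise variable, then
  against the one before, and so on, expresses its conditional mean given the starting point as a
  composition of kernels \<open>f \<mapsto> (\<lambda>x. \<integral>z. f (x(Suc k := \<mu> k (x k) + \<rho> k (x k) * z)) \<partial>\<nu>)\<close>. Two facts give the ordering.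
  If a class of functionals is stable under the kernels of one of the two schemes, and the kernels of the
  two schemes are ordered on the class, then the compositions are ordered (\<open>backward_compare\<close>). If the
  class consists of functionals that are convex along the diagonal, the conditional means are convex functions
  of the starting point, to which the order between \<open>X0\<close> and \<open>Y0\<close> applies.

  The kernels are ordered because the noise is symmetric and a convex function gains from a larger
  spread. Their stability is the heart of the matter. For directionally convex functionals it reduces to
  one variable: for convex \<open>g\<close>, increasing unless \<open>\<mu>\<close> is affine, the average
  \<open>x \<mapsto> \<integral>z. g (\<mu> x + \<rho> x * z) \<partial>\<nu>\<close> must be convex (\<open>noise_average_convex\<close>). Differentiating twice
  formally, the gain is at least \<open>\<kappa>\<^sup>2 * \<integral>g''\<close>, where \<open>\<kappa>\<close> bounds from below the slope of
  \<open>x \<mapsto> \<mu> x + \<rho> x * z\<close>, while semiconvexity of \<open>\<rho>\<^sup>2\<close> and the Lipschitz constant of \<open>\<rho>\<close> only give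
  \<open>\<rho> * \<rho>'' \<ge> - (\<alpha> + L\<^sup>2)\<close>, so that concavity of \<open>\<rho>\<close> may cost up to \<open>(\<alpha> + L\<^sup>2) / \<rho> * \<integral>z * g'\<close>. For truncated
  Gaussian noise, integration by parts bounds \<open>\<integral>z * g'\<close> by \<open>\<rho> * \<integral>g''\<close>, and the lower bound on \<open>m\<close> together
  with the upper bound on the truncation level ensures that \<open>\<alpha> + L\<^sup>2 \<le> \<kappa>\<^sup>2\<close> for a suitable \<open>\<kappa>\<close>
  (\<open>step_small\<close>, \<open>euler_convex_step\<close>).

  The remaining work concerns infinite values. If the truncation level is infinite, the Gaussian variables
  are first confined to windows \<open>[-N, N]\<close>, where all functionals are bounded given the starting point.
  For increasing functionals the negative parts are integrable, and \<open>N \<rightarrow> \<infinity>\<close> settles part (a). In part (b)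
  they are integrable when the truncation level is finite, since a path that starts on one side of the origin
  then stays in an orthant on which \<open>f\<close> has an affine minorant. With an infinite level
  the diffusion coefficient of one scheme is constant in space, the steps of that scheme are affine, and
  the functionals \<open>max f (- c)\<close>, which need not be directionally convex but are convex along
  nonnegative rays, can be compared instead; \<open>c \<rightarrow> \<infinity>\<close> then yields the ordering.
\<close>

section \<open>Convexity on the line from second differences\<close>

text \<open>
  If \<open>u\<close> exceeded one of its chords, then so would \<open>u\<close> plus a small multiple of the parabola that vanishes at both ends
  of the chord. At an interior maximum the second differences of this sum are nonpositive, but the
  parabola adds a positive multiple of \<open>d\<^sup>2\<close> that outweighs the error term.
\<close>

lemma convex_on_if_second_differences:
  fixes u :: "real \<Rightarrow> real"
  assumes cont: "continuous_on UNIV u"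
    and D: "\<And>x e. e > 0 \<Longrightarrow> \<exists>d0>0. \<forall>d. 0 < d \<and> d < d0 \<longrightarrow> u (x + d) + u (x - d) - 2 * u x \<ge> - e * d\<^sup>2"
  shows "convex_on UNIV u"
proof (rule convex_on_linorderI)
  fix t x y :: real
  assume t: "0 < t" "t < 1" and xy: "x < y"
  show "u ((1 - t) *\<^sub>R x + t *\<^sub>R y) \<le> (1 - t) * u x + t * u y"
  proof (rule ccontr)
    assume neg: "\<not> ?thesis"
    define p where "p = (1 - t) * x + t * y"
    define k where "k = (u y - u x) / (y - x)"
    have k: "(y - x) * k = u y - u x" using xy by (simp add: k_def)
    define l where "l = (\<lambda>v. u x + (v - x) * k)"
    define gap where "gap = u p - l p"
    have px: "p - x = t * (y - x)" and yp: "y - p = (1 - t) * (y - x)"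
      by (simp_all add: p_def algebra_simps)
    have ppos: "p - x > 0" "y - p > 0" using t xy unfolding px yp by auto
    have "l p = (1 - t) * u x + t * u y"
    proof -
      have "(p - x) * k = t * (u y - u x)"
        unfolding px by (simp add: k mult.assoc)
      then show ?thesis by (simp add: l_def algebra_simps)
    qed
    with neg have gap: "gap > 0" by (simp add: gap_def p_def)
    define e where "e = gap / (2 * ((p - x) * (y - p)))"
    have e: "e > 0" using gap ppos by (simp add: e_def)
    define w where "w = (\<lambda>v. u v - l v + e * ((v - x) * (v - y)))"
    have "e * ((p - x) * (p - y)) = - gap / 2"
    proof -
      have "(p - x) * (p - y) = - ((p - x) * (y - p))" by (simp add: algebra_simps)
      then show ?thesis using ppos by (simp add: e_def)
    qed
    then have wp: "w p > 0" using gap by (simp add: w_def gap_def)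
    have w0: "w x = 0" "w y = 0" by (simp_all add: w_def l_def k)
    have "continuous_on {x..y} w"
      unfolding w_def l_def
      by (intro continuous_intros continuous_on_subset[OF cont]) auto
    then obtain v where v: "v \<in> {x..y}" and vmax: "\<And>z. z \<in> {x..y} \<Longrightarrow> w z \<le> w v"
      using continuous_attains_sup[of "{x..y}" w] xy by auto
    have "w v > 0" using vmax[of p] ppos wp by auto
    with w0 v have vin: "x < v" "v < y" by (auto simp: less_le)
    obtain d0 where d0: "d0 > 0" and dd: "\<And>d. 0 < d \<Longrightarrow> d < d0 \<Longrightarrow> u (v + d) + u (v - d) - 2 * u v \<ge> - e * d\<^sup>2"
      using D[OF e, of v] by blast
    define d where "d = Min {d0 / 2, v - x, y - v}"
    have d: "d > 0" "d < d0" "d \<le> v - x" "d \<le> y - v"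
      using d0 vin by (auto simp: d_def min_def)
    have "w (v + d) + w (v - d) - 2 * w v
        = u (v + d) + u (v - d) - 2 * u v + 2 * e * d\<^sup>2"
      by (simp add: w_def l_def power2_eq_square algebra_simps)
    moreover have "w (v + d) \<le> w v" "w (v - d) \<le> w v" using vmax d vin by auto
    moreover have "e * d\<^sup>2 > 0" using e d by simp
    ultimately show False using dd[OF d(1,2)] by simp
  qed
qed simp

text \<open>
  Directional convexity restricted to a line with nonnegative direction. Without some regularity this is weaker
  than convexity: every additive function satisfies it.
\<close>

definition wright_convex :: "(real \<Rightarrow> real) \<Rightarrow> bool" where
  "wright_convex g \<longleftrightarrow> (\<forall>x y z. 0 \<le> y \<and> 0 \<le> z \<longrightarrow> g (x + y) + g (x + z) \<le> g (x + y + z) + g x)"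

lemma wright_convexD:
  "wright_convex g \<Longrightarrow> 0 \<le> y \<Longrightarrow> 0 \<le> z \<Longrightarrow> g (x + y) + g (x + z) \<le> g (x + y + z) + g x"
  unfolding wright_convex_def by blast

lemma wright_convex_increments:
  assumes "wright_convex g" "d \<ge> 0"
  shows "real n * (g (x + d) - g x) \<le> g (x + real n * d) - g x"
proof (induction n)
  case (Suc n)
  have "g (x + d) + g (x + real n * d) \<le> g (x + d + real n * d) + g x"
    using wright_convexD[OF assms(1)] assms(2) by simp
  with Suc show ?case by (simp add: algebra_simps)
qed simp

lemma wright_convex_increments_left:
  assumes "wright_convex g" "d \<ge> 0"
  shows "g x - g (x - real n * d) \<le> real n * (g (x + d) - g x)"
proof (induction n)
  case (Suc n)
  have "g (x - real (Suc n) * d + d) + g (x - real (Suc n) * d + real (Suc n) * d)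
     \<le> g (x - real (Suc n) * d + d + real (Suc n) * d) + g (x - real (Suc n) * d)"
    using assms(2) by (intro wright_convexD[OF assms(1)]) auto
  moreover have "x - real (Suc n) * d + d = x - real n * d"
    "x - real (Suc n) * d + d + real (Suc n) * d = x + d" "x - real (Suc n) * d + real (Suc n) * d = x"
    by (simp_all add: algebra_simps)
  ultimately show ?case using Suc by (simp add: algebra_simps)
qed simp

text \<open>
  Second differences are nonnegative, and only continuity is missing. The increment over \<open>d\<close> is at most \<open>1/n\<close> times the increment over \<open>n * d\<close>, to the right
  and, with reversed sign, to the left; local boundedness makes both small.
\<close>

lemma convex_on_if_wright_convex_bounded:
  fixes g :: "real \<Rightarrow> real"
  assumes W: "wright_convex g" and B: "\<And>R. \<exists>C. \<forall>x. \<bar>x\<bar> \<le> R \<longrightarrow> \<bar>g x\<bar> \<le> C"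
  shows "convex_on UNIV g"
proof (rule convex_on_if_second_differences)
  show "continuous_on UNIV g"
  proof (rule continuous_at_imp_continuous_on, rule ballI)
    fix x :: real
    obtain C where C: "\<And>y. \<bar>y\<bar> \<le> \<bar>x\<bar> + 2 \<Longrightarrow> \<bar>g y\<bar> \<le> C" using B by blast
    have step: "\<bar>g (a + d) - g a\<bar> \<le> 2 * C / real n"
      if "n > 0" "0 \<le> d" "real n * d \<le> 1" "\<bar>a\<bar> \<le> \<bar>x\<bar> + 1" for n d a
    proof -
      have nd: "0 \<le> real n * d" using that by simp
      have b: "\<bar>g (a + real n * d)\<bar> \<le> C" "\<bar>g (a - real n * d)\<bar> \<le> C" "\<bar>g a\<bar> \<le> C"
        using that nd by (intro C; linarith)+
      have "\<bar>real n * (g (a + d) - g a)\<bar> \<le> 2 * C"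
        using wright_convex_increments[OF W that(2), of n a]
          wright_convex_increments_left[OF W that(2), of a n] b by linarith
      then have "real n * \<bar>g (a + d) - g a\<bar> \<le> 2 * C" by (simp only: abs_mult abs_of_nat)
      then show ?thesis using that(1) by (simp add: field_simps)
    qed
    show "isCont g x"
      unfolding continuous_at_eps_delta
    proof (intro allI impI)
      fix e :: real assume e: "e > 0"
      obtain n :: nat where n0: "n > 0" and n: "2 * C / real n < e"
      proof -
        obtain k :: nat where "2 * C / e < real k" using reals_Archimedean2 by blast
        then have "2 * C / real (Suc k) < e" using e by (simp add: field_simps)
        then show ?thesis using that[of "Suc k"] by simp
      qed
      have "dist (g x') (g x) < e" if "dist x' x < 1 / real n" for x'
      proof (cases "x \<le> x'")
        case True
        then have "real n * (x' - x) \<le> 1" using that n0 by (simp add: dist_real_def field_simps)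
        then have "\<bar>g (x + (x' - x)) - g x\<bar> \<le> 2 * C / real n"
          using True n0 by (intro step) auto
        then show ?thesis using n by (simp add: dist_real_def)
      next
        case False
        then have q: "real n * (x - x') \<le> 1" using that n0 by (simp add: dist_real_def field_simps)
        have "1 / real n \<le> 1" using n0 by simp
        then have "\<bar>x'\<bar> \<le> \<bar>x\<bar> + 1" using that False by (simp add: dist_real_def)
        then have "\<bar>g (x' + (x - x')) - g x'\<bar> \<le> 2 * C / real n"
          using False n0 q by (intro step) auto
        then show ?thesis using n by (simp add: dist_real_def)
      qed
      then show "\<exists>d>0. \<forall>x'. dist x' x < d \<longrightarrow> dist (g x') (g x) < e"
        using n0 by (intro exI[of _ "1 / real n"]) auto
    qed
  qed
  fix x e :: real assume "e > 0"
  show "\<exists>d0>0. \<forall>d. 0 < d \<and> d < d0 \<longrightarrow> g (x + d) + g (x - d) - 2 * g x \<ge> - e * d\<^sup>2"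
  proof (intro exI[of _ 1] conjI allI impI)
    fix d :: real assume d: "0 < d \<and> d < 1"
    have "g (x - d + d) + g (x - d + d) \<le> g (x - d + d + d) + g (x - d)"
      using d by (intro wright_convexD[OF W]) auto
    moreover have "e * d\<^sup>2 \<ge> 0" using \<open>e > 0\<close> by simp
    ultimately show "g (x + d) + g (x - d) - 2 * g x \<ge> - e * d\<^sup>2" by simp
  qed simp
qed

text \<open>
  A Sierpinski type argument. The set where \<open>g\<close> exceeds \<open>n\<close> has small measure for large \<open>n\<close>, so for each \<open>t\<close> some
  \<open>u\<close> has both \<open>t + u\<close> and \<open>t - u\<close> outside of it, and midpoint convexity bounds \<open>g t\<close> from above. Reflection about
  the origin turns upper bounds into lower bounds.
\<close>

lemma wright_convex_measurable_bounded:
  fixes g :: "real \<Rightarrow> real"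
  assumes W: "wright_convex g" and M[measurable]: "g \<in> borel_measurable borel"
  shows "\<exists>C. \<forall>x. \<bar>x\<bar> \<le> R \<longrightarrow> \<bar>g x\<bar> \<le> C"
proof -
  have mid: "2 * g x \<le> g (x + u) + g (x - u)" for x u
  proof -
    have "2 * g x \<le> g (x + v) + g (x - v)" if "v \<ge> 0" for v
      using wright_convexD[OF W, of v v "x - v"] that by simp
    from this[of "\<bar>u\<bar>"] show ?thesis by (cases "u \<ge> 0") auto
  qed
  define S where "S = max R 1"
  have S: "S \<ge> R" "S > 0" by (auto simp: S_def)
  define A where "A = (\<lambda>n::nat. {x \<in> {-2*S..2*S}. g x > real n})"
  have Ameas[measurable]: "A n \<in> sets borel" for n unfolding A_def by measurable
  have "(\<lambda>n. emeasure lborel (A n)) \<longlonglongrightarrow> emeasure lborel (\<Inter>n. A n)"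
  proof (rule Lim_emeasure_decseq)
    show "range A \<subseteq> sets lborel" using Ameas by auto
    show "decseq A" unfolding A_def decseq_def by (auto intro: le_less_trans)
    fix n
    have "emeasure lborel (A n) \<le> emeasure lborel {-2*S..2*S}"
      by (rule emeasure_mono) (auto simp: A_def)
    also have "\<dots> < \<infinity>" using S by simp
    finally show "emeasure lborel (A n) \<noteq> \<infinity>" by auto
  qed
  moreover have "(\<Inter>n. A n) = {}"
  proof -
    have "\<exists>n. x \<notin> A n" for x
    proof -
      obtain n :: nat where "g x < real n" using reals_Archimedean2 by blast
      then show ?thesis by (intro exI[of _ n]) (auto simp: A_def)
    qed
    then show ?thesis by auto
  qed
  ultimately have "(\<lambda>n. emeasure lborel (A n)) \<longlonglongrightarrow> 0" by simp
  then have "eventually (\<lambda>n. emeasure lborel (A n) < ennreal (S / 2)) sequentially"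
    using S by (intro order_tendstoD) auto
  then obtain n where n: "emeasure lborel (A n) < ennreal (S / 2)"
    by (auto simp: eventually_sequentially)
  have upper: "g t \<le> real n" if t: "\<bar>t\<bar> \<le> S" for t
  proof -
    define B1 where "B1 = {u. t + u \<in> A n}"
    define B2 where "B2 = {u. t - u \<in> A n}"
    have m[measurable]: "B1 \<in> sets lborel" "B2 \<in> sets lborel"
      using measurable_sets[of "\<lambda>u. t + u" borel borel "A n"] measurable_sets[of "\<lambda>u. t - u" borel borel "A n"]
      by (auto simp: B1_def B2_def vimage_def)
    have "emeasure lborel (A n) = emeasure (distr lborel borel (\<lambda>u. t + u)) (A n)"
      by (subst lborel_distr_plus) simp
    also have "\<dots> = emeasure lborel B1" by (subst emeasure_distr) (auto simp: B1_def vimage_def)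
    finally have e1: "emeasure lborel B1 = emeasure lborel (A n)" ..
    have "emeasure lborel (A n) = emeasure (distr lborel borel (\<lambda>u. t + (-1) * u)) (A n)"
      using lborel_real_affine[of "-1" t] by (simp add: density_1)
    also have "\<dots> = emeasure lborel B2" by (subst emeasure_distr) (auto simp: B2_def vimage_def)
    finally have e2: "emeasure lborel B2 = emeasure lborel (A n)" ..
    have "\<not> {0..S} \<subseteq> B1 \<union> B2"
    proof
      assume "{0..S} \<subseteq> B1 \<union> B2"
      then have "emeasure lborel {0..S} \<le> emeasure lborel (B1 \<union> B2)"
        using m by (intro emeasure_mono) auto
      also have "\<dots> \<le> emeasure lborel B1 + emeasure lborel B2"
        using m by (intro emeasure_subadditive) auto
      also have "\<dots> < ennreal (S/2) + ennreal (S/2)"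
        unfolding e1 e2 using n by (intro add_strict_mono) auto
      finally show False using S by (simp flip: ennreal_plus)
    qed
    then obtain u where "u \<in> {0..S}" "u \<notin> B1" "u \<notin> B2" by blast
    then have u: "0 \<le> u" "u \<le> S" "t + u \<notin> A n" "t - u \<notin> A n"
      by (simp_all add: B1_def B2_def)
    then have "g (t + u) \<le> n" "g (t - u) \<le> n" using t by (auto simp: A_def)
    then show ?thesis using mid[of t u] by simp
  qed
  have "\<bar>g x\<bar> \<le> max (real n) (real n - 2 * g 0)" if "\<bar>x\<bar> \<le> R" for x
    using upper[of x] upper[of "-x"] mid[of 0 x] that S by auto
  then show ?thesis by blast
qed

lemma convex_on_UNIV_affine_minorant:
  fixes g :: "real \<Rightarrow> real"
  assumes "convex_on UNIV g"
  obtains c where "\<And>x. g x \<ge> - c * (1 + \<bar>x\<bar>)" "c \<ge> 0"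
proof -
  define c where "c = \<bar>g 0\<bar> + \<bar>g 1\<bar> + \<bar>g (-1)\<bar>"
  have key: "f x \<ge> f 0 - x * (f (-1) - f 0)" if f: "convex_on UNIV f" and x: "x \<ge> 0" for f :: "real \<Rightarrow> real" and x
  proof -
    have "f ((1 - x/(1+x)) *\<^sub>R x + (x/(1+x)) *\<^sub>R (-1)) \<le> (1 - x/(1+x)) * f x + (x/(1+x)) * f (-1)"
      using x by (intro convex_onD[OF f]) auto
    moreover have "(1 - x/(1+x)) *\<^sub>R x + (x/(1+x)) *\<^sub>R (-1) = 0" "1 - x/(1+x) = 1/(1+x)"
      using x by (simp_all add: field_simps)
    ultimately have "f 0 \<le> (f x + x * f (-1)) / (1+x)" by (simp add: add_divide_distrib)
    then have "f 0 * (1 + x) \<le> f x + x * f (-1)" using x by (subst (asm) pos_le_divide_eq) auto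
    then show ?thesis by (simp add: algebra_simps)
  qed
  have refl: "convex_on UNIV (\<lambda>x. g (- x))"
  proof (rule convex_onI)
    fix t x y :: real assume "0 < t" "t < 1"
    then show "g (- ((1 - t) *\<^sub>R x + t *\<^sub>R y)) \<le> (1 - t) * g (- x) + t * g (- y)"
      using convex_onD[OF assms, of t "-x" "-y"] by simp
  qed simp
  have "g x \<ge> - c * (1 + \<bar>x\<bar>)" for x
  proof (cases "x \<ge> 0")
    case True
    have "x * (g (-1) - g 0) \<le> x * c" using True by (intro mult_left_mono) (auto simp: c_def)
    then show ?thesis using key[OF assms True] True by (simp add: c_def algebra_simps)
  next
    case False
    then have "-x * (g 1 - g 0) \<le> -x * c" by (intro mult_left_mono) (auto simp: c_def)
    then show ?thesis using key[OF refl, of "-x"] False by (simp add: c_def algebra_simps)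
  qed
  then show ?thesis using that[of c] by (simp add: c_def)
qed

section \<open>Symmetric noise\<close>

lemma convex_on_midpoint:
  fixes f :: "real \<Rightarrow> real"
  assumes "convex_on UNIV f"
  shows "2 * f x \<le> f (x - d) + f (x + d)"
proof -
  have "f ((1 - 1/2) *\<^sub>R (x - d) + (1/2) *\<^sub>R (x + d)) \<le> (1 - 1/2) * f (x - d) + (1/2) * f (x + d)"
    by (rule convex_onD[OF assms]) auto
  moreover have "(1 - 1/2) *\<^sub>R (x - d) + (1/2) *\<^sub>R (x + d) = x" by (simp add: field_simps)
  ultimately show ?thesis by simp
qed

lemma continuous_locally_bounded:
  fixes g :: "real \<Rightarrow> real"
  assumes "continuous_on UNIV g"
  shows "\<exists>C. \<forall>y. \<bar>y\<bar> \<le> R \<longrightarrow> \<bar>g y\<bar> \<le> C"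
proof -
  have "compact (g ` {-R..R})"
    by (intro compact_continuous_image continuous_on_subset[OF assms]) auto
  then obtain C where C: "\<forall>x\<in>g ` {-R..R}. norm x \<le> C"
    using compact_imp_bounded bounded_iff by metis
  have "\<bar>g y\<bar> \<le> C" if "\<bar>y\<bar> \<le> R" for y
    using C that by (simp add: abs_le_iff)
  then show ?thesis by blast
qed

text \<open>
  The last assumption is the inequality version of Stein's identity: for the standard Gaussian
  law both sides agree, and confining it to a symmetric interval only adds a boundary term of the good sign. The
  measure need not be a probability, so that a Gaussian restricted to a window is covered.
\<close>

locale stein_noise = finite_measure \<nu> for \<nu> :: "real measure" +
  fixes S :: real
  assumes sets_noise[measurable_cong, simp]: "sets \<nu> = sets borel"
    and S_nonneg: "0 \<le> S"
    and noise_bounded: "AE z in \<nu>. \<bar>z\<bar> \<le> S"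
    and noise_symmetric: "distr \<nu> borel uminus = \<nu>"
    and stein: "\<And>p q. \<lbrakk>\<And>x. (p has_real_derivative q x) (at x); continuous_on UNIV q; \<And>x. 0 \<le> q x\<rbrakk>
        \<Longrightarrow> (\<integral>z. z * p z \<partial>\<nu>) \<le> (\<integral>z. q z \<partial>\<nu>)"
begin

lemma integrable_noise:
  fixes h :: "real \<Rightarrow> real"
  assumes "h \<in> borel_measurable borel" "\<And>z. \<bar>z\<bar> \<le> S \<Longrightarrow> \<bar>h z\<bar> \<le> C"
  shows "integrable \<nu> h"
  using noise_bounded assms by (intro integrable_const_bound[of _ C]) auto

lemma integrable_noise_continuous:
  fixes h :: "real \<Rightarrow> real"
  assumes "continuous_on UNIV h"
  shows "integrable \<nu> h"
proof -
  obtain C where "\<And>y. \<bar>y\<bar> \<le> S \<Longrightarrow> \<bar>h y\<bar> \<le> C"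
    using continuous_locally_bounded[OF assms] by blast
  then show ?thesis
    using borel_measurable_continuous_onI[OF assms] by (intro integrable_noise[of _ C]) auto
qed

lemma integral_noise_mono:
  fixes h k :: "real \<Rightarrow> real"
  assumes "integrable \<nu> h" "integrable \<nu> k" "\<And>z. \<bar>z\<bar> \<le> S \<Longrightarrow> h z \<le> k z"
  shows "(\<integral>z. h z \<partial>\<nu>) \<le> (\<integral>z. k z \<partial>\<nu>)"
  using noise_bounded assms by (intro integral_mono_AE) auto

lemma integral_noise_uminus:
  fixes h :: "real \<Rightarrow> real"
  assumes [measurable]: "h \<in> borel_measurable borel"
  shows "(\<integral>z. h (- z) \<partial>\<nu>) = (\<integral>z. h z \<partial>\<nu>)" "integrable \<nu> h \<Longrightarrow> integrable \<nu> (\<lambda>z. h (- z))"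
proof -
  have "(\<integral>z. h z \<partial>\<nu>) = (\<integral>z. h z \<partial>(distr \<nu> borel uminus))" by (simp add: noise_symmetric)
  also have "\<dots> = (\<integral>z. h (- z) \<partial>\<nu>)" by (rule integral_distr) auto
  finally show "(\<integral>z. h (- z) \<partial>\<nu>) = (\<integral>z. h z \<partial>\<nu>)" ..
next
  assume "integrable \<nu> h"
  then have "integrable (distr \<nu> borel uminus) h" by (simp add: noise_symmetric)
  then show "integrable \<nu> (\<lambda>z. h (- z))" by (subst (asm) integrable_distr_eq) auto
qed

lemma integral_noise_mono_symmetric:
  fixes h k :: "real \<Rightarrow> real"
  assumes [measurable]: "h \<in> borel_measurable borel" "k \<in> borel_measurable borel"
    and I: "integrable \<nu> h" "integrable \<nu> k"
    and le: "\<And>z. 0 \<le> z \<Longrightarrow> z \<le> S \<Longrightarrow> h z + h (- z) \<le> k z + k (- z)"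
  shows "(\<integral>z. h z \<partial>\<nu>) \<le> (\<integral>z. k z \<partial>\<nu>)"
proof -
  have *: "(\<integral>z. f z + f (- z) \<partial>\<nu>) = 2 * (\<integral>z. f z \<partial>\<nu>)" "integrable \<nu> (\<lambda>z. f z + f (- z))"
    if "f \<in> borel_measurable borel" "integrable \<nu> f" for f :: "real \<Rightarrow> real"
    using integral_noise_uminus[OF that(1)] that(2) by (auto simp: Bochner_Integration.integral_add)
  have "(\<integral>z. h z + h (- z) \<partial>\<nu>) \<le> (\<integral>z. k z + k (- z) \<partial>\<nu>)"
  proof (rule integral_noise_mono)
    fix z :: real assume "\<bar>z\<bar> \<le> S"
    then show "h z + h (- z) \<le> k z + k (- z)"
      using le[of z] le[of "-z"] by (cases "z \<ge> 0") auto
  qed (use * I in auto)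
  then show ?thesis using * I by auto
qed

end

lemma convex_on_pointwise_limit:
  fixes u :: "nat \<Rightarrow> real \<Rightarrow> real"
  assumes "\<And>n. convex_on UNIV (u n)" "\<And>x. (\<lambda>n. u n x) \<longlonglongrightarrow> w x"
  shows "convex_on UNIV w"
proof (rule convex_onI)
  fix t x y :: real assume t: "0 < t" "t < 1"
  show "w ((1 - t) *\<^sub>R x + t *\<^sub>R y) \<le> (1 - t) * w x + t * w y"
  proof (rule LIMSEQ_le)
    show "(\<lambda>n. u n ((1 - t) *\<^sub>R x + t *\<^sub>R y)) \<longlonglongrightarrow> w ((1 - t) *\<^sub>R x + t *\<^sub>R y)" by (rule assms)
    show "(\<lambda>n. (1 - t) * u n x + t * u n y) \<longlonglongrightarrow> (1 - t) * w x + t * w y"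
      by (intro tendsto_intros assms)
    show "\<exists>N. \<forall>n\<ge>N. u n ((1 - t) *\<^sub>R x + t *\<^sub>R y) \<le> (1 - t) * u n x + t * u n y"
      using convex_onD[OF assms(1)] t by auto
  qed
qed simp

lemma continuous_has_antiderivative:
  fixes g :: "real \<Rightarrow> real"
  assumes "continuous_on UNIV g"
  obtains F where "\<And>x. (F has_real_derivative g x) (at x)"
proof
  fix x :: real
  have "((\<lambda>x. LBINT y=ereal 0..ereal x. g y) has_vector_derivative g x) (at x within {-\<bar>x\<bar>-1..\<bar>x\<bar>+1})"
    by (rule interval_integral_FTC2) (auto intro: continuous_on_subset[OF assms])
  moreover have "at x within {-\<bar>x\<bar>-1..\<bar>x\<bar>+1} = at x"
    by (rule at_within_interior) auto
  ultimately show "((\<lambda>x. LBINT y=ereal 0..ereal x. g y) has_real_derivative g x) (at x)"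
    by (simp add: has_real_derivative_iff_has_vector_derivative)
qed

text \<open>
  With \<open>H'' = g\<close>, the divided second difference \<open>(H (x + 2*e) - 2 * H (x + e) + H x) / e\<^sup>2\<close> does it: its
  second derivative is the divided second difference of \<open>g\<close>, nonnegative by convexity, and the mean value
  theorem, applied twice, turns it into a value of \<open>g\<close> near \<open>x\<close>.
\<close>

lemma convex_smoothing:
  fixes g :: "real \<Rightarrow> real"
  assumes g: "convex_on UNIV g" and e: "e > 0"
  obtains G G1 G2 where
    "\<And>x. (G has_real_derivative G1 x) (at x)" "\<And>x. (G1 has_real_derivative G2 x) (at x)"
    "continuous_on UNIV G2" "\<And>x. 0 \<le> G2 x" "mono g \<Longrightarrow> (\<forall>x. 0 \<le> G1 x)"
    "\<And>x. \<exists>y\<in>{x..x+2*e}. G x = g y"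
proof -
  have cont: "continuous_on UNIV g" by (rule convex_on_continuous[OF open_UNIV g])
  obtain F where F: "\<And>x. (F has_real_derivative g x) (at x)"
    using continuous_has_antiderivative[OF cont] by blast
  then have "continuous_on UNIV F" by (meson DERIV_isCont continuous_at_imp_continuous_on)
  then obtain H where H: "\<And>x. (H has_real_derivative F x) (at x)"
    using continuous_has_antiderivative by blast
  have sh: "((\<lambda>x. f (x + c)) has_real_derivative f' (x + c)) (at x)"
    if "\<And>x. (f has_real_derivative f' x) (at x)" for f f' :: "real \<Rightarrow> real" and c x
    using that[of "x + c"] by (simp add: DERIV_shift)
  let ?D = "\<lambda>f x. (f (x + 2*e) - 2 * f (x + e) + f x) / e\<^sup>2"
  have D: "(?D f has_real_derivative ?D f' x) (at x)"
    if f: "\<And>x. (f has_real_derivative f' x) (at x)" for f f' :: "real \<Rightarrow> real" and x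
    by (intro DERIV_cdivide DERIV_add DERIV_diff DERIV_cmult sh[OF f] f)
  have mvt: "\<exists>y\<in>{x..x+e}. f (x + e) - f x = e * f' y" if "\<And>x. (f has_real_derivative f' x) (at x)"
    for f f' :: "real \<Rightarrow> real" and x
    using MVT2[of x "x + e" f f'] that e by force
  show ?thesis
  proof (rule that[of "?D H" "?D F" "?D g"])
    show "continuous_on UNIV (?D g)"
      by (intro continuous_intros continuous_on_compose2[OF cont]) (use e in auto)
    fix x
    show "0 \<le> ?D g x" using convex_on_midpoint[OF g, of "x + e" e] by (simp add: algebra_simps)
    obtain y where y: "y \<in> {x..x+e}" "(H (x + e + e) - H (x + e)) - (H (x + e) - H x) = e * (F (y + e) - F y)"
      using mvt[of "\<lambda>x. H (x + e) - H x" "\<lambda>x. F (x + e) - F x" x] DERIV_diff[OF sh[OF H] H] by blast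
    obtain y' where y': "y' \<in> {y..y+e}" "F (y + e) - F y = e * g y'" using mvt[OF F] by blast
    have "?D H x = ((H (x + e + e) - H (x + e)) - (H (x + e) - H x)) / e\<^sup>2" by (simp add: add.assoc)
    also have "\<dots> = g y'" using y y' e by (simp add: power2_eq_square)
    finally show "\<exists>y\<in>{x..x+2*e}. ?D H x = g y" using y y' by (intro bexI[of _ y']) auto
  next
    assume mg: "mono g"
    show "\<forall>x. 0 \<le> ?D F x"
    proof
      fix x
      obtain y where y: "y \<in> {x..x+e}" "(F (x + e + e) - F (x + e)) - (F (x + e) - F x) = e * (g (y + e) - g y)"
        using mvt[of "\<lambda>x. F (x + e) - F x" "\<lambda>x. g (x + e) - g x" x] DERIV_diff[OF sh[OF F] F] by blast
      have "?D F x = ((F (x + e + e) - F (x + e)) - (F (x + e) - F x)) / e\<^sup>2" by (simp add: add.assoc)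
      also have "\<dots> \<ge> 0" using y e monoD[OF mg, of y "y + e"] by simp
      finally show "0 \<le> ?D F x" .
    qed
  qed (use D H F in auto)
qed

lemma taylor2_lower:
  fixes g g1 g2 :: "real \<Rightarrow> real"
  assumes g: "\<And>x. (g has_real_derivative g1 x) (at x)" "\<And>x. (g1 has_real_derivative g2 x) (at x)"
    and near: "\<And>t. \<bar>t - v\<bar> \<le> \<bar>D\<bar> \<Longrightarrow> g2 t \<ge> g2 v - e"
  shows "g (v + D) \<ge> g v + g1 v * D + (g2 v - e) / 2 * D\<^sup>2"
proof (cases "D = 0")
  case False
  define df where "df = (\<lambda>n::nat. if n = 0 then g else if n = 1 then g1 else g2)"
  have "\<exists>t. (if v + D < v then v + D < t \<and> t < v else v < t \<and> t < v + D) \<and>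
     g (v + D) = (\<Sum>m<2. df m v / fact m * (v + D - v)^m) + df 2 t / fact 2 * (v + D - v)^2"
    by (rule Taylor[of 2 df g "v - \<bar>D\<bar>" "v + \<bar>D\<bar>" v "v + D"])
      (use False g in \<open>auto simp: df_def less_Suc_eq numeral_2_eq_2\<close>)
  then obtain t where t0: "if v + D < v then v + D < t \<and> t < v else v < t \<and> t < v + D"
    and t1: "g (v + D) = (\<Sum>m<2. df m v / fact m * (v + D - v)^m) + df 2 t / fact 2 * (v + D - v)^2"
    by blast
  have t: "\<bar>t - v\<bar> \<le> \<bar>D\<bar>" "g (v + D) = (\<Sum>m<2. df m v / fact m * D^m) + df 2 t / fact 2 * D^2"
    using t0 t1 by (auto split: if_splits)
  have "(g2 v - e) / 2 * D\<^sup>2 \<le> g2 t / 2 * D\<^sup>2"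
    using near[OF t(1)] by (intro mult_right_mono) auto
  moreover have "g (v + D) = g v + g1 v * D + g2 t / 2 * D\<^sup>2"
    using t(2) by (simp add: df_def numeral_2_eq_2)
  ultimately show ?thesis by simp
qed simp

context stein_noise
begin

lemma continuous_noise_average:
  fixes g m s :: "real \<Rightarrow> real"
  assumes g: "continuous_on UNIV g" and m: "continuous_on UNIV m" and s: "continuous_on UNIV s"
  shows "continuous_on UNIV (\<lambda>x. \<integral>z. g (m x + s x * z) \<partial>\<nu>)"
proof (rule continuous_at_imp_continuous_on, rule ballI)
  fix x :: real
  show "isCont (\<lambda>x. \<integral>z. g (m x + s x * z) \<partial>\<nu>) x"
    unfolding continuous_within_sequentially o_def
  proof (intro allI impI)
    fix xs :: "nat \<Rightarrow> real" assume "(\<forall>n. xs n \<in> UNIV) \<and> xs \<longlonglongrightarrow> x"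
    then have xs: "xs \<longlonglongrightarrow> x" by simp
    have mx: "(\<lambda>n. m (xs n)) \<longlonglongrightarrow> m x" "(\<lambda>n. s (xs n)) \<longlonglongrightarrow> s x"
      using m s xs by (auto simp: continuous_on_tendsto_compose[where s = UNIV])
    obtain B1 where B1: "\<And>n. \<bar>m (xs n)\<bar> \<le> B1"
      using convergent_imp_Bseq[OF convergentI[OF mx(1)]] by (auto simp: Bseq_def)
    obtain B2 where B2: "\<And>n. \<bar>s (xs n)\<bar> \<le> B2"
      using convergent_imp_Bseq[OF convergentI[OF mx(2)]] by (auto simp: Bseq_def)
    define R where "R = B1 + B2 * S"
    obtain C where C: "\<And>y. \<bar>y\<bar> \<le> R \<Longrightarrow> \<bar>g y\<bar> \<le> C"
      using continuous_locally_bounded[OF g] by blast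
    have R: "\<bar>m (xs n) + s (xs n) * z\<bar> \<le> R" if "\<bar>z\<bar> \<le> S" for n z
    proof -
      have "\<bar>s (xs n) * z\<bar> \<le> B2 * S" unfolding abs_mult
        using B2[of n] that by (intro mult_mono) auto
      then show ?thesis using B1[of n] unfolding R_def by linarith
    qed
    show "(\<lambda>n. \<integral>z. g (m (xs n) + s (xs n) * z) \<partial>\<nu>) \<longlonglongrightarrow> (\<integral>z. g (m x + s x * z) \<partial>\<nu>)"
    proof (rule integral_dominated_convergence[where w = "\<lambda>_. C"])
      show "AE z in \<nu>. (\<lambda>n. g (m (xs n) + s (xs n) * z)) \<longlonglongrightarrow> g (m x + s x * z)"
        by (intro AE_I2 continuous_on_tendsto_compose[OF g] tendsto_intros mx) auto
      show "AE z in \<nu>. norm (g (m (xs n) + s (xs n) * z)) \<le> C" for n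
        using noise_bounded C R by auto
      note [measurable] = borel_measurable_continuous_onI[OF g]
      show "(\<lambda>z. g (m x + s x * z)) \<in> borel_measurable \<nu>" by measurable
      show "(\<lambda>z. g (m (xs n) + s (xs n) * z)) \<in> borel_measurable \<nu>" for n by measurable
    qed auto
  qed
qed

text \<open>
  The second difference at \<open>x\<close> with step \<open>d\<close> is expanded to second order around the points \<open>v x z\<close>. The
  quadratic terms contribute at least \<open>\<kappa>\<^sup>2 * d\<^sup>2 * B\<close> with \<open>B = \<integral>g2\<close>, because both increments have size at least \<open>\<kappa> * d\<close>. The
  first order terms are \<open>M * E\<close>, nonnegative, and \<open>k * A\<close>, where \<open>k\<close> is the second difference of \<open>s\<close> and \<open>A = \<integral>z * g1\<close>. The
  noise enters through \<open>A\<close>, which Stein's inequality places between \<open>0\<close> and \<open>s x * B\<close>; and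
  \<open>s x * k \<ge> - (\<alpha> + L\<^sup>2) * d\<^sup>2\<close> holds even where \<open>s\<close> is not differentiable.
\<close>

lemma noise_average_convex_smooth:
  fixes g g1 g2 m s :: "real \<Rightarrow> real"
  assumes g: "\<And>x. (g has_real_derivative g1 x) (at x)" "\<And>x. (g1 has_real_derivative g2 x) (at x)"
    and g2: "continuous_on UNIV g2" "\<And>x. 0 \<le> g2 x"
    and drift: "((\<forall>x. 0 \<le> g1 x) \<and> convex_on UNIV m) \<or> (\<exists>a b. \<forall>x. m x = a + b * x)"
    and m: "\<And>x y. \<bar>m x - m y\<bar> \<le> Lm * \<bar>x - y\<bar>" and s: "\<And>x y. \<bar>s x - s y\<bar> \<le> L * \<bar>x - y\<bar>"
    and s2: "convex_on UNIV (\<lambda>x. (s x)\<^sup>2 + \<alpha> * x\<^sup>2)" and kap: "0 \<le> \<alpha>" "\<alpha> + L\<^sup>2 \<le> \<kappa>\<^sup>2" "0 \<le> \<kappa>"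
    and inc: "\<And>x y z. x \<le> y \<Longrightarrow> \<bar>z\<bar> \<le> S \<Longrightarrow> \<kappa> * (y - x) \<le> (m y + s y * z) - (m x + s x * z)"
  shows "convex_on UNIV (\<lambda>x. \<integral>z. g (m x + s x * z) \<partial>\<nu>)"
proof (rule convex_on_if_second_differences)
  have Lm0: "Lm \<ge> 0" using m[of 1 0] by simp
  have L0: "L \<ge> 0" using s[of 1 0] by simp
  have lip_cont: "continuous_on UNIV f" if "\<And>x y. \<bar>f x - f y\<bar> \<le> K * \<bar>x - y\<bar>" "K \<ge> 0" for f :: "real \<Rightarrow> real" and K
    using that by (intro lipschitz_on_continuous_on[of K]) (auto simp: lipschitz_on_def dist_real_def)
  have mc: "continuous_on UNIV m" and sc: "continuous_on UNIV s"
    using lip_cont m s Lm0 L0 by blast+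
  have gc: "continuous_on UNIV g" "continuous_on UNIV g1"
    using g by (meson DERIV_isCont continuous_at_imp_continuous_on)+
  show "continuous_on UNIV (\<lambda>x. \<integral>z. g (m x + s x * z) \<partial>\<nu>)"
    by (rule continuous_noise_average[OF gc(1) mc sc])
  fix x e :: real assume e: "e > 0"
  define K where "K = Lm + L * S"
  define V where "V = measure \<nu> (space \<nu>)"
  have K0: "K \<ge> 0" "V \<ge> 0" using Lm0 L0 S_nonneg by (auto simp: K_def V_def)
  \<comment> \<open>tolerance for the oscillation of \<open>g2\<close>; the \<open>1\<close> prevents a division by zero\<close>
  define \<epsilon> where "\<epsilon> = e / (K\<^sup>2 * V + 1)"
  have KV: "K\<^sup>2 * V + 1 > 0" using K0 by (smt (verit) mult_nonneg_nonneg zero_le_power2)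
  then have eps: "\<epsilon> > 0" "\<epsilon> * (K\<^sup>2 * V) \<le> e" using e K0
    by (auto simp: \<epsilon>_def field_simps)
  define v where "v = (\<lambda>y z. m y + s y * z)"
  have vK: "\<bar>v y z - v x z\<bar> \<le> K * \<bar>y - x\<bar>" if "\<bar>z\<bar> \<le> S" for y z
  proof -
    have "\<bar>(s y - s x) * z\<bar> \<le> (L * \<bar>y - x\<bar>) * S" unfolding abs_mult
      using s[of y x] that by (intro mult_mono) auto
    moreover have "v y z - v x z = (m y - m x) + (s y - s x) * z" by (simp add: v_def algebra_simps)
    ultimately show ?thesis using m[of y x] by (simp add: K_def algebra_simps)
  qed
  define R where "R = \<bar>m x\<bar> + \<bar>s x\<bar> * S + K"
  have vx: "\<bar>v x z\<bar> \<le> R - K" if "\<bar>z\<bar> \<le> S" for z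
  proof -
    have "\<bar>s x * z\<bar> \<le> \<bar>s x\<bar> * S" unfolding abs_mult using that by (intro mult_left_mono) auto
    then show ?thesis unfolding v_def R_def by linarith
  qed
  have "uniformly_continuous_on {-R..R} g2"
    by (intro compact_uniformly_continuous continuous_on_subset[OF g2(1)]) auto
  then obtain \<eta> where eta: "\<eta> > 0" and unif: "\<And>a b. a \<in> {-R..R} \<Longrightarrow> b \<in> {-R..R} \<Longrightarrow> \<bar>a - b\<bar> < \<eta> \<Longrightarrow> \<bar>g2 a - g2 b\<bar> < \<epsilon>"
    using eps(1) unfolding uniformly_continuous_on_def dist_real_def by blast
  define d0 where "d0 = min 1 (\<eta> / (K + 1))"
  have d0: "d0 > 0" using eta K0 by (simp add: d0_def)
  show "\<exists>d0>0. \<forall>d. 0 < d \<and> d < d0 \<longrightarrow>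
      (\<integral>z. g (m (x + d) + s (x + d) * z) \<partial>\<nu>) + (\<integral>z. g (m (x - d) + s (x - d) * z) \<partial>\<nu>)
        - 2 * (\<integral>z. g (m x + s x * z) \<partial>\<nu>) \<ge> - e * d\<^sup>2"
  proof (intro exI[of _ d0] conjI allI impI d0)
    fix d :: real assume "0 < d \<and> d < d0"
    then have d: "0 < d" "d < 1" "d < \<eta> / (K + 1)" by (auto simp: d0_def)
    have "(K + 1) * d < \<eta>" using d K0 by (simp add: field_simps)
    then have Kd: "K * d < \<eta>" "K * d \<le> K" using d K0 by (auto simp: algebra_simps mult_left_le)
    define M where "M = m (x + d) + m (x - d) - 2 * m x"
    define k where "k = s (x + d) + s (x - d) - 2 * s x"
    have pt: "g1 (v x z) * (M + z * k) + g2 (v x z) * (\<kappa>\<^sup>2 * d\<^sup>2) - \<epsilon> * (K\<^sup>2 * d\<^sup>2)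
        \<le> g (v (x + d) z) + g (v (x - d) z) - 2 * g (v x z)" if z: "\<bar>z\<bar> \<le> S" for z
    proof -
      define D1 where "D1 = v (x + d) z - v x z"
      define D2 where "D2 = v (x - d) z - v x z"
      have b: "\<bar>D1\<bar> \<le> K * d" "\<bar>D2\<bar> \<le> K * d"
        using vK[OF z, of "x + d"] vK[OF z, of "x - d"] d by (auto simp: D1_def D2_def)
      have low: "\<kappa> * d \<le> D1" "\<kappa> * d \<le> - D2"
        using inc[OF _ z, of x "x + d"] inc[OF _ z, of "x - d" x] d by (auto simp: D1_def D2_def v_def)
      have near: "g2 t \<ge> g2 (v x z) - \<epsilon>" if "\<bar>t - v x z\<bar> \<le> K * d" for t
      proof -
        have "\<bar>t\<bar> \<le> R" "\<bar>v x z\<bar> \<le> R" using vx[OF z] that Kd K0 by linarith+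
        moreover have "\<bar>t - v x z\<bar> < \<eta>" using that Kd by simp
        ultimately have "\<bar>g2 t - g2 (v x z)\<bar> < \<epsilon>" by (intro unif) (auto simp: abs_le_iff)
        then show ?thesis by simp
      qed
      have T1: "g (v x z + D1) \<ge> g (v x z) + g1 (v x z) * D1 + (g2 (v x z) - \<epsilon>) / 2 * D1\<^sup>2"
        by (rule taylor2_lower[OF g]) (use near b in auto)
      have T2: "g (v x z + D2) \<ge> g (v x z) + g1 (v x z) * D2 + (g2 (v x z) - \<epsilon>) / 2 * D2\<^sup>2"
        by (rule taylor2_lower[OF g]) (use near b in auto)
      have sum: "D1 + D2 = M + z * k" by (simp add: D1_def D2_def v_def M_def k_def algebra_simps)
      have "(\<kappa> * d)\<^sup>2 \<le> D1\<^sup>2" "(\<kappa> * d)\<^sup>2 \<le> (- D2)\<^sup>2"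
        using low kap d by (intro power_mono; simp)+
      then have "g2 (v x z) * ((\<kappa> * d)\<^sup>2 + (\<kappa> * d)\<^sup>2) \<le> g2 (v x z) * (D1\<^sup>2 + D2\<^sup>2)"
        by (intro mult_left_mono g2) auto
      moreover have "D1\<^sup>2 \<le> (K * d)\<^sup>2" "D2\<^sup>2 \<le> (K * d)\<^sup>2"
        using b by (metis abs_ge_zero power2_abs power_mono)+
      then have "\<epsilon> * (D1\<^sup>2 + D2\<^sup>2) \<le> \<epsilon> * ((K * d)\<^sup>2 + (K * d)\<^sup>2)"
        using eps by (intro mult_left_mono) auto
      ultimately have "g2 (v x z) * (\<kappa>\<^sup>2 * d\<^sup>2) - \<epsilon> * (K\<^sup>2 * d\<^sup>2) \<le> (g2 (v x z) - \<epsilon>) / 2 * D1\<^sup>2 + (g2 (v x z) - \<epsilon>) / 2 * D2\<^sup>2"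
        by (simp add: power_mult_distrib field_simps)
      moreover have "g1 (v x z) * (M + z * k) = g1 (v x z) * D1 + g1 (v x z) * D2"
        by (simp flip: sum add: distrib_left)
      ultimately show ?thesis using T1 T2 unfolding D1_def D2_def by simp
    qed
    have vc: "continuous_on UNIV (\<lambda>z. f (v y z))" if "continuous_on UNIV f" for f :: "real \<Rightarrow> real" and y
      unfolding v_def by (intro continuous_on_compose2[OF that] continuous_intros) auto
    have I: "integrable \<nu> (\<lambda>z. g (v y z))" "integrable \<nu> (\<lambda>z. g1 (v y z))" "integrable \<nu> (\<lambda>z. g2 (v y z))"
      "integrable \<nu> (\<lambda>z. z * g1 (v y z))" "integrable \<nu> (\<lambda>z. z)" for y
      by (intro integrable_noise_continuous continuous_intros vc gc g2)+
    define A where "A = (\<integral>z. z * g1 (v x z) \<partial>\<nu>)"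
    define B where "B = (\<integral>z. g2 (v x z) \<partial>\<nu>)"
    define E where "E = (\<integral>z. g1 (v x z) \<partial>\<nu>)"
    have "(\<integral>z. M * g1 (v x z) + k * (z * g1 (v x z)) + (\<kappa>\<^sup>2 * d\<^sup>2) * g2 (v x z) - \<epsilon> * (K\<^sup>2 * d\<^sup>2) \<partial>\<nu>)
       \<le> (\<integral>z. g (v (x + d) z) + g (v (x - d) z) - 2 * g (v x z) \<partial>\<nu>)"
    proof (rule integral_noise_mono)
      show "integrable \<nu> (\<lambda>z. M * g1 (v x z) + k * (z * g1 (v x z)) + (\<kappa>\<^sup>2 * d\<^sup>2) * g2 (v x z) - \<epsilon> * (K\<^sup>2 * d\<^sup>2))"
        by (intro Bochner_Integration.integrable_add Bochner_Integration.integrable_diff integrable_mult_right I) auto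
      show "integrable \<nu> (\<lambda>z. g (v (x + d) z) + g (v (x - d) z) - 2 * g (v x z))"
        by (intro Bochner_Integration.integrable_add Bochner_Integration.integrable_diff integrable_mult_right I)
    qed (use pt in \<open>simp add: algebra_simps\<close>)
    then have main: "M * E + k * A + (\<kappa>\<^sup>2 * d\<^sup>2) * B - V * (\<epsilon> * (K\<^sup>2 * d\<^sup>2))
       \<le> (\<integral>z. g (v (x + d) z) \<partial>\<nu>) + (\<integral>z. g (v (x - d) z) \<partial>\<nu>) - 2 * (\<integral>z. g (v x z) \<partial>\<nu>)"
      using I by (simp add: A_def B_def E_def V_def)
    have ME: "M * E \<ge> 0"
      using drift
    proof
      assume a: "(\<forall>x. 0 \<le> g1 x) \<and> convex_on UNIV m"
      then have "M \<ge> 0" using convex_on_midpoint[of m x d] by (simp add: M_def)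
      then show ?thesis using a by (simp add: E_def)
    next
      assume "\<exists>a b. \<forall>x. m x = a + b * x"
      then have "M = 0" by (auto simp: M_def algebra_simps)
      then show ?thesis by simp
    qed
    have B0: "B \<ge> 0" using g2 by (simp add: B_def)
    \<comment> \<open>the semiconvexity of \<open>s\<^sup>2\<close>, with \<open>2 * a * (b - a) = b\<^sup>2 - a\<^sup>2 - (b - a)\<^sup>2\<close> at both neighbours of \<open>x\<close>\<close>
    have sk: "s x * k \<ge> - (\<alpha> + L\<^sup>2) * d\<^sup>2"
    proof -
      have "2 * (s x)\<^sup>2 \<le> (s (x - d))\<^sup>2 + (s (x + d))\<^sup>2 + 2 * \<alpha> * d\<^sup>2"
        using convex_on_midpoint[OF s2, of x d] by (simp add: power2_eq_square algebra_simps)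
      moreover have "(s y - s x)\<^sup>2 \<le> (L * d)\<^sup>2" if "\<bar>y - x\<bar> = d" for y
        using s[of y x] that by (metis abs_ge_zero power2_abs power_mono)
      from this[of "x + d"] this[of "x - d"] d
      have "(s (x + d) - s x)\<^sup>2 \<le> L\<^sup>2 * d\<^sup>2" "(s (x - d) - s x)\<^sup>2 \<le> L\<^sup>2 * d\<^sup>2"
        by (auto simp: power_mult_distrib)
      ultimately show ?thesis by (simp add: k_def power2_eq_square algebra_simps)
    qed
    have kA: "k * A \<ge> - (\<alpha> + L\<^sup>2) * d\<^sup>2 * B"
    proof (cases "s x = 0")
      case True
      have "(\<integral>z. - z \<partial>\<nu>) = (\<integral>z. z \<partial>\<nu>)" by (rule integral_noise_uminus) auto
      then have "(\<integral>z. z \<partial>\<nu>) = 0" by simp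
      then have "A = 0" using True by (simp add: A_def v_def)
      moreover have "0 \<le> (\<alpha> + L\<^sup>2) * d\<^sup>2 * B" using B0 kap by simp
      ultimately show ?thesis by (simp only: mult_minus_left mult_zero_right neg_le_0_iff_le)
    next
      case False
      have "(\<integral>z. z * (s x * g1 (v x z)) \<partial>\<nu>) \<le> (\<integral>z. s x * (g2 (v x z) * s x) \<partial>\<nu>)"
      proof (rule stein)
        show "((\<lambda>z. s x * g1 (v x z)) has_real_derivative s x * (g2 (v x z) * s x)) (at z)" for z
          unfolding v_def by (intro DERIV_cmult DERIV_chain'[OF _ g(2)]) (auto intro!: derivative_eq_intros)
        show "continuous_on UNIV (\<lambda>z. s x * (g2 (v x z) * s x))" by (intro continuous_intros vc g2)
        show "0 \<le> s x * (g2 (v x z) * s x)" for z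
        proof -
          have "0 \<le> g2 (v x z) * (s x * s x)" using g2(2) by simp
          then show ?thesis by (simp add: ac_simps)
        qed
      qed
      moreover have "(\<lambda>z. z * (s x * g1 (v x z))) = (\<lambda>z. s x * (z * g1 (v x z)))"
        "(\<lambda>z. s x * (g2 (v x z) * s x)) = (\<lambda>z. (s x)\<^sup>2 * g2 (v x z))"
        by (auto simp: power2_eq_square fun_eq_iff)
      ultimately have up: "s x * A \<le> (s x)\<^sup>2 * B"
        using I by (simp add: A_def B_def)
      have "(\<integral>z. (0::real) \<partial>\<nu>) \<le> (\<integral>z. s x * (z * g1 (v x z)) \<partial>\<nu>)"
      proof (rule integral_noise_mono_symmetric)
        show "(\<lambda>z. s x * (z * g1 (v x z))) \<in> borel_measurable borel"
          by (intro borel_measurable_continuous_onI continuous_intros vc gc)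
        fix z :: real assume z: "0 \<le> z" "z \<le> S"
        have mono: "a \<le> b \<Longrightarrow> g1 a \<le> g1 b" for a b
          using g(2) g2(2) by (metis DERIV_nonneg_imp_nondecreasing)
        have "0 \<le> s x * (g1 (v x z) - g1 (v x (- z)))"
        proof (cases "s x \<ge> 0")
          case True
          then have "v x (- z) \<le> v x z" using z by (simp add: v_def)
          then show ?thesis using mono True by simp
        next
          case False
          then have "v x z \<le> v x (- z)" using z by (simp add: v_def mult_nonpos_nonneg)
          then show ?thesis using mono False by (simp add: mult_nonpos_nonpos)
        qed
        then have "0 \<le> z * (s x * (g1 (v x z) - g1 (v x (- z))))" using z by simp
        then show "0 + 0 \<le> s x * (z * g1 (v x z)) + s x * (- z * g1 (v x (- z)))"
          by (simp add: algebra_simps)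
      next
        show "integrable \<nu> (\<lambda>z. s x * (z * g1 (v x z)))" by (intro integrable_mult_right I)
      qed simp_all
      then have lo: "0 \<le> s x * A" using I by (simp add: A_def)
      \<comment> \<open>\<open>J = A / s x\<close>, written so that its sign does not depend on that of \<open>s x\<close>\<close>
      define J where "J = s x * A / (s x)\<^sup>2"
      have s2pos: "(s x)\<^sup>2 > 0" using False by simp
      have J: "0 \<le> J" "J \<le> B" using lo up s2pos by (auto simp: J_def divide_le_eq mult.commute)
      have "A = s x * J" using False by (simp add: J_def power2_eq_square)
      then have "k * A = (s x * k) * J" by simp
      moreover have "(- (\<alpha> + L\<^sup>2) * d\<^sup>2) * J \<le> (s x * k) * J" using sk J by (intro mult_right_mono) auto
      moreover have "(\<alpha> + L\<^sup>2) * d\<^sup>2 * J \<le> (\<alpha> + L\<^sup>2) * d\<^sup>2 * B" using J kap by (intro mult_left_mono) auto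
      ultimately show ?thesis by (simp only: mult_minus_left)
    qed
    have "(\<alpha> + L\<^sup>2) * (d\<^sup>2 * B) \<le> \<kappa>\<^sup>2 * (d\<^sup>2 * B)" using kap B0 by (intro mult_right_mono) auto
    moreover have "\<epsilon> * (K\<^sup>2 * V) * d\<^sup>2 \<le> e * d\<^sup>2" using eps by (intro mult_right_mono) auto
    ultimately show "(\<integral>z. g (m (x + d) + s (x + d) * z) \<partial>\<nu>) + (\<integral>z. g (m (x - d) + s (x - d) * z) \<partial>\<nu>)
        - 2 * (\<integral>z. g (m x + s x * z) \<partial>\<nu>) \<ge> - e * d\<^sup>2"
      using main ME kA by (simp add: v_def algebra_simps)
  qed
qed

text \<open>
  Smoothing reduces to twice differentiable \<open>g\<close>, since pointwise limits of convex functions are convex.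
\<close>

lemma noise_average_convex:
  fixes g m s :: "real \<Rightarrow> real"
  assumes g: "convex_on UNIV g"
    and drift: "(mono g \<and> convex_on UNIV m) \<or> (\<exists>a b. \<forall>x. m x = a + b * x)"
    and m: "\<And>x y. \<bar>m x - m y\<bar> \<le> Lm * \<bar>x - y\<bar>" and s: "\<And>x y. \<bar>s x - s y\<bar> \<le> L * \<bar>x - y\<bar>"
    and s2: "convex_on UNIV (\<lambda>x. (s x)\<^sup>2 + \<alpha> * x\<^sup>2)" and kap: "0 \<le> \<alpha>" "\<alpha> + L\<^sup>2 \<le> \<kappa>\<^sup>2" "0 \<le> \<kappa>"
    and inc: "\<And>x y z. x \<le> y \<Longrightarrow> \<bar>z\<bar> \<le> S \<Longrightarrow> \<kappa> * (y - x) \<le> (m y + s y * z) - (m x + s x * z)"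
  shows "convex_on UNIV (\<lambda>x. \<integral>z. g (m x + s x * z) \<partial>\<nu>)"
proof -
  have gc: "continuous_on UNIV g" by (rule convex_on_continuous[OF open_UNIV g])
  have "\<exists>G G1 G2. (\<forall>x. (G has_real_derivative G1 x) (at x)) \<and> (\<forall>x. (G1 has_real_derivative G2 x) (at x)) \<and>
    continuous_on UNIV G2 \<and> (\<forall>x. 0 \<le> G2 x) \<and> (mono g \<longrightarrow> (\<forall>x. 0 \<le> G1 x)) \<and>
    (\<forall>x. \<exists>y\<in>{x..x+2*(1 / real (Suc n))}. G x = g y)" for n
    using convex_smoothing[OF g, of "1 / real (Suc n)"] by (metis of_nat_0_less_iff zero_less_Suc zero_less_divide_1_iff)
  then obtain G G1 G2 where
    G: "\<And>n x. (G n has_real_derivative G1 n x) (at x)" "\<And>n x. (G1 n has_real_derivative G2 n x) (at x)"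
    "\<And>n. continuous_on UNIV (G2 n)" "\<And>n x. 0 \<le> G2 n x" "\<And>n. mono g \<Longrightarrow> \<forall>x. 0 \<le> G1 n x"
    "\<And>n x. \<exists>y\<in>{x..x+2*(1 / real (Suc n))}. G n x = g y" by metis
  define Y where "Y = (\<lambda>n x. SOME y. y \<in> {x..x+2*(1 / real (Suc n))} \<and> G n x = g y)"
  have Y0: "Y n x \<in> {x..x+2*(1 / real (Suc n))} \<and> G n x = g (Y n x)" for n x
    unfolding Y_def by (rule someI_ex[OF G(6)[of x n, unfolded Bex_def]])
  then have Y: "\<And>n x. x \<le> Y n x" "\<And>n x. Y n x \<le> x + 2*(1 / real (Suc n))" "\<And>n x. G n x = g (Y n x)"
    by auto
  have Ylim: "(\<lambda>n. Y n x) \<longlonglongrightarrow> x" for x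
  proof (rule tendsto_sandwich[where f = "\<lambda>_. x"])
    show "(\<lambda>n. x + 2 * (1 / real (Suc n))) \<longlonglongrightarrow> x"
      using tendsto_add[OF tendsto_const[of x] tendsto_mult_left[OF LIMSEQ_Suc[OF lim_1_over_n], of 2]] by simp
  qed (use Y in auto)
  show ?thesis
  proof (rule convex_on_pointwise_limit)
    show "convex_on UNIV (\<lambda>x. \<integral>z. G n (m x + s x * z) \<partial>\<nu>)" for n
      by (rule noise_average_convex_smooth[OF G(1-4)]) (use drift G(5) m s s2 kap inc in blast)+
    fix x
    define R where "R = \<bar>m x\<bar> + \<bar>s x\<bar> * S + 2"
    have R: "\<bar>m x + s x * z\<bar> \<le> R - 2" if "\<bar>z\<bar> \<le> S" for z
    proof -
      have "\<bar>s x * z\<bar> \<le> \<bar>s x\<bar> * S" unfolding abs_mult using that by (intro mult_left_mono) auto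
      then show ?thesis unfolding R_def by linarith
    qed
    obtain C where C: "\<And>y. \<bar>y\<bar> \<le> R \<Longrightarrow> \<bar>g y\<bar> \<le> C"
      using continuous_locally_bounded[OF gc] by blast
    have small: "2 * (1 / real (Suc n)) \<le> 2" for n by (simp add: field_simps)
    have YR: "\<bar>Y n v\<bar> \<le> R" if "\<bar>v\<bar> \<le> R - 2" for n v
      using Y(1)[of v n] Y(2)[of n v] small[of n] that by linarith
    show "(\<lambda>n. \<integral>z. G n (m x + s x * z) \<partial>\<nu>) \<longlonglongrightarrow> (\<integral>z. g (m x + s x * z) \<partial>\<nu>)"
    proof (rule integral_dominated_convergence[where w = "\<lambda>_. C"])
      show "AE z in \<nu>. (\<lambda>n. G n (m x + s x * z)) \<longlonglongrightarrow> g (m x + s x * z)"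
        unfolding Y(3) by (intro AE_I2 continuous_on_tendsto_compose[OF gc] Ylim) auto
      show "AE z in \<nu>. norm (G n (m x + s x * z)) \<le> C" for n
        using noise_bounded C R YR unfolding Y(3) by auto
      have "continuous_on UNIV (G n)" for n using G(1) by (meson DERIV_isCont continuous_at_imp_continuous_on)
      note [measurable] = borel_measurable_continuous_onI[OF gc] borel_measurable_continuous_onI[OF this]
      show "(\<lambda>z. g (m x + s x * z)) \<in> borel_measurable \<nu>" by measurable
      show "(\<lambda>z. G n (m x + s x * z)) \<in> borel_measurable \<nu>" for n by measurable
    qed auto
  qed
qed

end

section \<open>Functions of a real sequence\<close>

definition dirconvex_seq :: "((nat \<Rightarrow> real) \<Rightarrow> real) \<Rightarrow> bool" where
  "dirconvex_seq f \<longleftrightarrow> (\<forall>x y z. (\<forall>i. 0 \<le> y i \<and> 0 \<le> z i) \<longrightarrow>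
     f (\<lambda>i. x i + y i) + f (\<lambda>i. x i + z i) \<le> f (\<lambda>i. x i + y i + z i) + f x)"

definition increasing_seq :: "((nat \<Rightarrow> real) \<Rightarrow> real) \<Rightarrow> bool" where
  "increasing_seq f \<longleftrightarrow> (\<forall>x y. (\<forall>i. x i \<le> y i) \<longrightarrow> f x \<le> f y)"

text \<open>
  Unlike directional convexity, this is preserved by taking the maximum with a constant even if the function is
  not monotone.
\<close>

definition ray_convex :: "((nat \<Rightarrow> real) \<Rightarrow> real) \<Rightarrow> bool" where
  "ray_convex f \<longleftrightarrow> (\<forall>x q. (\<forall>i. 0 \<le> q i) \<longrightarrow> convex_on UNIV (\<lambda>t. f (\<lambda>i. x i + t * q i)))"

text \<open>
  Such functions have finite integrals against bounded noise, and the kernels defined below keep them tame. Boxes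
  restrict finitely many coordinates, so that rays with unbounded directions stay in them for bounded times.
\<close>

definition tame :: "nat \<Rightarrow> ((nat \<Rightarrow> real) \<Rightarrow> real) \<Rightarrow> bool" where
  "tame n f \<longleftrightarrow> f \<in> borel_measurable (PiM UNIV (\<lambda>_. borel)) \<and>
     (\<forall>R. \<exists>C. \<forall>x. (\<forall>i\<le>n. \<bar>x i\<bar> \<le> R) \<longrightarrow> \<bar>f x\<bar> \<le> C)"

lemma dirconvex_seqD:
  assumes "dirconvex_seq f" "\<And>i. 0 \<le> y i" "\<And>i. 0 \<le> z i"
  shows "f (\<lambda>i. x i + y i) + f (\<lambda>i. x i + z i) \<le> f (\<lambda>i. x i + y i + z i) + f x"
  using assms unfolding dirconvex_seq_def by blast

lemma tameD_measurable: "tame n f \<Longrightarrow> f \<in> borel_measurable (PiM UNIV (\<lambda>_. borel))"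
  by (simp add: tame_def)

lemma tameD_bounded:
  assumes "tame n f"
  obtains C where "\<And>x. (\<And>i. i \<le> n \<Longrightarrow> \<bar>x i\<bar> \<le> R) \<Longrightarrow> \<bar>f x\<bar> \<le> C"
  using assms unfolding tame_def by blast

lemma ray_convex_if_dirconvex:
  assumes f: "dirconvex_seq f" and t: "tame n f"
  shows "ray_convex f"
  unfolding ray_convex_def
proof (intro allI impI)
  fix x q :: "nat \<Rightarrow> real" assume q: "\<forall>i. 0 \<le> q i"
  show "convex_on UNIV (\<lambda>t. f (\<lambda>i. x i + t * q i))"
  proof (rule convex_on_if_wright_convex_bounded)
    show "wright_convex (\<lambda>t. f (\<lambda>i. x i + t * q i))"
      unfolding wright_convex_def
    proof (intro allI impI)
      fix a y z :: real assume "0 \<le> y \<and> 0 \<le> z"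
      then show "f (\<lambda>i. x i + (a + y) * q i) + f (\<lambda>i. x i + (a + z) * q i)
          \<le> f (\<lambda>i. x i + (a + y + z) * q i) + f (\<lambda>i. x i + a * q i)"
        using dirconvex_seqD[OF f, of "\<lambda>i. y * q i" "\<lambda>i. z * q i" "\<lambda>i. x i + a * q i"] q
        by (simp add: algebra_simps)
    qed
    fix R :: real
    define R' where "R' = (\<Sum>i\<le>n. \<bar>x i\<bar> + \<bar>R\<bar> * \<bar>q i\<bar>)"
    obtain C where C: "\<And>x. (\<And>i. i \<le> n \<Longrightarrow> \<bar>x i\<bar> \<le> R') \<Longrightarrow> \<bar>f x\<bar> \<le> C"
      using tameD_bounded[OF t] by blast
    have "\<bar>f (\<lambda>i. x i + t * q i)\<bar> \<le> C" if "\<bar>t\<bar> \<le> R" for t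
    proof (rule C)
      fix i assume i: "i \<le> n"
      have "\<bar>t\<bar> * \<bar>q i\<bar> \<le> \<bar>R\<bar> * \<bar>q i\<bar>" using that by (intro mult_right_mono) auto
      then have "\<bar>x i + t * q i\<bar> \<le> \<bar>x i\<bar> + \<bar>R\<bar> * \<bar>q i\<bar>"
        using abs_triangle_ineq[of "x i" "t * q i"] by (simp add: abs_mult)
      also have "\<dots> \<le> R'" unfolding R'_def using i by (intro member_le_sum) auto
      finally show "\<bar>x i + t * q i\<bar> \<le> R'" .
    qed
    then show "\<exists>C. \<forall>t. \<bar>t\<bar> \<le> R \<longrightarrow> \<bar>f (\<lambda>i. x i + t * q i)\<bar> \<le> C" by blast
  qed
qed

lemma ray_convex_coordinate:
  assumes "ray_convex f"
  shows "convex_on UNIV (\<lambda>t. f (x(j := t)))"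
proof -
  have "convex_on UNIV (\<lambda>t. f (\<lambda>i. (x(j := 0)) i + t * (if i = j then 1 else 0)))"
    using assms unfolding ray_convex_def by simp
  moreover have "(\<lambda>i. (x(j := 0)) i + t * (if i = j then 1 else 0)) = x(j := t)" for t
    by auto
  ultimately show ?thesis by simp
qed

text \<open>
  The points \<open>c + a\<close> and \<open>c - a\<close> are convex combinations of \<open>c + b\<close> and \<open>c - b\<close> with exchanged weights.
\<close>

lemma convex_on_symmetric_spread:
  fixes g :: "real \<Rightarrow> real"
  assumes g: "convex_on UNIV g" and le: "\<bar>a\<bar> \<le> \<bar>b\<bar>"
  shows "g (c + a) + g (c - a) \<le> g (c + b) + g (c - b)"
proof (cases "b = 0")
  case False
  define u where "u = (1 + a / b) / 2"
  have "\<bar>a / b\<bar> \<le> 1" using le False by (simp add: divide_le_eq)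
  then have "- 1 \<le> a / b" "a / b \<le> 1" by linarith+
  then have u: "0 \<le> u" "u \<le> 1" by (auto simp: u_def)
  have e: "(1 - u) *\<^sub>R (c - b) + u *\<^sub>R (c + b) = c + a" "(1 - u) *\<^sub>R (c + b) + u *\<^sub>R (c - b) = c - a"
    using False by (simp_all add: u_def field_simps)
  show ?thesis
    using convex_onD[OF g u, of "c - b" "c + b"] convex_onD[OF g u, of "c + b" "c - b"] unfolding e
    by (simp add: algebra_simps)
qed (use le in auto)

text \<open>
  Drift maps and spreads to which \<open>noise_average_convex\<close> applies as long as the noise stays in \<open>[-r, r]\<close>. The last
  clause says that \<open>x \<mapsto> m x + s x * z\<close> expands distances by at least \<open>\<kappa>\<close>; its absolute values make it independent
  of the signs of \<open>s\<close> and \<open>z\<close>.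
\<close>

definition convex_step :: "ereal \<Rightarrow> (real \<Rightarrow> real) \<Rightarrow> (real \<Rightarrow> real) \<Rightarrow> bool" where
  "convex_step r m s \<longleftrightarrow> (\<exists>Lm L \<alpha> \<kappa>.
     (\<forall>x y. \<bar>m x - m y\<bar> \<le> Lm * \<bar>x - y\<bar>) \<and> (\<forall>x y. \<bar>s x - s y\<bar> \<le> L * \<bar>x - y\<bar>) \<and>
     convex_on UNIV (\<lambda>x. (s x)\<^sup>2 + \<alpha> * x\<^sup>2) \<and> 0 \<le> \<alpha> \<and> \<alpha> + L\<^sup>2 \<le> \<kappa>\<^sup>2 \<and> 0 \<le> \<kappa> \<and>
     (\<forall>x y z. x \<le> y \<longrightarrow> ereal \<bar>z\<bar> \<le> r \<longrightarrow> \<kappa> * (y - x) \<le> m y - m x - \<bar>s y - s x\<bar> * \<bar>z\<bar>))"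

lemma convex_step_level: "convex_step r m s \<Longrightarrow> r' \<le> r \<Longrightarrow> convex_step r' m s"
  unfolding convex_step_def by (meson order_trans)

lemma convex_step_increment:
  assumes "convex_step r m s" "x \<le> y" "ereal \<bar>z\<bar> \<le> r"
  shows "\<bar>s y - s x\<bar> * \<bar>z\<bar> \<le> m y - m x"
proof -
  obtain \<kappa> where "0 \<le> \<kappa>" "\<kappa> * (y - x) \<le> m y - m x - \<bar>s y - s x\<bar> * \<bar>z\<bar>"
    using assms unfolding convex_step_def by blast
  moreover have "0 \<le> \<kappa> * (y - x)" using \<open>0 \<le> \<kappa>\<close> assms(2) by simp
  ultimately show ?thesis by linarith
qed

lemma convex_step_mono:
  assumes "convex_step r m s" "x \<le> y" "ereal \<bar>z\<bar> \<le> r"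
  shows "m x + s x * z \<le> m y + s y * z"
proof -
  have "\<bar>(s y - s x) * z\<bar> \<le> m y - m x"
    using convex_step_increment[OF assms] by (simp add: abs_mult)
  then have "- ((s y - s x) * z) \<le> m y - m x" by linarith
  then show ?thesis by (simp add: algebra_simps)
qed

context stein_noise
begin

text \<open>
  The conditional mean of \<open>f\<close> given the coordinates other than \<open>Suc k\<close>, when coordinate \<open>Suc k\<close> is one step away from
  coordinate \<open>k\<close>.
\<close>

definition kernel ::
  "(real \<Rightarrow> real) \<Rightarrow> (real \<Rightarrow> real) \<Rightarrow> nat \<Rightarrow> ((nat \<Rightarrow> real) \<Rightarrow> real) \<Rightarrow> (nat \<Rightarrow> real) \<Rightarrow> real" where
  "kernel m s k f x = (\<integral>z. f (x(Suc k := m (x k) + s (x k) * z)) \<partial>\<nu>)"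

lemma measurable_kernel_integrand:
  fixes f :: "(nat \<Rightarrow> real) \<Rightarrow> real"
  assumes f: "f \<in> borel_measurable (PiM UNIV (\<lambda>_. borel))"
    and m: "m \<in> borel_measurable borel" and s: "s \<in> borel_measurable borel"
  shows "(\<lambda>(x, z). f (x(Suc k := m (x k) + s (x k) * z))) \<in> borel_measurable (PiM UNIV (\<lambda>_. borel) \<Otimes>\<^sub>M borel)"
proof -
  note [measurable] = f m s
  have [measurable]: "(\<lambda>p::(nat \<Rightarrow> real) \<times> real. (fst p)(Suc k := m (fst p k) + s (fst p k) * snd p))
      \<in> (PiM UNIV (\<lambda>_. borel) \<Otimes>\<^sub>M borel) \<rightarrow>\<^sub>M PiM UNIV (\<lambda>_. borel)"
    by (rule measurable_fun_upd[where J = UNIV]) auto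
  show ?thesis unfolding case_prod_beta by measurable
qed

lemma measurable_kernel_section:
  fixes f :: "(nat \<Rightarrow> real) \<Rightarrow> real"
  assumes f: "f \<in> borel_measurable (PiM UNIV (\<lambda>_. borel))"
  shows "(\<lambda>z. f (x(Suc k := a + b * z))) \<in> borel_measurable borel"
proof -
  note [measurable] = f
  have [measurable]: "(\<lambda>z::real. x(Suc k := a + b * z)) \<in> borel \<rightarrow>\<^sub>M PiM UNIV (\<lambda>_. borel)"
    by (rule measurable_fun_upd[where J = UNIV]) (auto simp: space_PiM)
  show ?thesis by measurable
qed

lemma affine_noise_bounded:
  assumes "\<bar>z\<bar> \<le> S"
  shows "\<bar>a + b * z\<bar> \<le> \<bar>a\<bar> + \<bar>b\<bar> * S"
proof -
  have "\<bar>b * z\<bar> \<le> \<bar>b\<bar> * S" unfolding abs_mult using assms by (intro mult_left_mono) auto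
  then show ?thesis by linarith
qed

lemma kernel_integrable:
  assumes f: "tame n f"
  shows "integrable \<nu> (\<lambda>z. f (x(Suc k := a + b * z)))"
proof -
  define R where "R = (\<Sum>i\<le>n. \<bar>x i\<bar>) + \<bar>a\<bar> + \<bar>b\<bar> * S"
  have R1: "\<bar>x i\<bar> \<le> R" if "i \<le> n" for i
  proof -
    have "\<bar>x i\<bar> \<le> (\<Sum>i\<le>n. \<bar>x i\<bar>)" using that by (intro member_le_sum) auto
    then show ?thesis using S_nonneg by (simp add: R_def add_increasing2)
  qed
  obtain C where C: "\<And>x. (\<And>i. i \<le> n \<Longrightarrow> \<bar>x i\<bar> \<le> R) \<Longrightarrow> \<bar>f x\<bar> \<le> C"
    using tameD_bounded[OF f] by blast
  have R2: "\<bar>a + b * z\<bar> \<le> R" if "\<bar>z\<bar> \<le> S" for z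
  proof -
    have "0 \<le> (\<Sum>i\<le>n. \<bar>x i\<bar>)" by (intro sum_nonneg) auto
    then show ?thesis using affine_noise_bounded[OF that, of a b] unfolding R_def by linarith
  qed
  show ?thesis
  proof (rule integrable_noise)
    show "(\<lambda>z. f (x(Suc k := a + b * z))) \<in> borel_measurable borel"
      by (rule measurable_kernel_section[OF tameD_measurable[OF f]])
    show "\<bar>f (x(Suc k := a + b * z))\<bar> \<le> C" if "\<bar>z\<bar> \<le> S" for z
      by (rule C) (use R1 R2[OF that] in auto)
  qed
qed

lemma tame_kernel:
  assumes f: "tame n f" and k: "k \<le> n"
    and m: "continuous_on UNIV m" and s: "continuous_on UNIV s"
  shows "tame n (kernel m s k f)"
  unfolding tame_def
proof (intro conjI allI)
  note [measurable] = measurable_kernel_integrand[OF tameD_measurable[OF f]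
      borel_measurable_continuous_onI[OF m] borel_measurable_continuous_onI[OF s]]
  show "kernel m s k f \<in> borel_measurable (PiM UNIV (\<lambda>_. borel))"
    unfolding kernel_def by measurable
  fix R :: real
  obtain C1 where C1: "\<And>y. \<bar>y\<bar> \<le> R \<Longrightarrow> \<bar>m y\<bar> \<le> C1" using continuous_locally_bounded[OF m] by blast
  obtain C2 where C2: "\<And>y. \<bar>y\<bar> \<le> R \<Longrightarrow> \<bar>s y\<bar> \<le> C2" using continuous_locally_bounded[OF s] by blast
  obtain C where C: "\<And>x. (\<And>i. i \<le> n \<Longrightarrow> \<bar>x i\<bar> \<le> max R (C1 + C2 * S)) \<Longrightarrow> \<bar>f x\<bar> \<le> C"
    using tameD_bounded[OF f] by blast
  have "\<bar>kernel m s k f x\<bar> \<le> measure \<nu> (space \<nu>) * C" if x: "\<And>i. i \<le> n \<Longrightarrow> \<bar>x i\<bar> \<le> R" for x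
  proof -
    have b: "\<bar>f (x(Suc k := m (x k) + s (x k) * z))\<bar> \<le> C" if "\<bar>z\<bar> \<le> S" for z
    proof (rule C)
      fix i assume "i \<le> n"
      have "\<bar>s (x k)\<bar> * S \<le> C2 * S" using C2[OF x[OF k]] S_nonneg by (intro mult_right_mono) auto
      then have "\<bar>m (x k) + s (x k) * z\<bar> \<le> C1 + C2 * S"
        using affine_noise_bounded[OF that, of "m (x k)" "s (x k)"] C1[OF x[OF k]] by linarith
      then show "\<bar>(x(Suc k := m (x k) + s (x k) * z)) i\<bar> \<le> max R (C1 + C2 * S)"
        using x[OF \<open>i \<le> n\<close>] by auto
    qed
    have I: "integrable \<nu> (\<lambda>z. f (x(Suc k := m (x k) + s (x k) * z)))" by (rule kernel_integrable[OF f])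
    have "(\<integral>z. f (x(Suc k := m (x k) + s (x k) * z)) \<partial>\<nu>) \<le> (\<integral>z. C \<partial>\<nu>)"
      using I abs_le_D1[OF b] by (intro integral_noise_mono) auto
    moreover have "(\<integral>z. - C \<partial>\<nu>) \<le> (\<integral>z. f (x(Suc k := m (x k) + s (x k) * z)) \<partial>\<nu>)"
      using I abs_le_D2[OF b] by (intro integral_noise_mono) (auto simp: minus_le_iff)
    ultimately show ?thesis by (simp add: kernel_def abs_le_iff)
  qed
  then show "\<exists>C. \<forall>x. (\<forall>i\<le>n. \<bar>x i\<bar> \<le> R) \<longrightarrow> \<bar>kernel m s k f x\<bar> \<le> C" by blast
qed

lemma kernel_mono:
  assumes "tame n f" "tame n g" "\<And>x. f x \<le> g x"
  shows "kernel m s k f x \<le> kernel m s k g x"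
  unfolding kernel_def by (intro integral_mono kernel_integrable[OF assms(1)] kernel_integrable[OF assms(2)] assms(3))

text \<open>
  Pairing \<open>z\<close> with \<open>- z\<close> leaves two values at symmetric distance from the drift map, and spreading them
  apart increases the sum of a convex function.
\<close>

lemma kernel_spread_mono:
  assumes t: "tame n f" and f: "ray_convex f"
    and m: "m (x k) = m' (x k) \<or> (increasing_seq f \<and> m (x k) \<le> m' (x k))"
    and s: "\<bar>s (x k)\<bar> \<le> \<bar>s' (x k)\<bar>"
  shows "kernel m s k f x \<le> kernel m' s' k f x"
  unfolding kernel_def
proof (rule integral_noise_mono_symmetric)
  fix z :: real assume z: "0 \<le> z" "z \<le> S"
  define g where "g = (\<lambda>t. f (x(Suc k := t)))"
  have g: "convex_on UNIV g" unfolding g_def by (rule ray_convex_coordinate[OF f])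
  have "g (m (x k) + s (x k) * z) + g (m (x k) - s (x k) * z)
      \<le> g (m' (x k) + s (x k) * z) + g (m' (x k) - s (x k) * z)"
  proof (cases "m (x k) = m' (x k)")
    case False
    then have "mono g" using m by (auto simp: g_def increasing_seq_def intro!: monoI)
    then show ?thesis using m by (intro add_mono) (auto intro: monoD)
  qed simp
  also have "\<dots> \<le> g (m' (x k) + s' (x k) * z) + g (m' (x k) - s' (x k) * z)"
    using s z by (intro convex_on_symmetric_spread[OF g]) (auto simp: abs_mult intro: mult_right_mono)
  finally show "f (x(Suc k := m (x k) + s (x k) * z)) + f (x(Suc k := m (x k) + s (x k) * - z))
     \<le> f (x(Suc k := m' (x k) + s' (x k) * z)) + f (x(Suc k := m' (x k) + s' (x k) * - z))"
    by (simp add: g_def)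
qed (use kernel_integrable[OF t] measurable_kernel_section[OF tameD_measurable[OF t]] in auto)

lemma noise_average_convex':
  assumes g: "convex_on UNIV g" "(mono g \<and> convex_on UNIV m) \<or> (\<exists>a b. \<forall>x. m x = a + b * x)"
    and ms: "convex_step (ereal S) m s"
  shows "convex_on UNIV (\<lambda>x. \<integral>z. g (m x + s x * z) \<partial>\<nu>)"
proof -
  obtain Lm L \<alpha> \<kappa> where *: "\<forall>x y. \<bar>m x - m y\<bar> \<le> Lm * \<bar>x - y\<bar>" "\<forall>x y. \<bar>s x - s y\<bar> \<le> L * \<bar>x - y\<bar>"
     "convex_on UNIV (\<lambda>x. (s x)\<^sup>2 + \<alpha> * x\<^sup>2)" "0 \<le> \<alpha>" "\<alpha> + L\<^sup>2 \<le> \<kappa>\<^sup>2" "0 \<le> \<kappa>"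
     "\<forall>x y z. x \<le> y \<longrightarrow> ereal \<bar>z\<bar> \<le> ereal S \<longrightarrow> \<kappa> * (y - x) \<le> m y - m x - \<bar>s y - s x\<bar> * \<bar>z\<bar>"
    using ms unfolding convex_step_def by blast
  have "\<kappa> * (y - x) \<le> (m y + s y * z) - (m x + s x * z)" if "x \<le> y" "\<bar>z\<bar> \<le> S" for x y z
  proof -
    have "\<kappa> * (y - x) \<le> m y - m x - \<bar>s y - s x\<bar> * \<bar>z\<bar>" using *(7) that by simp
    moreover have "- (\<bar>s y - s x\<bar> * \<bar>z\<bar>) \<le> (s y - s x) * z"
      using abs_ge_minus_self[of "(s y - s x) * z"] unfolding abs_mult by linarith
    ultimately show ?thesis by (simp add: left_diff_distrib)
  qed
  then show ?thesis
    by (intro noise_average_convex[OF g *(1)[rule_format] *(2)[rule_format] *(3-6)])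
qed

lemma kernel_increasing:
  assumes t: "tame n f" and f: "increasing_seq f" and ms: "convex_step (ereal S) m s"
  shows "increasing_seq (kernel m s k f)"
  unfolding increasing_seq_def kernel_def
proof (intro allI impI)
  fix x y :: "nat \<Rightarrow> real" assume xy: "\<forall>i. x i \<le> y i"
  show "(\<integral>z. f (x(Suc k := m (x k) + s (x k) * z)) \<partial>\<nu>) \<le> (\<integral>z. f (y(Suc k := m (y k) + s (y k) * z)) \<partial>\<nu>)"
  proof (rule integral_noise_mono)
    fix z :: real assume "\<bar>z\<bar> \<le> S"
    then have "m (x k) + s (x k) * z \<le> m (y k) + s (y k) * z"
      using xy by (intro convex_step_mono[OF ms]) auto
    then show "f (x(Suc k := m (x k) + s (x k) * z)) \<le> f (y(Suc k := m (y k) + s (y k) * z))"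
      using f xy unfolding increasing_seq_def by simp
  qed (rule kernel_integrable[OF t])+
qed

text \<open>
  Directional convexity of \<open>f\<close> is used twice, to move the new coordinate of the four points onto one and
  the same function \<open>g = f (x(Suc k := _))\<close>: for each value of the noise, which must keep the order of the
  points, the four-point inequality follows from the corresponding one for \<open>g\<close> alone. After averaging,
  the latter is the convexity of the noise average of \<open>g\<close>.
\<close>

lemma kernel_dirconvex:
  assumes t: "tame n f" and f: "dirconvex_seq f" and ms: "convex_step (ereal S) m s"
    and drift: "(increasing_seq f \<and> convex_on UNIV m) \<or> (\<exists>a b. \<forall>x. m x = a + b * x)"
  shows "dirconvex_seq (kernel m s k f)"
  unfolding dirconvex_seq_def
proof (intro allI impI)
  fix x y z :: "nat \<Rightarrow> real" assume yz: "\<forall>i. 0 \<le> y i \<and> 0 \<le> z i"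
  define v where "v = (\<lambda>a \<zeta>. m a + s a * \<zeta>)"
  have vmono: "v a \<zeta> \<le> v b \<zeta>" if "a \<le> b" "\<bar>\<zeta>\<bar> \<le> S" for a b \<zeta>
    unfolding v_def using that by (intro convex_step_mono[OF ms]) auto
  let ?xy = "\<lambda>i. x i + y i" and ?xz = "\<lambda>i. x i + z i" and ?xyz = "\<lambda>i. x i + y i + z i"
  define g where "g = (\<lambda>t. f (x(Suc k := t)))"
  have f4: "f (p(j := a1)) + f (q(j := a2)) \<le> f (r(j := a3)) + f (w(j := a0))"
    if "\<And>i. p i = w i + c i" "\<And>i. q i = w i + d i" "\<And>i. r i = w i + c i + d i"
      "\<And>i. c i \<ge> 0" "\<And>i. d i \<ge> 0" "a0 \<le> a1" "a0 \<le> a2" "a3 = a1 + a2 - a0"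
    for p q r w c d :: "nat \<Rightarrow> real" and j a0 a1 a2 a3
  proof -
    have "(\<lambda>i. (w(j := a0)) i + (c(j := a1 - a0)) i) = p(j := a1)"
      "(\<lambda>i. (w(j := a0)) i + (d(j := a2 - a0)) i) = q(j := a2)"
      "(\<lambda>i. (w(j := a0)) i + (c(j := a1 - a0)) i + (d(j := a2 - a0)) i) = r(j := a3)"
      using that by (auto simp: fun_eq_iff)
    then show ?thesis
      using dirconvex_seqD[OF f, of "c(j := a1 - a0)" "d(j := a2 - a0)" "w(j := a0)"] that by auto
  qed
  have pt: "f (?xy(Suc k := v (?xy k) \<zeta>)) + f (?xz(Suc k := v (?xz k) \<zeta>))
      + (g (v (?xyz k) \<zeta>) - g (v (?xy k) \<zeta>) - g (v (?xz k) \<zeta>) + g (v (x k) \<zeta>))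
     \<le> f (?xyz(Suc k := v (?xyz k) \<zeta>)) + f (x(Suc k := v (x k) \<zeta>))" if \<zeta>: "\<bar>\<zeta>\<bar> \<le> S" for \<zeta>
  proof -
    define V1 V2 V3 V4 where V: "V1 = v (x k) \<zeta>" "V2 = v (?xy k) \<zeta>" "V3 = v (?xz k) \<zeta>" "V4 = v (?xyz k) \<zeta>"
    have ord: "V2 \<le> V4" "V3 \<le> V4" unfolding V using yz \<zeta> by (auto intro!: vmono)
    have "f (?xy(Suc k := V4)) + f (?xz(Suc k := V3)) \<le> f (?xyz(Suc k := V4)) + f (x(Suc k := V3))"
      by (rule f4[where c = y and d = z]) (use yz ord in auto)
    moreover have "f (?xy(Suc k := V2)) + f (x(Suc k := V4)) \<le> f (?xy(Suc k := V4)) + f (x(Suc k := V2))"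
      by (rule f4[where c = y and d = "\<lambda>_. 0"]) (use yz ord in auto)
    ultimately show ?thesis by (simp add: g_def flip: V)
  qed
  have "convex_on UNIV g"
    unfolding g_def by (rule ray_convex_coordinate[OF ray_convex_if_dirconvex[OF f t]])
  moreover have "(mono g \<and> convex_on UNIV m) \<or> (\<exists>a b. \<forall>x. m x = a + b * x)"
    using drift by (auto simp: g_def increasing_seq_def intro!: monoI)
  ultimately have Q: "convex_on UNIV (\<lambda>a. \<integral>\<zeta>. g (v a \<zeta>) \<partial>\<nu>)"
    unfolding v_def by (rule noise_average_convex'[OF _ _ ms])
  have four: "u (a + p) + u (a + q) \<le> u (a + p + q) + u a"
    if u: "convex_on UNIV u" and pq: "0 \<le> p" "0 \<le> q" for u :: "real \<Rightarrow> real" and a p q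
  proof (cases "p + q = 0")
    case False
    define w where "w = p / (p + q)"
    have w: "0 \<le> w" "w \<le> 1" using pq False by (auto simp: w_def)
    have wp: "w * (p + q) = p" using False by (simp add: w_def)
    have e: "(1 - w) *\<^sub>R a + w *\<^sub>R (a + p + q) = a + p" "(1 - w) *\<^sub>R (a + p + q) + w *\<^sub>R a = a + q"
      using wp by (simp_all add: algebra_simps)
    show ?thesis
      using convex_onD[OF u w, of a "a + p + q"] convex_onD[OF u w, of "a + p + q" a] unfolding e
      by (simp add: algebra_simps)
  next
    case True
    then have "p = 0" "q = 0" using pq by auto
    then show ?thesis by simp
  qed
  have I: "integrable \<nu> (\<lambda>\<zeta>. f (w(Suc k := v a \<zeta>)))" for w a
    unfolding v_def by (rule kernel_integrable[OF t])
  then have Ig: "integrable \<nu> (\<lambda>\<zeta>. g (v a \<zeta>))" for a unfolding g_def .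
  have K: "kernel m s k f w = (\<integral>\<zeta>. f (w(Suc k := v (w k) \<zeta>)) \<partial>\<nu>)" for w
    by (simp add: kernel_def v_def)
  have "(\<integral>\<zeta>. f (?xy(Suc k := v (?xy k) \<zeta>)) + f (?xz(Suc k := v (?xz k) \<zeta>))
      + (g (v (?xyz k) \<zeta>) - g (v (?xy k) \<zeta>) - g (v (?xz k) \<zeta>) + g (v (x k) \<zeta>)) \<partial>\<nu>)
     \<le> (\<integral>\<zeta>. f (?xyz(Suc k := v (?xyz k) \<zeta>)) + f (x(Suc k := v (x k) \<zeta>)) \<partial>\<nu>)"
    by (rule integral_noise_mono)
      (intro Bochner_Integration.integrable_add Bochner_Integration.integrable_diff I Ig pt)+
  then have "kernel m s k f ?xy + kernel m s k f ?xz
      + ((\<integral>\<zeta>. g (v (?xyz k) \<zeta>) \<partial>\<nu>) - (\<integral>\<zeta>. g (v (?xy k) \<zeta>) \<partial>\<nu>) - (\<integral>\<zeta>. g (v (?xz k) \<zeta>) \<partial>\<nu>) + (\<integral>\<zeta>. g (v (x k) \<zeta>) \<partial>\<nu>))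
     \<le> kernel m s k f ?xyz + kernel m s k f x"
    using I Ig by (simp add: K)
  moreover have "(\<integral>\<zeta>. g (v (?xy k) \<zeta>) \<partial>\<nu>) + (\<integral>\<zeta>. g (v (?xz k) \<zeta>) \<partial>\<nu>)
      \<le> (\<integral>\<zeta>. g (v (?xyz k) \<zeta>) \<partial>\<nu>) + (\<integral>\<zeta>. g (v (x k) \<zeta>) \<partial>\<nu>)"
    using four[OF Q, of "y k" "z k" "x k"] yz by simp
  ultimately show "kernel m s k f ?xy + kernel m s k f ?xz \<le> kernel m s k f ?xyz + kernel m s k f x"
    by linarith
qed

text \<open>
  For each value of the noise the step is affine in coordinate \<open>k\<close> with nonnegative slope, so it maps rays with
  nonnegative direction to such rays.
\<close>

lemma kernel_ray_convex:
  assumes t: "tame n f" and f: "ray_convex f"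
    and m: "\<And>x. m x = a + b * x" "0 \<le> b" and s: "\<And>x. s x = c"
  shows "ray_convex (kernel m s k f)"
  unfolding ray_convex_def
proof (intro allI impI)
  fix x q :: "nat \<Rightarrow> real" assume q: "\<forall>i. 0 \<le> q i"
  define F where "F = (\<lambda>z t. f (\<lambda>i. (x(Suc k := a + b * x k + c * z)) i + t * (q(Suc k := b * q k)) i))"
  have F: "convex_on UNIV (F z)" for z
    using f q m(2) unfolding ray_convex_def F_def by simp
  have upd: "(\<lambda>i. x i + t * q i)(Suc k := m (x k + t * q k) + s (x k + t * q k) * z)
      = (\<lambda>i. (x(Suc k := a + b * x k + c * z)) i + t * (q(Suc k := b * q k)) i)" for t z
    by (auto simp: fun_eq_iff m s algebra_simps)
  have eq: "kernel m s k f (\<lambda>i. x i + t * q i) = (\<integral>z. F z t \<partial>\<nu>)" for t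
    unfolding kernel_def F_def upd ..
  have I: "integrable \<nu> (\<lambda>z. F z t)" for t
    unfolding F_def upd[symmetric] by (rule kernel_integrable[OF t])
  show "convex_on UNIV (\<lambda>t. kernel m s k f (\<lambda>i. x i + t * q i))"
    unfolding eq
  proof (rule convex_onI)
    fix u t t' :: real assume u: "0 < u" "u < 1"
    have "(\<integral>z. F z ((1 - u) *\<^sub>R t + u *\<^sub>R t') \<partial>\<nu>) \<le> (\<integral>z. (1 - u) * F z t + u * F z t' \<partial>\<nu>)"
      using u I by (intro integral_mono convex_onD[OF F]) auto
    then show "(\<integral>z. F z ((1 - u) *\<^sub>R t + u *\<^sub>R t') \<partial>\<nu>) \<le> (1 - u) * (\<integral>z. F z t \<partial>\<nu>) + u * (\<integral>z. F z t' \<partial>\<nu>)"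
      using I by simp
  qed simp
qed

section \<open>Backward iteration\<close>

primrec backward ::
  "(nat \<Rightarrow> real \<Rightarrow> real) \<Rightarrow> (nat \<Rightarrow> real \<Rightarrow> real) \<Rightarrow> nat \<Rightarrow> ((nat \<Rightarrow> real) \<Rightarrow> real) \<Rightarrow> (nat \<Rightarrow> real) \<Rightarrow> real" where
  "backward m s 0 f = f"
| "backward m s (Suc n) f = backward m s n (kernel (m n) (s n) n f)"

lemma backward_preserves:
  assumes "C f" "\<And>k f. k < n \<Longrightarrow> C f \<Longrightarrow> C (kernel (m k) (s k) k f)"
  shows "C (backward m s n f)"
  using assms by (induction n arbitrary: f) auto

lemma backward_mono:
  assumes "\<And>k. k < n \<Longrightarrow> continuous_on UNIV (m k)" "\<And>k. k < n \<Longrightarrow> continuous_on UNIV (s k)"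
    and "tame N f" "tame N g" "\<And>x. f x \<le> g x" "n \<le> N"
  shows "backward m s n f x \<le> backward m s n g x"
  using assms
proof (induction n arbitrary: f g)
  case (Suc n)
  show ?case unfolding backward.simps
    by (rule Suc.IH) (use Suc.prems in \<open>auto intro!: tame_kernel intro: kernel_mono\<close>)
qed simp

text \<open>
  The last kernel is replaced first or last according to which scheme keeps the class: the comparison of kernels
  is then applied to a functional in \<open>C\<close>, while the other scheme contributes the monotonicity of its kernels.
\<close>

lemma backward_compare:
  assumes cont: "\<And>k. k < n \<Longrightarrow> continuous_on UNIV (m k)" "\<And>k. k < n \<Longrightarrow> continuous_on UNIV (s k)"
      "\<And>k. k < n \<Longrightarrow> continuous_on UNIV (m' k)" "\<And>k. k < n \<Longrightarrow> continuous_on UNIV (s' k)"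
    and C: "\<And>f. C f \<Longrightarrow> tame N f" and N: "n \<le> N" and f: "C f"
    and le: "\<And>k f x. k < n \<Longrightarrow> C f \<Longrightarrow> kernel (m k) (s k) k f x \<le> kernel (m' k) (s' k) k f x"
    and stable: "(\<forall>k<n. \<forall>f. C f \<longrightarrow> C (kernel (m k) (s k) k f)) \<or> (\<forall>k<n. \<forall>f. C f \<longrightarrow> C (kernel (m' k) (s' k) k f))"
  shows "backward m s n f x \<le> backward m' s' n f x"
  using assms
proof (induction n arbitrary: f)
  case (Suc n)
  note cont = Suc.prems(1-4)
  have tf: "tame N f" using Suc.prems by blast
  have t: "tame N (kernel (m n) (s n) n f)" "tame N (kernel (m' n) (s' n) n f)"
    using cont Suc.prems(6) by (auto intro!: tame_kernel[OF tf])
  show ?case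
  proof (cases "\<forall>k<Suc n. \<forall>f. C f \<longrightarrow> C (kernel (m k) (s k) k f)")
    case True
    have "backward m s n (kernel (m n) (s n) n f) x \<le> backward m' s' n (kernel (m n) (s n) n f) x"
      by (rule Suc.IH) (use Suc.prems True in auto)
    also have "\<dots> \<le> backward m' s' n (kernel (m' n) (s' n) n f) x"
      by (rule backward_mono[OF _ _ t]) (use Suc.prems in auto)
    finally show ?thesis by simp
  next
    case False
    have "backward m s n (kernel (m n) (s n) n f) x \<le> backward m s n (kernel (m' n) (s' n) n f) x"
      by (rule backward_mono[OF _ _ t]) (use Suc.prems in auto)
    also have "\<dots> \<le> backward m' s' n (kernel (m' n) (s' n) n f) x"
      by (rule Suc.IH) (use Suc.prems False in auto)
    finally show ?thesis by simp
  qed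
qed simp

end

section \<open>Truncated Gaussian noise\<close>

text \<open>
  Restricting a Gaussian variable to \<open>[-r, r]\<close>, with loss of mass, bounds the noise even if the truncation
  level \<open>s\<close> is infinite.
\<close>

definition window :: "ereal \<Rightarrow> real \<Rightarrow> real" where
  "window r g = (if ereal \<bar>g\<bar> \<le> r then 1 else 0)"

lemma measurable_truncate[measurable]: "truncate s \<in> borel_measurable borel"
  unfolding truncate_def[abs_def] by measurable

lemma measurable_window[measurable]: "window r \<in> borel_measurable borel"
  unfolding window_def[abs_def] by measurable

lemma truncate_bounded:
  assumes "min t r = ereal S" "0 \<le> S" "ereal \<bar>g\<bar> \<le> r"
  shows "\<bar>truncate t g\<bar> \<le> S"
proof (cases "ereal \<bar>g\<bar> \<le> t")
  case True
  then have "ereal \<bar>g\<bar> \<le> ereal S" using assms(1,3) by (metis min.boundedI)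
  then show ?thesis using True by (simp add: truncate_def)
qed (use assms(2) in \<open>simp add: truncate_def\<close>)

definition truncated_gauss :: "ereal \<Rightarrow> ereal \<Rightarrow> real measure" where
  "truncated_gauss s r =
     distr (density std_normal_distribution (\<lambda>g. ennreal (window r g))) borel (truncate s)"

lemma integral_truncated_gauss:
  fixes h :: "real \<Rightarrow> real"
  assumes [measurable]: "h \<in> borel_measurable borel"
  shows "(\<integral>z. h z \<partial>truncated_gauss s r) = (\<integral>g. window r g * h (truncate s g) \<partial>std_normal_distribution)"
    "integrable (truncated_gauss s r) h \<longleftrightarrow> integrable std_normal_distribution (\<lambda>g. window r g * h (truncate s g))"
  unfolding truncated_gauss_def
  by (auto simp: integral_distr integrable_distr_eq integral_density integrable_density window_def intro!: AE_I2)

lemma integral_truncated_gauss_lborel: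
  fixes h :: "real \<Rightarrow> real"
  assumes [measurable]: "h \<in> borel_measurable borel"
  shows "(\<integral>z. h z \<partial>truncated_gauss s r) = (\<integral>g. std_normal_density g * (window r g * h (truncate s g)) \<partial>lborel)"
    "integrable (truncated_gauss s r) h \<longleftrightarrow> integrable lborel (\<lambda>g. std_normal_density g * (window r g * h (truncate s g)))"
  unfolding integral_truncated_gauss[OF assms]
  by (auto simp: integral_density integrable_density normal_density_nonneg intro!: AE_I2)

lemma truncated_gauss_symmetric: "distr (truncated_gauss s r) borel uminus = truncated_gauss s r"
proof -
  define f where "f = (\<lambda>g. ennreal (std_normal_density g) * ennreal (window r g))"
  have [measurable]: "f \<in> borel_measurable borel" unfolding f_def by measurable
  have D: "density std_normal_distribution (\<lambda>g. ennreal (window r g)) = density lborel f"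
    unfolding f_def by (subst density_density_eq) auto
  have even: "f (- g) = f g" for g by (simp add: f_def window_def std_normal_density_def)
  have "density lborel f = density (distr lborel borel uminus) f" by (simp add: lborel_distr_uminus)
  also have "\<dots> = distr (density lborel (\<lambda>g. f (- g))) borel uminus" by (rule density_distr) auto
  finally have "density lborel f = distr (density lborel f) borel uminus" unfolding even .
  note sym = this[symmetric]
  have odd: "truncate s (- g) = - truncate s g" for g by (simp add: truncate_def)
  have "distr (distr (density lborel f) borel (truncate s)) borel uminus
      = distr (density lborel f) borel (\<lambda>g. truncate s (- g))"
    by (subst distr_distr) (simp_all add: odd comp_def)
  also have "\<dots> = distr (distr (density lborel f) borel uminus) borel (truncate s)"
    by (subst distr_distr) (simp_all add: comp_def)
  finally show ?thesis by (simp add: truncated_gauss_def D sym)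
qed

text \<open>
  Let \<open>\<phi>\<close> be the Gaussian density. Since \<open>(\<phi> * p)' = \<phi> * q - z * \<phi> * p\<close>, the two integrals over \<open>[-S, S]\<close> differ by
  the boundary term \<open>\<phi> S * (p S - p (- S)) \<ge> 0\<close>. The atom at \<open>0\<close>, which collects the values beyond the truncation
  level, adds only to the right-hand side.
\<close>

lemma truncated_gauss_stein_noise:
  assumes s: "0 \<le> s" and r: "0 \<le> r" and S: "min s r = ereal S"
  shows "stein_noise (truncated_gauss s r) S"
proof -
  have S0: "0 \<le> S" using s r S by (metis ereal_less_eq(5) min_def)
  have S_iff: "\<bar>g\<bar> \<le> S \<longleftrightarrow> ereal \<bar>g\<bar> \<le> s \<and> ereal \<bar>g\<bar> \<le> r" for g
    using S by (metis ereal_less_eq(3) min.bounded_iff)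
  let ?D = "density std_normal_distribution (\<lambda>g. ennreal (window r g))"
  interpret N: prob_space std_normal_distribution by (rule prob_space_normal_density) simp
  have "finite_measure ?D"
  proof (rule finite_measureI)
    have "emeasure ?D (space ?D) = (\<integral>\<^sup>+g. ennreal (window r g) \<partial>std_normal_distribution)"
      by (subst emeasure_density) auto
    also have "\<dots> \<le> (\<integral>\<^sup>+g. 1 \<partial>std_normal_distribution)"
      by (intro nn_integral_mono) (simp add: window_def)
    also have "\<dots> = 1" using N.emeasure_space_1 by simp
    finally show "emeasure ?D (space ?D) \<noteq> \<infinity>" by (auto simp: top_unique)
  qed
  then interpret F: finite_measure "truncated_gauss s r"
    unfolding truncated_gauss_def by (rule finite_measure.finite_measure_distr) auto
  have bnd: "AE z in truncated_gauss s r. \<bar>z\<bar> \<le> S"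
  proof -
    have "AE g in ?D. \<bar>truncate s g\<bar> \<le> S"
    proof (subst AE_density)
      show "AE g in std_normal_distribution. 0 < ennreal (window r g) \<longrightarrow> \<bar>truncate s g\<bar> \<le> S"
        using truncate_bounded[OF S S0] by (intro AE_I2) (simp add: window_def)
    qed simp
    then show ?thesis unfolding truncated_gauss_def by (subst AE_distr_iff) simp_all
  qed
  show ?thesis
  proof
    show "sets (truncated_gauss s r) = sets borel" by (simp add: truncated_gauss_def)
    show "0 \<le> S" by (rule S0)
    show "AE z in truncated_gauss s r. \<bar>z\<bar> \<le> S" by (rule bnd)
    show "distr (truncated_gauss s r) borel uminus = truncated_gauss s r" by (rule truncated_gauss_symmetric)
    fix p q :: "real \<Rightarrow> real"
    assume p: "\<And>x. (p has_real_derivative q x) (at x)" and q: "continuous_on UNIV q" and q0: "\<And>x. 0 \<le> q x"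
    let ?\<phi> = std_normal_density
    have pc: "continuous_on UNIV p" using p by (meson DERIV_isCont continuous_at_imp_continuous_on)
    note [measurable] = borel_measurable_continuous_onI[OF pc] borel_measurable_continuous_onI[OF q]
    have d\<phi>: "(?\<phi> has_real_derivative - x * ?\<phi> x) (at x)" for x
      unfolding std_normal_density_def by (auto intro!: derivative_eq_intros simp: field_simps)
    have \<phi>c: "continuous_on UNIV ?\<phi>" using d\<phi> by (meson DERIV_isCont continuous_at_imp_continuous_on)
    have ind: "indicator {-S..S} g = (if ereal \<bar>g\<bar> \<le> s \<and> ereal \<bar>g\<bar> \<le> r then 1 else (0::real))" for g
      using S_iff[of g] by (simp add: indicator_def abs_le_iff minus_le_iff conj_commute)
    have zp: "(\<integral>z. z * p z \<partial>truncated_gauss s r) = (\<integral>g. indicator {-S..S} g *\<^sub>R (g * p g * ?\<phi> g) \<partial>lborel)"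
      unfolding ind
      by (subst integral_truncated_gauss_lborel)
        (auto intro!: Bochner_Integration.integral_cong simp: window_def truncate_def)
    have Iq: "integrable lborel (\<lambda>g. ?\<phi> g * (window r g * q (truncate s g)))"
    proof -
      obtain C where "\<And>y. \<bar>y\<bar> \<le> S \<Longrightarrow> \<bar>q y\<bar> \<le> C" using continuous_locally_bounded[OF q] by blast
      then have "integrable (truncated_gauss s r) q"
        using bnd by (intro F.integrable_const_bound[of _ C]) (auto simp: truncated_gauss_def)
      then show ?thesis by (subst (asm) integral_truncated_gauss_lborel) auto
    qed
    have Icomp: "integrable lborel (\<lambda>g. indicator {-S..S} g *\<^sub>R h g)" if "continuous_on UNIV h" for h :: "real \<Rightarrow> real"
      by (rule borel_integrable_compact) (auto intro: continuous_on_subset[OF that])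
    have "(\<integral>g. indicator {-S..S} g *\<^sub>R (q g * ?\<phi> g) \<partial>lborel) \<le> (\<integral>z. q z \<partial>truncated_gauss s r)"
      unfolding integral_truncated_gauss_lborel(1)[OF borel_measurable_continuous_onI[OF q]]
    proof (rule integral_mono)
      show "integrable lborel (\<lambda>g. indicator {-S..S} g *\<^sub>R (q g * ?\<phi> g))"
        by (intro Icomp continuous_intros q \<phi>c)
      show "indicator {-S..S} g *\<^sub>R (q g * ?\<phi> g) \<le> ?\<phi> g * (window r g * q (truncate s g))" for g
        using q0 normal_density_nonneg[of 0 1 g] unfolding ind by (simp add: window_def truncate_def)
    qed (rule Iq)
    moreover have "(\<integral>g. indicator {-S..S} g *\<^sub>R (g * p g * ?\<phi> g - q g * ?\<phi> g) \<partial>lborel)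
        = - (?\<phi> S * p S) - - (?\<phi> (-S) * p (-S))"
    proof (rule integral_FTC_atLeastAtMost)
      show "((\<lambda>g. - (?\<phi> g * p g)) has_vector_derivative g * p g * ?\<phi> g - q g * ?\<phi> g) (at g within {-S..S})" for g
        unfolding has_real_derivative_iff_has_vector_derivative[symmetric]
        by (auto intro!: derivative_eq_intros has_field_derivative_at_within[OF p] has_field_derivative_at_within[OF d\<phi>]
            simp: algebra_simps)
      show "continuous_on {-S..S} (\<lambda>g. g * p g * ?\<phi> g - q g * ?\<phi> g)"
        by (intro continuous_intros continuous_on_subset[OF q] continuous_on_subset[OF pc] continuous_on_subset[OF \<phi>c]) auto
    qed (use S0 in auto)
    moreover have "\<dots> \<le> 0"
    proof -
      have "p (-S) \<le> p S" by (rule DERIV_nonneg_imp_nondecreasing) (use S0 p q0 in auto)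
      then have "?\<phi> S * p (-S) \<le> ?\<phi> S * p S" by (intro mult_left_mono) (auto simp: normal_density_nonneg)
      then show ?thesis by (simp add: std_normal_density_def)
    qed
    moreover have "(\<integral>g. indicator {-S..S} g *\<^sub>R (g * p g * ?\<phi> g - q g * ?\<phi> g) \<partial>lborel)
       = (\<integral>g. indicator {-S..S} g *\<^sub>R (g * p g * ?\<phi> g) \<partial>lborel) - (\<integral>g. indicator {-S..S} g *\<^sub>R (q g * ?\<phi> g) \<partial>lborel)"
      unfolding scaleR_diff_right
      by (intro Bochner_Integration.integral_diff Icomp continuous_intros q pc \<phi>c)
    ultimately show "(\<integral>z. z * p z \<partial>truncated_gauss s r) \<le> (\<integral>z. q z \<partial>truncated_gauss s r)"
      unfolding zp by linarith
  qed
qed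

section \<open>Backward iteration as an integral over the driving noise\<close>

text \<open>
  The scheme written over the coordinates of a given sequence, one update per step as in \<open>kernel\<close>.
\<close>

primrec path_seq ::
  "(nat \<Rightarrow> real \<Rightarrow> real) \<Rightarrow> (nat \<Rightarrow> real \<Rightarrow> real) \<Rightarrow> ereal \<Rightarrow> (nat \<Rightarrow> real) \<Rightarrow> (nat \<Rightarrow> real) \<Rightarrow> nat \<Rightarrow> nat \<Rightarrow> real" where
  "path_seq m s t x g 0 = x"
| "path_seq m s t x g (Suc n) = (path_seq m s t x g n)
     (Suc n := m n (path_seq m s t x g n n) + s n (path_seq m s t x g n n) * truncate t (g (Suc n)))"

lemma path_seq_cong: "(\<And>j. j \<in> {1..n} \<Longrightarrow> g j = g' j) \<Longrightarrow> path_seq m s t x g n = path_seq m s t x g' n"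
  by (induction n) auto

lemma measurable_path_seq:
  assumes "\<And>k. k < n \<Longrightarrow> m k \<in> borel_measurable borel" "\<And>k. k < n \<Longrightarrow> s k \<in> borel_measurable borel"
    and [measurable]: "x \<in> M \<rightarrow>\<^sub>M PiM UNIV (\<lambda>_. borel)" and "\<And>j. j \<in> {1..n} \<Longrightarrow> (\<lambda>\<omega>. g \<omega> j) \<in> borel_measurable M"
  shows "(\<lambda>\<omega>. path_seq m s t (x \<omega>) (g \<omega>) n) \<in> M \<rightarrow>\<^sub>M PiM UNIV (\<lambda>_. borel)"
  using assms(1,2,4)
proof (induction n)
  case (Suc n)
  have [measurable]: "(\<lambda>\<omega>. path_seq m s t (x \<omega>) (g \<omega>) n) \<in> M \<rightarrow>\<^sub>M PiM UNIV (\<lambda>_. borel)"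
    by (rule Suc.IH) (use Suc.prems in auto)
  have [measurable]: "m n \<in> borel_measurable borel" "s n \<in> borel_measurable borel"
    "(\<lambda>\<omega>. g \<omega> (Suc n)) \<in> borel_measurable M"
    using Suc.prems by auto
  show ?case unfolding path_seq.simps by (rule measurable_fun_upd[where J = UNIV]) auto
qed auto

lemma path_seq_bounded:
  assumes "\<And>k. k < n \<Longrightarrow> continuous_on UNIV (m k)" "\<And>k. k < n \<Longrightarrow> continuous_on UNIV (s k)"
  shows "\<exists>R'. \<forall>x g i. (\<forall>i\<le>N. \<bar>x i\<bar> \<le> R) \<longrightarrow> (\<forall>j\<in>{1..n}. \<bar>truncate t (g j)\<bar> \<le> S) \<longrightarrow>
     i \<le> max N n \<longrightarrow> \<bar>path_seq m s t x g n i\<bar> \<le> R'"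
  using assms
proof (induction n)
  case 0
  then show ?case by auto
next
  case (Suc n)
  obtain R' where R': "\<And>x g i. (\<forall>i\<le>N. \<bar>x i\<bar> \<le> R) \<Longrightarrow> (\<forall>j\<in>{1..n}. \<bar>truncate t (g j)\<bar> \<le> S) \<Longrightarrow> i \<le> max N n
     \<Longrightarrow> \<bar>path_seq m s t x g n i\<bar> \<le> R'"
    using Suc.IH Suc.prems less_SucI by metis
  obtain C1 where C1: "\<And>y. \<bar>y\<bar> \<le> R' \<Longrightarrow> \<bar>m n y\<bar> \<le> C1"
    using continuous_locally_bounded[of "m n"] Suc.prems by blast
  obtain C2 where C2: "\<And>y. \<bar>y\<bar> \<le> R' \<Longrightarrow> \<bar>s n y\<bar> \<le> C2"
    using continuous_locally_bounded[of "s n"] Suc.prems by blast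
  have "\<bar>path_seq m s t x g (Suc n) i\<bar> \<le> max R' (C1 + C2 * S)"
    if x: "\<forall>i\<le>N. \<bar>x i\<bar> \<le> R" and g: "\<forall>j\<in>{1..Suc n}. \<bar>truncate t (g j)\<bar> \<le> S" and i: "i \<le> max N (Suc n)" for x g i
  proof -
    have g': "\<forall>j\<in>{1..n}. \<bar>truncate t (g j)\<bar> \<le> S" "\<bar>truncate t (g (Suc n))\<bar> \<le> S" using g by auto
    define y where "y = path_seq m s t x g n n"
    have y: "\<bar>y\<bar> \<le> R'" unfolding y_def by (rule R'[OF x g'(1)]) simp
    have "\<bar>s n y * truncate t (g (Suc n))\<bar> \<le> C2 * S"
      unfolding abs_mult using C2[OF y] g' by (intro mult_mono) auto
    then have "\<bar>m n y + s n y * truncate t (g (Suc n))\<bar> \<le> C1 + C2 * S" using C1[OF y] by linarith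
    then show ?thesis using R'[OF x g'(1), of i] i
      by (cases "i = Suc n") (auto simp: y_def le_max_iff_disj le_Suc_eq)
  qed
  then show ?case by blast
qed

abbreviation gauss_vector :: "nat \<Rightarrow> (nat \<Rightarrow> real) measure" where
  "gauss_vector n \<equiv> PiM {1..n} (\<lambda>_. std_normal_distribution)"

definition windows :: "ereal \<Rightarrow> nat \<Rightarrow> (nat \<Rightarrow> real) \<Rightarrow> real" where
  "windows r n g = (\<Prod>j\<in>{1..n}. window r (g j))"

lemma windows_eq: "windows r n g = (if \<forall>j\<in>{1..n}. ereal \<bar>g j\<bar> \<le> r then 1 else 0)"
  by (auto simp: windows_def window_def)

lemma prob_space_std_normal: "prob_space std_normal_distribution"
  by (rule prob_space_normal_density) simp

lemma prob_space_gauss_vector: "prob_space (gauss_vector n)"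
  by (intro prob_space_PiM prob_space_std_normal)

lemma measurable_gauss_component: "j \<in> {1..n} \<Longrightarrow> (\<lambda>g. g j) \<in> borel_measurable (gauss_vector n)"
  using measurable_component_singleton[of j "{1..n}" "\<lambda>_. std_normal_distribution"] by simp

lemma measurable_windows: "windows r n \<in> borel_measurable (gauss_vector n)"
  unfolding windows_def[abs_def]
  by (intro borel_measurable_prod measurable_compose[OF measurable_gauss_component]) auto

lemma path_seq_integrable:
  assumes f: "tame N f" and n: "n \<le> N" and S: "min t r = ereal S" "0 \<le> S"
    and m: "\<And>k. k < n \<Longrightarrow> continuous_on UNIV (m k)" and s: "\<And>k. k < n \<Longrightarrow> continuous_on UNIV (s k)"
  shows "integrable (gauss_vector n) (\<lambda>g. f (path_seq m s t x g n) * windows r n g)"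
proof -
  interpret prob_space "gauss_vector n" by (rule prob_space_gauss_vector)
  obtain R where R: "\<And>i. i \<le> N \<Longrightarrow> \<bar>x i\<bar> \<le> R"
  proof
    fix i assume "i \<le> N"
    then show "\<bar>x i\<bar> \<le> (\<Sum>i\<le>N. \<bar>x i\<bar>)" by (intro member_le_sum) auto
  qed
  obtain R' where R': "\<And>g i. (\<forall>j\<in>{1..n}. \<bar>truncate t (g j)\<bar> \<le> S) \<Longrightarrow> i \<le> N \<Longrightarrow> \<bar>path_seq m s t x g n i\<bar> \<le> R'"
    using path_seq_bounded[where n = n and m = m and s = s and N = N and R = R and t = t and S = S, OF m s] R
    by (metis le_max_iff_disj)
  obtain C where C: "\<And>y. (\<And>i. i \<le> N \<Longrightarrow> \<bar>y i\<bar> \<le> R') \<Longrightarrow> \<bar>f y\<bar> \<le> C" using tameD_bounded[OF f] by blast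
  have "\<bar>f (path_seq m s t x g n) * windows r n g\<bar> \<le> \<bar>C\<bar>" for g
  proof (cases "\<forall>j\<in>{1..n}. ereal \<bar>g j\<bar> \<le> r")
    case True
    then have "\<forall>j\<in>{1..n}. \<bar>truncate t (g j)\<bar> \<le> S"
      using truncate_bounded[OF S] by blast
    then have "\<bar>f (path_seq m s t x g n)\<bar> \<le> C" by (intro C R')
    then show ?thesis using True by (simp add: windows_eq)
  next
    case False
    then have "windows r n g = 0" by (simp only: windows_eq if_False)
    then show ?thesis by simp
  qed
  moreover have "(\<lambda>g. f (path_seq m s t x g n)) \<in> borel_measurable (gauss_vector n)"
  proof (rule measurable_compose[OF _ tameD_measurable[OF f]])
    show "(\<lambda>g. path_seq m s t x g n) \<in> gauss_vector n \<rightarrow>\<^sub>M PiM UNIV (\<lambda>_. borel)"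
      using m s by (intro measurable_path_seq borel_measurable_continuous_onI measurable_gauss_component)
        (auto simp: space_PiM)
  qed
  ultimately show ?thesis
    using measurable_windows[of r n]
    by (intro integrable_const_bound[of _ "\<bar>C\<bar>"] borel_measurable_times) simp_all
qed

text \<open>
  Fubini's theorem with the last noise variable integrated first.
\<close>

lemma backward_eq_integral:
  assumes f: "tame N f" and n: "n \<le> N" and t: "0 \<le> t" and r: "0 \<le> r" and S: "min t r = ereal S"
    and m: "\<And>k. k < n \<Longrightarrow> continuous_on UNIV (m k)" and s: "\<And>k. k < n \<Longrightarrow> continuous_on UNIV (s k)"
  shows "stein_noise.backward (truncated_gauss t r) m s n f x
    = (\<integral>g. f (path_seq m s t x g n) * windows r n g \<partial>gauss_vector n)"
  using f n m s
proof (induction n arbitrary: f)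
  case 0
  interpret stein_noise "truncated_gauss t r" S by (rule truncated_gauss_stein_noise[OF t r S])
  interpret P: prob_space "gauss_vector 0" by (rule prob_space_gauss_vector)
  show ?case using P.prob_space by (simp add: windows_def)
next
  case (Suc n)
  interpret N: stein_noise "truncated_gauss t r" S by (rule truncated_gauss_stein_noise[OF t r S])
  interpret G: prob_space std_normal_distribution by (rule prob_space_std_normal)
  interpret product_sigma_finite "\<lambda>_::nat. std_normal_distribution" by standard
  have ins: "{1..Suc n} = insert (Suc n) {1..n}" by auto
  have tk: "tame N (N.kernel (m n) (s n) n f)"
    using Suc.prems by (intro N.tame_kernel) auto
  have "(\<integral>g. f (path_seq m s t x g (Suc n)) * windows r (Suc n) g \<partial>gauss_vector (Suc n))
     = (\<integral>g. (\<integral>y. f (path_seq m s t x (g(Suc n := y)) (Suc n)) * windows r (Suc n) (g(Suc n := y)) \<partial>std_normal_distribution) \<partial>gauss_vector n)"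
    unfolding ins
  proof (rule product_integral_insert)
    show "integrable (PiM (insert (Suc n) {1..n}) (\<lambda>_. std_normal_distribution))
       (\<lambda>g. f (path_seq m s t x g (Suc n)) * windows r (Suc n) g)"
      using path_seq_integrable[where n = "Suc n" and m = m and s = s, OF Suc.prems(1,2) S N.S_nonneg Suc.prems(3,4)]
      unfolding ins by blast
  qed auto
  also have "\<dots> = (\<integral>g. N.kernel (m n) (s n) n f (path_seq m s t x g n) * windows r n g \<partial>gauss_vector n)"
  proof (rule Bochner_Integration.integral_cong[OF refl])
    fix g :: "nat \<Rightarrow> real"
    define p where "p = path_seq m s t x g n"
    have p: "path_seq m s t x (g(Suc n := y)) n = p" for y
      unfolding p_def by (rule path_seq_cong) auto
    have w: "windows r (Suc n) (g(Suc n := y)) = windows r n g * window r y" for y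
      unfolding windows_def ins by (simp add: mult.commute)
    have "(\<integral>y. f (path_seq m s t x (g(Suc n := y)) (Suc n)) * windows r (Suc n) (g(Suc n := y)) \<partial>std_normal_distribution)
       = (\<integral>y. (window r y * f (p(Suc n := m n (p n) + s n (p n) * truncate t y))) * windows r n g \<partial>std_normal_distribution)"
      unfolding w path_seq.simps p by (simp add: ac_simps)
    also have "\<dots> = (\<integral>y. window r y * f (p(Suc n := m n (p n) + s n (p n) * truncate t y)) \<partial>std_normal_distribution) * windows r n g"
      by (rule integral_mult_left_zero)
    also have "(\<integral>y. window r y * f (p(Suc n := m n (p n) + s n (p n) * truncate t y)) \<partial>std_normal_distribution)
       = N.kernel (m n) (s n) n f p"
      unfolding N.kernel_def
      by (rule integral_truncated_gauss(1)[symmetric]) (rule N.measurable_kernel_section[OF tameD_measurable[OF Suc.prems(1)]])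
    finally show "(\<integral>y. f (path_seq m s t x (g(Suc n := y)) (Suc n)) * windows r (Suc n) (g(Suc n := y)) \<partial>std_normal_distribution)
       = N.kernel (m n) (s n) n f (path_seq m s t x g n) * windows r n g" unfolding p_def .
  qed
  also have "\<dots> = N.backward m s (Suc n) f x"
    using Suc.IH[OF tk] Suc.prems by simp
  finally show ?case ..
qed

section \<open>Extended expectations\<close>

lemma ext_expectation_mono:
  assumes "\<And>\<omega>. f \<omega> \<le> g \<omega>"
  shows "ext_expectation M f \<le> ext_expectation M g"
  unfolding ext_expectation_def
  by (intro ereal_minus_mono) (auto simp: less_eq_ennreal.rep_eq[symmetric] intro!: nn_integral_mono ennreal_leI assms)

lemma ext_expectation_not_minf:
  assumes "neg_part_integrable M f"
  shows "ext_expectation M f \<noteq> - \<infinity>"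
  using assms unfolding ext_expectation_def neg_part_integrable_def
  by (cases "\<integral>\<^sup>+ \<omega>. ennreal (f \<omega>) \<partial>M" rule: ennreal_cases; cases "\<integral>\<^sup>+ \<omega>. ennreal (- f \<omega>) \<partial>M" rule: ennreal_cases) auto

lemma ext_expectation_integrable:
  assumes "integrable M f"
  shows "ext_expectation M f = ereal (\<integral>\<omega>. f \<omega> \<partial>M)"
proof -
  have "(\<integral>\<^sup>+ \<omega>. ennreal (f \<omega>) \<partial>M) < \<infinity>" "(\<integral>\<^sup>+ \<omega>. ennreal (- f \<omega>) \<partial>M) < \<infinity>"
    using assms by (auto simp: real_integrable_def less_top)
  then show ?thesis
    unfolding ext_expectation_def real_lebesgue_integral_def[OF assms]
    by (cases "\<integral>\<^sup>+ \<omega>. ennreal (f \<omega>) \<partial>M" rule: ennreal_cases; cases "\<integral>\<^sup>+ \<omega>. ennreal (- f \<omega>) \<partial>M" rule: ennreal_cases)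
      auto
qed

lemma ext_expectation_nonneg:
  assumes "\<And>\<omega>. 0 \<le> f \<omega>"
  shows "ext_expectation M f = enn2ereal (\<integral>\<^sup>+ \<omega>. ennreal (f \<omega>) \<partial>M)"
proof -
  have "(\<integral>\<^sup>+ \<omega>. ennreal (- f \<omega>) \<partial>M) = 0"
    using assms by (simp add: ennreal_neg)
  then show ?thesis by (simp add: ext_expectation_def zero_ennreal.rep_eq)
qed

lemma ext_expectation_infinite:
  "(\<integral>\<^sup>+ \<omega>. ennreal (f \<omega>) \<partial>M) = \<infinity> \<Longrightarrow> ext_expectation M f = \<infinity>"
  by (simp add: ext_expectation_def)

lemma neg_part_integrable_minorant:
  assumes "integrable M h" "\<And>\<omega>. h \<omega> \<le> f \<omega>"
  shows "neg_part_integrable M f"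
proof -
  have "(\<integral>\<^sup>+ \<omega>. ennreal (- f \<omega>) \<partial>M) \<le> (\<integral>\<^sup>+ \<omega>. ennreal (- h \<omega>) \<partial>M)"
    by (intro nn_integral_mono ennreal_leI) (use assms(2) in auto)
  also have "\<dots> < \<infinity>" using assms(1) by (auto simp: real_integrable_def less_top)
  finally show ?thesis by (simp add: neg_part_integrable_def)
qed

text \<open>
  Monotone convergence for the positive and for the negative part; the limit of the latter is finite, so the difference
  converges.
\<close>

lemma ext_expectation_window_limit:
  fixes W :: "nat \<Rightarrow> 'w \<Rightarrow> real"
  assumes f[measurable]: "f \<in> borel_measurable M" and neg: "neg_part_integrable M f"
    and W[measurable]: "\<And>n. W n \<in> borel_measurable M" and W01: "\<And>n \<omega>. W n \<omega> = 0 \<or> W n \<omega> = 1"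
    and inc: "\<And>\<omega>. incseq (\<lambda>n. W n \<omega>)" and lim: "\<And>\<omega>. \<exists>n. W n \<omega> = 1"
  shows "(\<lambda>n. ext_expectation M (\<lambda>\<omega>. f \<omega> * W n \<omega>)) \<longlonglongrightarrow> ext_expectation M f"
proof -
  have mc: "(\<lambda>n. \<integral>\<^sup>+ \<omega>. ennreal (h \<omega> * W n \<omega>) \<partial>M) \<longlonglongrightarrow> (\<integral>\<^sup>+ \<omega>. ennreal (h \<omega>) \<partial>M)"
    if [measurable]: "h \<in> borel_measurable M" for h
  proof (rule nn_integral_LIMSEQ)
    show "incseq (\<lambda>n \<omega>. ennreal (h \<omega> * W n \<omega>))"
    proof (rule incseq_SucI, rule le_funI)
      fix n \<omega>
      have "W n \<omega> \<le> W (Suc n) \<omega>" by (rule incseq_SucD[OF inc])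
      then show "ennreal (h \<omega> * W n \<omega>) \<le> ennreal (h \<omega> * W (Suc n) \<omega>)"
        using W01[of n \<omega>] W01[of "Suc n" \<omega>] by auto
    qed
    fix \<omega>
    obtain N where N: "W N \<omega> = 1" using lim by blast
    have "W n \<omega> = 1" if "N \<le> n" for n
      using incseqD[OF inc that, of \<omega>] N W01[of n \<omega>] by auto
    then have "eventually (\<lambda>n. ennreal (h \<omega> * W n \<omega>) = ennreal (h \<omega>)) sequentially"
      unfolding eventually_sequentially by (intro exI[of _ N]) simp
    then show "(\<lambda>n. ennreal (h \<omega> * W n \<omega>)) \<longlonglongrightarrow> ennreal (h \<omega>)" by (rule tendsto_eventually)
  qed auto
  have 1: "(\<lambda>n. enn2ereal (\<integral>\<^sup>+ \<omega>. ennreal (f \<omega> * W n \<omega>) \<partial>M)) \<longlonglongrightarrow> enn2ereal (\<integral>\<^sup>+ \<omega>. ennreal (f \<omega>) \<partial>M)"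
    by (intro tendsto_enn2erealI mc) auto
  have "(\<lambda>n. enn2ereal (\<integral>\<^sup>+ \<omega>. ennreal (- f \<omega> * W n \<omega>) \<partial>M)) \<longlonglongrightarrow> enn2ereal (\<integral>\<^sup>+ \<omega>. ennreal (- f \<omega>) \<partial>M)"
    by (intro tendsto_enn2erealI mc) auto
  then have 2: "(\<lambda>n. enn2ereal (\<integral>\<^sup>+ \<omega>. ennreal (- (f \<omega> * W n \<omega>)) \<partial>M)) \<longlonglongrightarrow> enn2ereal (\<integral>\<^sup>+ \<omega>. ennreal (- f \<omega>) \<partial>M)"
    by simp
  have fin: "enn2ereal (\<integral>\<^sup>+ \<omega>. ennreal (- f \<omega>) \<partial>M) \<noteq> \<infinity>" "enn2ereal (\<integral>\<^sup>+ \<omega>. ennreal (- f \<omega>) \<partial>M) \<noteq> - \<infinity>"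
    using neg unfolding neg_part_integrable_def
    by (cases "\<integral>\<^sup>+ \<omega>. ennreal (- f \<omega>) \<partial>M" rule: ennreal_cases; auto)+
  show ?thesis
    unfolding ext_expectation_def
    by (rule tendsto_diff_ereal_general[OF 1 2]) (use fin in auto)
qed

text \<open>
  For real \<open>t\<close> one has \<open>max t (- c) + c + min (max (- t) 0) c = max t 0 + c\<close>. The case \<open>c = 0\<close> compares the positive parts.
  If that of \<open>g\<close> has finite mean, the constants cancel for every \<open>c\<close>, and \<open>c \<rightarrow> \<infinity>\<close> brings in the whole negative
  parts, whether or not their means are finite.
\<close>

lemma ext_expectation_le_if_truncations_le:
  fixes f g :: "'w \<Rightarrow> real"
  assumes M: "prob_space M" and f[measurable]: "f \<in> borel_measurable M" and g[measurable]: "g \<in> borel_measurable M"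
    and le: "\<And>c::nat. (\<integral>\<^sup>+ \<omega>. ennreal (max (f \<omega>) (- real c) + real c) \<partial>M)
       \<le> (\<integral>\<^sup>+ \<omega>. ennreal (max (g \<omega>) (- real c) + real c) \<partial>M)"
  shows "ext_expectation M f \<le> ext_expectation M g"
proof (cases "(\<integral>\<^sup>+ \<omega>. ennreal (g \<omega>) \<partial>M) = \<infinity>")
  case True
  then show ?thesis by (simp add: ext_expectation_infinite)
next
  case False
  interpret prob_space M by (rule M)
  define P where "P = (\<lambda>h. \<integral>\<^sup>+ \<omega>. ennreal (h \<omega>) \<partial>M)"
  define N where "N = (\<lambda>(h :: 'w \<Rightarrow> real) (c::nat). \<integral>\<^sup>+ \<omega>. ennreal (min (- h \<omega>) (real c)) \<partial>M)"
  have ident: "(\<integral>\<^sup>+ \<omega>. ennreal (max (h \<omega>) (- real c) + real c) \<partial>M) + N h c = P h + ennreal (real c)"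
    if [measurable]: "h \<in> borel_measurable M" for h c
  proof -
    have "ennreal (max (h \<omega>) (- real c) + real c) + ennreal (min (- h \<omega>) (real c)) = ennreal (h \<omega>) + ennreal (real c)" for \<omega>
    proof (cases "h \<omega> \<ge> 0")
      case True
      then show ?thesis by (simp add: ennreal_neg max_def min_def flip: ennreal_plus)
    next
      case False
      then show ?thesis by (auto simp: ennreal_neg max_def min_def simp flip: ennreal_plus)
    qed
    then have "(\<integral>\<^sup>+ \<omega>. ennreal (max (h \<omega>) (- real c) + real c) \<partial>M) + N h c
        = (\<integral>\<^sup>+ \<omega>. ennreal (h \<omega>) + ennreal (real c) \<partial>M)"
      unfolding N_def by (subst nn_integral_add[symmetric]) auto
    also have "\<dots> = P h + ennreal (real c)"
      unfolding P_def by (subst nn_integral_add) (auto simp: emeasure_space_1)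
    finally show ?thesis .
  qed
  have Nc: "N h c \<le> ennreal (real c)" for h c
  proof -
    have "N h c \<le> (\<integral>\<^sup>+ \<omega>. ennreal (real c) \<partial>M)" unfolding N_def by (intro nn_integral_mono ennreal_leI) auto
    then show ?thesis by (simp add: emeasure_space_1)
  qed
  have Nlim: "(\<lambda>c. N h c) \<longlonglongrightarrow> P (\<lambda>\<omega>. - h \<omega>)" if [measurable]: "h \<in> borel_measurable M" for h
    unfolding N_def P_def
  proof (rule nn_integral_LIMSEQ)
    show "incseq (\<lambda>c \<omega>. ennreal (min (- h \<omega>) (real c)))"
      by (auto simp: incseq_def le_fun_def intro!: ennreal_leI)
    fix \<omega>
    obtain K :: nat where "- h \<omega> \<le> real K" using real_arch_simple by blast
    then have "eventually (\<lambda>c. ennreal (min (- h \<omega>) (real c)) = ennreal (- h \<omega>)) sequentially"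
      unfolding eventually_sequentially by (intro exI[of _ K]) (auto simp: min_def)
    then show "(\<lambda>c. ennreal (min (- h \<omega>) (real c))) \<longlonglongrightarrow> ennreal (- h \<omega>)" by (rule tendsto_eventually)
  qed auto
  have Pg: "P g < \<infinity>" using False by (simp add: P_def less_top)
  have step: "P f + N g c \<le> P g + N f c" for c
  proof -
    have "P f + ennreal (real c) + N g c = (\<integral>\<^sup>+ \<omega>. ennreal (max (f \<omega>) (- real c) + real c) \<partial>M) + N f c + N g c"
      using ident[OF f, of c] by simp
    also have "\<dots> \<le> (\<integral>\<^sup>+ \<omega>. ennreal (max (g \<omega>) (- real c) + real c) \<partial>M) + N f c + N g c"
      by (intro add_right_mono le)
    also have "\<dots> = P g + ennreal (real c) + N f c"
      using ident[OF g, of c] by (metis add.assoc add.commute)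
    finally have "ennreal (real c) + (P f + N g c) \<le> ennreal (real c) + (P g + N f c)"
      by (simp add: ac_simps)
    then show ?thesis by (subst (asm) ennreal_add_left_cancel_le) auto
  qed
  have lim: "P f + P (\<lambda>\<omega>. - g \<omega>) \<le> P g + P (\<lambda>\<omega>. - f \<omega>)"
    by (rule LIMSEQ_le[OF tendsto_add[OF tendsto_const Nlim[OF g]] tendsto_add[OF tendsto_const Nlim[OF f]]])
      (use step in auto)
  have Pf: "P f < \<infinity>"
  proof -
    have "P f + N g 0 \<le> P g + N f 0" by (rule step)
    then have "P f \<le> P g" using Nc[of f 0] Nc[of g 0] by simp
    then show ?thesis using Pg by (rule le_less_trans)
  qed
  have "enn2ereal (P f) - enn2ereal (P (\<lambda>\<omega>. - f \<omega>)) \<le> enn2ereal (P g) - enn2ereal (P (\<lambda>\<omega>. - g \<omega>))"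
    using lim Pf Pg
    by (cases "P f" rule: ennreal_cases; cases "P g" rule: ennreal_cases;
        cases "P (\<lambda>\<omega>. - f \<omega>)" rule: ennreal_cases; cases "P (\<lambda>\<omega>. - g \<omega>)" rule: ennreal_cases)
      (auto simp: top_unique simp flip: ennreal_plus)
  then show ?thesis by (simp add: ext_expectation_def P_def)
qed

section \<open>Starting points independent of the driving noise\<close>

text \<open>
  Independence in the form of Fubini's formula, which also holds for constant starting points.
\<close>

definition independent_start ::
  "'w measure \<Rightarrow> (nat \<Rightarrow> 'w \<Rightarrow> real) \<Rightarrow> nat \<Rightarrow> ('w \<Rightarrow> real) \<Rightarrow> bool" where
  "independent_start M G m U \<longleftrightarrow> U \<in> borel_measurable M \<and>
     (\<lambda>\<omega>. \<lambda>k\<in>{1..m}. G k \<omega>) \<in> M \<rightarrow>\<^sub>M gauss_vector m \<and>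
     (\<forall>\<Phi> \<in> borel_measurable (borel \<Otimes>\<^sub>M gauss_vector m). (\<integral>\<^sup>+ \<omega>. (\<Phi> (U \<omega>, \<lambda>k\<in>{1..m}. G k \<omega>) :: ennreal) \<partial>M)
        = (\<integral>\<^sup>+ \<omega>. \<integral>\<^sup>+ g. \<Phi> (U \<omega>, g) \<partial>gauss_vector m \<partial>M))"

lemma independent_start_measurable:
  assumes U: "independent_start M G m U" and \<Phi>: "\<Phi> \<in> borel_measurable (borel \<Otimes>\<^sub>M gauss_vector m)"
  shows "(\<lambda>\<omega>. \<Phi> (U \<omega>, \<lambda>k\<in>{1..m}. G k \<omega>)) \<in> borel_measurable M"
proof -
  have [measurable]: "U \<in> borel_measurable M" "(\<lambda>\<omega>. \<lambda>k\<in>{1..m}. G k \<omega>) \<in> M \<rightarrow>\<^sub>M gauss_vector m"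
    using U by (auto simp: independent_start_def)
  show ?thesis using \<Phi> by measurable
qed

lemma sets_gauss_vector: "sets (gauss_vector m) = sets (PiM {1..m} (\<lambda>_. borel))"
  by (intro sets_PiM_cong) auto

lemma gauss_vector_distr:
  assumes M: "prob_space M" and m: "m > 0"
    and G: "\<And>k. k \<in> {1..m} \<Longrightarrow> distributed M lborel (G k) (\<lambda>x. ennreal (std_normal_density x))"
    and ind: "prob_space.indep_vars M (\<lambda>_. borel) G {1..m}"
  shows "distr M (PiM {1..m} (\<lambda>_. borel)) (\<lambda>\<omega>. \<lambda>k\<in>{1..m}. G k \<omega>) = gauss_vector m"
proof -
  interpret prob_space M by (rule M)
  have rv: "random_variable borel (G k)" if "k \<in> {1..m}" for k
    using distributed_measurable[OF G[OF that]] by simp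
  have D: "distr M borel (G k) = std_normal_distribution" if "k \<in> {1..m}" for k
  proof -
    have "distr M lborel (G k) = std_normal_distribution"
      using distributed_distr_eq_density[OF G[OF that]] .
    moreover have "distr M lborel (G k) = distr M borel (G k)" by (rule distr_cong) auto
    ultimately show ?thesis by simp
  qed
  have "distr M (PiM {1..m} (\<lambda>_. borel)) (\<lambda>\<omega>. \<lambda>k\<in>{1..m}. G k \<omega>) = PiM {1..m} (\<lambda>k. distr M borel (G k))"
    using ind m rv by (subst (asm) indep_vars_iff_distr_eq_PiM') auto
  also have "\<dots> = gauss_vector m" by (rule PiM_cong) (auto simp: D)
  finally show ?thesis .
qed

lemma gauss_vector_measurable:
  assumes M: "prob_space M"
    and G: "\<And>k. k \<in> {1..m} \<Longrightarrow> distributed M lborel (G k) (\<lambda>x. ennreal (std_normal_density x))"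
  shows "(\<lambda>\<omega>. \<lambda>k\<in>{1..m}. G k \<omega>) \<in> M \<rightarrow>\<^sub>M gauss_vector m"
proof -
  have "G k \<in> M \<rightarrow>\<^sub>M std_normal_distribution" if "k \<in> {1..m}" for k
    using distributed_measurable[OF G[OF that]] by (simp cong: measurable_cong_sets)
  then show ?thesis by (intro measurable_restrict)
qed

lemma independent_start_const:
  assumes M: "prob_space M" and m: "m > 0"
    and G: "\<And>k. k \<in> {1..m} \<Longrightarrow> distributed M lborel (G k) (\<lambda>x. ennreal (std_normal_density x))"
    and ind: "prob_space.indep_vars M (\<lambda>_. borel) G {1..m}"
  shows "independent_start M G m (\<lambda>_. x)"
  unfolding independent_start_def
proof (intro conjI ballI)
  interpret prob_space M by (rule M)
  show Gm: "(\<lambda>\<omega>. \<lambda>k\<in>{1..m}. G k \<omega>) \<in> M \<rightarrow>\<^sub>M gauss_vector m" by (rule gauss_vector_measurable[OF M G])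
  fix \<Phi> :: "real \<times> (nat \<Rightarrow> real) \<Rightarrow> ennreal" assume [measurable]: "\<Phi> \<in> borel_measurable (borel \<Otimes>\<^sub>M gauss_vector m)"
  have "distr M (gauss_vector m) (\<lambda>\<omega>. \<lambda>k\<in>{1..m}. G k \<omega>) = gauss_vector m"
    unfolding distr_cong[OF refl sets_gauss_vector refl] by (rule gauss_vector_distr[OF M m G ind])
  then have "(\<integral>\<^sup>+ g. \<Phi> (x, g) \<partial>gauss_vector m)
     = (\<integral>\<^sup>+ g. \<Phi> (x, g) \<partial>distr M (gauss_vector m) (\<lambda>\<omega>. \<lambda>k\<in>{1..m}. G k \<omega>))" by simp
  also have "\<dots> = (\<integral>\<^sup>+ \<omega>. \<Phi> (x, \<lambda>k\<in>{1..m}. G k \<omega>) \<partial>M)"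
    by (rule nn_integral_distr[OF Gm]) measurable
  finally show "(\<integral>\<^sup>+ \<omega>. \<Phi> (x, \<lambda>k\<in>{1..m}. G k \<omega>) \<partial>M) = (\<integral>\<^sup>+ \<omega>. \<integral>\<^sup>+ g. \<Phi> (x, g) \<partial>gauss_vector m \<partial>M)"
    by (simp add: emeasure_space_1)
qed simp

text \<open>
  A product law is determined by its values on rectangles.
\<close>

lemma independent_start_if_indep:
  assumes M: "prob_space M" and m: "m > 0"
    and G: "\<And>k. k \<in> {1..m} \<Longrightarrow> distributed M lborel (G k) (\<lambda>x. ennreal (std_normal_density x))"
    and ind: "prob_space.indep_vars M (\<lambda>_. borel) G {1..m}"
    and Z: "prob_space.indep_set M
           (sets (vimage_algebra (space M) Z N))
           (sets (vimage_algebra (space M) (\<lambda>\<omega>. \<lambda>k\<in>{1..m}. G k \<omega>) (PiM {1..m} (\<lambda>_. borel))))"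
    and h: "h \<in> borel_measurable N" and Zm: "Z \<in> M \<rightarrow>\<^sub>M N"
  shows "independent_start M G m (\<lambda>\<omega>. h (Z \<omega>))"
proof -
  interpret prob_space M by (rule M)
  let ?U = "\<lambda>\<omega>. h (Z \<omega>)" and ?G = "\<lambda>\<omega>. \<lambda>k\<in>{1..m}. G k \<omega>"
  note [measurable] = h Zm
  have Um[measurable]: "?U \<in> borel_measurable M" by measurable
  have Gm: "?G \<in> M \<rightarrow>\<^sub>M gauss_vector m" by (rule gauss_vector_measurable[OF M G])
  then have Gm': "?G \<in> M \<rightarrow>\<^sub>M PiM {1..m} (\<lambda>_. borel)"
    unfolding measurable_cong_sets[OF refl sets_gauss_vector] .
  interpret U: prob_space "distr M borel ?U" by (rule prob_space_distr) (rule Um)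
  interpret V: prob_space "gauss_vector m" by (rule prob_space_gauss_vector)
  interpret UV: pair_sigma_finite "distr M borel ?U" "gauss_vector m" by standard
  have D: "distr M borel ?U \<Otimes>\<^sub>M gauss_vector m = distr M (borel \<Otimes>\<^sub>M PiM {1..m} (\<lambda>_. borel)) (\<lambda>\<omega>. (?U \<omega>, ?G \<omega>))"
  proof (rule pair_measure_eqI)
    show "sets (distr M borel ?U \<Otimes>\<^sub>M gauss_vector m)
        = sets (distr M (borel \<Otimes>\<^sub>M PiM {1..m} (\<lambda>_. borel)) (\<lambda>\<omega>. (?U \<omega>, ?G \<omega>)))"
      unfolding sets_distr by (rule sets_pair_measure_cong) (simp_all only: sets_distr sets_gauss_vector)
    fix A B assume A: "A \<in> sets (distr M borel ?U)" and B: "B \<in> sets (gauss_vector m)"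
    have A': "A \<in> sets borel" using A by simp
    have B': "B \<in> sets (PiM {1..m} (\<lambda>_. borel))" using B unfolding sets_gauss_vector .
    have "h -` A \<inter> space N \<in> sets N" by (rule measurable_sets[OF h A'])
    moreover have "?U -` A \<inter> space M = Z -` (h -` A \<inter> space N) \<inter> space M"
      using measurable_space[OF Zm] by auto
    ultimately have 1: "?U -` A \<inter> space M \<in> sets (vimage_algebra (space M) Z N)"
      by (simp only: in_vimage_algebra)
    have 2: "?G -` B \<inter> space M \<in> sets (vimage_algebra (space M) ?G (PiM {1..m} (\<lambda>_. borel)))"
      by (rule in_vimage_algebra[OF B'])
    have pm: "(\<lambda>\<omega>. (?U \<omega>, ?G \<omega>)) \<in> M \<rightarrow>\<^sub>M borel \<Otimes>\<^sub>M PiM {1..m} (\<lambda>_. borel)"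
      by (rule measurable_Pair[OF Um Gm'])
    have eB: "emeasure (gauss_vector m) B = emeasure M (?G -` B \<inter> space M)"
    proof -
      have "distr M (PiM {1..m} (\<lambda>_. borel)) ?G = gauss_vector m"
        by (rule gauss_vector_distr[OF M m G ind])
      then have "emeasure (gauss_vector m) B = emeasure (distr M (PiM {1..m} (\<lambda>_. borel)) ?G) B" by metis
      also have "\<dots> = emeasure M (?G -` B \<inter> space M)" by (rule emeasure_distr[OF Gm' B'])
      finally show ?thesis .
    qed
    have "emeasure (distr M borel ?U) A * emeasure (gauss_vector m) B
       = emeasure M (?U -` A \<inter> space M) * emeasure M (?G -` B \<inter> space M)"
      by (simp only: emeasure_distr[OF Um A'] eB)
    also have "\<dots> = emeasure M ((?U -` A \<inter> space M) \<inter> (?G -` B \<inter> space M))"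
      using indep_setD[OF Z 1 2] by (simp add: emeasure_eq_measure ennreal_mult)
    also have "(?U -` A \<inter> space M) \<inter> (?G -` B \<inter> space M) = (\<lambda>\<omega>. (?U \<omega>, ?G \<omega>)) -` (A \<times> B) \<inter> space M"
      by auto
    also have "emeasure M \<dots> = emeasure (distr M (borel \<Otimes>\<^sub>M PiM {1..m} (\<lambda>_. borel)) (\<lambda>\<omega>. (?U \<omega>, ?G \<omega>))) (A \<times> B)"
      by (rule emeasure_distr[symmetric, OF pm pair_measureI[OF A' B']])
    finally show "emeasure (distr M borel ?U) A * emeasure (gauss_vector m) B
       = emeasure (distr M (borel \<Otimes>\<^sub>M PiM {1..m} (\<lambda>_. borel)) (\<lambda>\<omega>. (?U \<omega>, ?G \<omega>))) (A \<times> B)" .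
  qed (rule U.sigma_finite_measure_axioms, rule V.sigma_finite_measure_axioms)
  show ?thesis
    unfolding independent_start_def
  proof (intro conjI ballI Um Gm)
    fix \<Phi> :: "real \<times> (nat \<Rightarrow> real) \<Rightarrow> ennreal" assume \<Phi>[measurable]: "\<Phi> \<in> borel_measurable (borel \<Otimes>\<^sub>M gauss_vector m)"
    have sets_eq: "sets (borel \<Otimes>\<^sub>M PiM {1..m} (\<lambda>_. borel)) = sets (borel \<Otimes>\<^sub>M gauss_vector m)"
      by (rule sets_pair_measure_cong[OF refl sets_gauss_vector[symmetric]])
    have \<Phi>': "\<Phi> \<in> borel_measurable (borel \<Otimes>\<^sub>M PiM {1..m} (\<lambda>_. borel))"
      using \<Phi> by (simp add: sets_eq cong: measurable_cong_sets)
    have "(\<integral>\<^sup>+ \<omega>. \<Phi> (?U \<omega>, ?G \<omega>) \<partial>M)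
       = (\<integral>\<^sup>+ p. \<Phi> p \<partial>distr M (borel \<Otimes>\<^sub>M PiM {1..m} (\<lambda>_. borel)) (\<lambda>\<omega>. (?U \<omega>, ?G \<omega>)))"
      by (rule nn_integral_distr[symmetric]) (use Gm' \<Phi>' in auto)
    also have "\<dots> = (\<integral>\<^sup>+ p. \<Phi> p \<partial>(distr M borel ?U \<Otimes>\<^sub>M gauss_vector m))" unfolding D ..
    also have "\<dots> = (\<integral>\<^sup>+ u. \<integral>\<^sup>+ g. \<Phi> (u, g) \<partial>gauss_vector m \<partial>distr M borel ?U)"
    proof (rule V.nn_integral_fst[symmetric])
      have "sets (distr M borel ?U \<Otimes>\<^sub>M gauss_vector m) = sets (borel \<Otimes>\<^sub>M gauss_vector m)"
        by (rule sets_pair_measure_cong[OF sets_distr refl])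
      from measurable_cong_sets[OF this refl] \<Phi>
      show "\<Phi> \<in> borel_measurable (distr M borel ?U \<Otimes>\<^sub>M gauss_vector m)" by blast
    qed
    also have "\<dots> = (\<integral>\<^sup>+ \<omega>. \<integral>\<^sup>+ g. \<Phi> (?U \<omega>, g) \<partial>gauss_vector m \<partial>M)"
      by (rule nn_integral_distr[OF Um]) (simp only: measurable_distr_eq1 V.borel_measurable_nn_integral_fst[OF \<Phi>])
    finally show "(\<integral>\<^sup>+ \<omega>. \<Phi> (?U \<omega>, ?G \<omega>) \<partial>M) = (\<integral>\<^sup>+ \<omega>. \<integral>\<^sup>+ g. \<Phi> (?U \<omega>, g) \<partial>gauss_vector m \<partial>M)" .
  qed
qed

text \<open>
  Finiteness of one of the two parts suffices: integrating \<open>\<psi>\<^sup>+ + q = \<psi>\<^sup>- + p\<close>, where \<open>\<psi> = p - q\<close> is the conditional mean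
  and \<open>p\<close>, \<open>q\<close> are the conditional means of the parts, relates the four integrals, and \<open>\<psi>\<^sup>+ \<le> p\<close>, \<open>\<psi>\<^sup>- \<le> q\<close>.
\<close>

lemma ext_expectation_fubini:
  fixes \<Phi> :: "real \<times> (nat \<Rightarrow> real) \<Rightarrow> real"
  assumes U: "independent_start M G m U"
    and \<Phi>[measurable]: "\<Phi> \<in> borel_measurable (borel \<Otimes>\<^sub>M gauss_vector m)"
    and int: "\<And>x. integrable (gauss_vector m) (\<lambda>g. \<Phi> (x, g))"
    and fin: "(\<integral>\<^sup>+ \<omega>. ennreal (\<Phi> (U \<omega>, \<lambda>k\<in>{1..m}. G k \<omega>)) \<partial>M) < \<infinity> \<or>
              (\<integral>\<^sup>+ \<omega>. ennreal (- \<Phi> (U \<omega>, \<lambda>k\<in>{1..m}. G k \<omega>)) \<partial>M) < \<infinity>"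
  shows "ext_expectation M (\<lambda>\<omega>. \<Phi> (U \<omega>, \<lambda>k\<in>{1..m}. G k \<omega>)) = ext_expectation M (\<lambda>\<omega>. \<integral>g. \<Phi> (U \<omega>, g) \<partial>gauss_vector m)"
proof -
  interpret V: prob_space "gauss_vector m" by (rule prob_space_gauss_vector)
  have [measurable]: "U \<in> borel_measurable M" using U by (simp add: independent_start_def)
  define p where "p = (\<lambda>x. \<integral>\<^sup>+ g. ennreal (\<Phi> (x, g)) \<partial>gauss_vector m)"
  define q where "q = (\<lambda>x. \<integral>\<^sup>+ g. ennreal (- \<Phi> (x, g)) \<partial>gauss_vector m)"
  define \<psi> where "\<psi> = (\<lambda>x. \<integral>g. \<Phi> (x, g) \<partial>gauss_vector m)"
  have [measurable]: "p \<in> borel_measurable borel" "q \<in> borel_measurable borel" "\<psi> \<in> borel_measurable borel"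
    unfolding p_def q_def \<psi>_def by measurable
  have pq: "p x < \<infinity>" "q x < \<infinity>" for x
    using int[of x] by (auto simp: real_integrable_def less_top p_def q_def)
  have \<psi>: "\<psi> x = enn2real (p x) - enn2real (q x)" for x
    unfolding \<psi>_def p_def q_def by (rule real_lebesgue_integral_def[OF int])
  have pq_real: "p x = ennreal (enn2real (p x))" "q x = ennreal (enn2real (q x))" for x
    using pq[of x] by (simp_all add: ennreal_enn2real_if less_top)
  have id: "ennreal (\<psi> x) + q x = ennreal (- \<psi> x) + p x" for x
  proof -
    have "ennreal (a - b) + ennreal b = ennreal (- (a - b)) + ennreal a" if "0 \<le> a" "0 \<le> b" for a b
      using that by (cases "b \<le> a") (auto simp: ennreal_neg simp flip: ennreal_plus)
    from this[of "enn2real (p x)" "enn2real (q x)"] show ?thesis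
      unfolding \<psi> by (simp flip: pq_real)
  qed
  have le: "ennreal (\<psi> x) \<le> p x" "ennreal (- \<psi> x) \<le> q x" for x
    by (subst pq_real, rule ennreal_leI, simp add: \<psi>)+
  define A B C D where "A = (\<integral>\<^sup>+ \<omega>. ennreal (\<psi> (U \<omega>)) \<partial>M)" and "B = (\<integral>\<^sup>+ \<omega>. ennreal (- \<psi> (U \<omega>)) \<partial>M)"
    and "C = (\<integral>\<^sup>+ \<omega>. p (U \<omega>) \<partial>M)" and "D = (\<integral>\<^sup>+ \<omega>. q (U \<omega>) \<partial>M)"
  have CD: "(\<integral>\<^sup>+ \<omega>. ennreal (\<Phi> (U \<omega>, \<lambda>k\<in>{1..m}. G k \<omega>)) \<partial>M) = C"
    "(\<integral>\<^sup>+ \<omega>. ennreal (- \<Phi> (U \<omega>, \<lambda>k\<in>{1..m}. G k \<omega>)) \<partial>M) = D"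
  proof -
    have F: "(\<integral>\<^sup>+ \<omega>. \<Psi> (U \<omega>, \<lambda>k\<in>{1..m}. G k \<omega>) \<partial>M) = (\<integral>\<^sup>+ \<omega>. \<integral>\<^sup>+ g. \<Psi> (U \<omega>, g) \<partial>gauss_vector m \<partial>M)"
      if "\<Psi> \<in> borel_measurable (borel \<Otimes>\<^sub>M gauss_vector m)" for \<Psi> :: "real \<times> (nat \<Rightarrow> real) \<Rightarrow> ennreal"
      using U that by (simp add: independent_start_def)
    show "(\<integral>\<^sup>+ \<omega>. ennreal (\<Phi> (U \<omega>, \<lambda>k\<in>{1..m}. G k \<omega>)) \<partial>M) = C"
      unfolding C_def p_def by (rule F[of "\<lambda>x. ennreal (\<Phi> x)"]) measurable
    show "(\<integral>\<^sup>+ \<omega>. ennreal (- \<Phi> (U \<omega>, \<lambda>k\<in>{1..m}. G k \<omega>)) \<partial>M) = D"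
      unfolding D_def q_def by (rule F[of "\<lambda>x. ennreal (- \<Phi> x)"]) measurable
  qed
  have sum: "A + D = B + C"
    unfolding A_def B_def C_def D_def
    by (subst (1 2) nn_integral_add[symmetric]) (auto simp: id)
  have AC: "A \<le> C" "B \<le> D" unfolding A_def B_def C_def D_def by (auto intro!: nn_integral_mono le)
  have "enn2ereal C - enn2ereal D = enn2ereal A - enn2ereal B"
    using fin sum AC unfolding CD
    by (cases A rule: ennreal_cases; cases B rule: ennreal_cases; cases C rule: ennreal_cases; cases D rule: ennreal_cases)
      (auto simp: top_unique simp flip: ennreal_plus)
  then show ?thesis
    unfolding ext_expectation_def CD by (simp add: A_def B_def \<psi>_def)
qed

section \<open>Functions of finitely many coordinates\<close>

text \<open>
  Functionals of all lengths become functions on one and the same space of sequences.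
\<close>

definition cylinder :: "nat \<Rightarrow> ((nat \<Rightarrow> real) \<Rightarrow> real) \<Rightarrow> (nat \<Rightarrow> real) \<Rightarrow> real" where
  "cylinder d f x = f (restrict x {..<d})"

lemma restrict_in_Rd: "restrict x {..<d} \<in> Rd d"
  by (auto simp: Rd_def)

lemma dirconvex_cylinder:
  assumes "dir_convex d f"
  shows "dirconvex_seq (cylinder d f)"
  unfolding dirconvex_seq_def cylinder_def
proof (intro allI impI)
  fix x y z :: "nat \<Rightarrow> real" assume yz: "\<forall>i. 0 \<le> y i \<and> 0 \<le> z i"
  let ?r = "\<lambda>x. restrict x {..<d}"
  have v: "vadd d (?r a) (?r b) = ?r (\<lambda>i. a i + b i)" for a b
    by (auto simp: vadd_def fun_eq_iff)
  have "f (vadd d (vadd d (?r x) (?r y)) (?r z)) - f (vadd d (?r x) (?r y)) - f (vadd d (?r x) (?r z)) + f (?r x) \<ge> 0"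
    using assms yz restrict_in_Rd[of _ d] unfolding dir_convex_def by auto
  then show "f (?r (\<lambda>i. x i + y i)) + f (?r (\<lambda>i. x i + z i)) \<le> f (?r (\<lambda>i. x i + y i + z i)) + f (?r x)"
    unfolding v by simp
qed

lemma increasing_cylinder:
  assumes "nondecreasing_each d f"
  shows "increasing_seq (cylinder d f)"
  unfolding increasing_seq_def
proof (intro allI impI)
  fix x y :: "nat \<Rightarrow> real" assume xy: "\<forall>i. x i \<le> y i"
  let ?h = "\<lambda>n. restrict (\<lambda>i. if i < n then y i else x i) {..<d}"
  have "f (?h 0) \<le> f (?h n)" if "n \<le> d" for n
    using that
  proof (induction n)
    case (Suc n)
    have "f (?h n) \<le> f ((?h n)(n := y n))"
      using assms xy Suc.prems restrict_in_Rd unfolding nondecreasing_each_def by simp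
    also have "(?h n)(n := y n) = ?h (Suc n)"
      using Suc.prems by (auto simp: fun_eq_iff less_Suc_eq)
    finally show ?case using Suc by simp
  qed simp
  from this[of d] show "cylinder d f x \<le> cylinder d f y"
    by (simp add: cylinder_def cong: restrict_cong)
qed

lemma measurable_cylinder:
  assumes "f \<in> borel_measurable (PiM {..<d} (\<lambda>_. borel))"
  shows "cylinder d f \<in> borel_measurable (PiM UNIV (\<lambda>_. borel))"
proof -
  have "(\<lambda>x. restrict x {..<d}) \<in> PiM UNIV (\<lambda>_. borel) \<rightarrow>\<^sub>M PiM {..<d} (\<lambda>_. borel :: real measure)"
    by (rule measurable_restrict_subset) simp
  from measurable_compose[OF this assms] show ?thesis by (simp add: cylinder_def[abs_def])
qed

text \<open>
  Induction on the number of coordinates that vary. The two endpoints of an edge bound the function from above;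
  once this is known, reflecting a coordinate about \<open>0\<close> bounds it from below.
\<close>

lemma coordinatewise_convex_bounded:
  fixes f :: "(nat \<Rightarrow> real) \<Rightarrow> real"
  assumes conv: "\<And>x j. convex_on UNIV (\<lambda>t. f (x(j := t)))"
    and dep: "\<And>x y. (\<And>i. i < d \<Longrightarrow> x i = y i) \<Longrightarrow> f x = f y" and R: "0 < R"
  shows "\<exists>C. \<forall>x. (\<forall>i<d. \<bar>x i\<bar> \<le> R) \<longrightarrow> \<bar>f x\<bar> \<le> C"
proof -
  have "\<exists>C. \<forall>x. (\<forall>i<j. \<bar>x i\<bar> \<le> R) \<and> (\<forall>i\<ge>j. x i = c i) \<longrightarrow> \<bar>f x\<bar> \<le> C" for j c
  proof (induction j arbitrary: c)
    case 0
    have "x = c" if "\<forall>i\<ge>0. x i = c i" for x using that by auto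
    then show ?case by blast
  next
    case (Suc j)
    have IH: "\<exists>C. \<forall>x. (\<forall>i<j. \<bar>x i\<bar> \<le> R) \<longrightarrow> (\<forall>i\<ge>j. x i = (c(j := v)) i) \<longrightarrow> \<bar>f x\<bar> \<le> C" for v
      using Suc.IH[of "c(j := v)"] by (simp only: imp_conjL)
    obtain C1 where C1: "\<And>x. \<forall>i<j. \<bar>x i\<bar> \<le> R \<Longrightarrow> \<forall>i\<ge>j. x i = (c(j := R)) i \<Longrightarrow> \<bar>f x\<bar> \<le> C1"
      using IH[of R] by blast
    obtain C2 where C2: "\<And>x. \<forall>i<j. \<bar>x i\<bar> \<le> R \<Longrightarrow> \<forall>i\<ge>j. x i = (c(j := - R)) i \<Longrightarrow> \<bar>f x\<bar> \<le> C2"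
      using IH[of "- R"] by blast
    obtain C0 where C0: "\<And>x. \<forall>i<j. \<bar>x i\<bar> \<le> R \<Longrightarrow> \<forall>i\<ge>j. x i = (c(j := 0)) i \<Longrightarrow> \<bar>f x\<bar> \<le> C0"
      using IH[of 0] by blast
    have up: "f x \<le> \<bar>C1\<bar> + \<bar>C2\<bar>" if x: "\<forall>i<Suc j. \<bar>x i\<bar> \<le> R" "\<forall>i\<ge>Suc j. x i = c i" for x
    proof -
      have "x j \<in> {- R..R}" using x(1)[rule_format, of j] by (auto simp: abs_le_iff)
      then have "f (x(j := x j)) \<le> max (f (x(j := - R))) (f (x(j := R)))"
        using convex_on_le_max[OF convex_on_subset[OF conv[of x j]], of "- R" R "x j"] by simp
      moreover have "\<bar>f (x(j := R))\<bar> \<le> C1" by (rule C1) (use x in auto)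
      moreover have "\<bar>f (x(j := - R))\<bar> \<le> C2" by (rule C2) (use x in auto)
      ultimately show ?thesis by (simp only: fun_upd_triv)
    qed
    have low: "- (2 * \<bar>C0\<bar> + \<bar>C1\<bar> + \<bar>C2\<bar>) \<le> f x" if x: "\<forall>i<Suc j. \<bar>x i\<bar> \<le> R" "\<forall>i\<ge>Suc j. x i = c i" for x
    proof -
      have "2 * f (x(j := 0)) \<le> f (x(j := 0 - x j)) + f (x(j := 0 + x j))"
        by (rule convex_on_midpoint[OF conv])
      moreover have "f (x(j := - x j)) \<le> \<bar>C1\<bar> + \<bar>C2\<bar>" by (rule up) (use x in auto)
      moreover have "\<bar>f (x(j := 0))\<bar> \<le> C0" by (rule C0) (use x in auto)
      ultimately show ?thesis by simp
    qed
    have "\<bar>f x\<bar> \<le> 2 * \<bar>C0\<bar> + \<bar>C1\<bar> + \<bar>C2\<bar>" if "\<forall>i<Suc j. \<bar>x i\<bar> \<le> R" "\<forall>i\<ge>Suc j. x i = c i" for x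
      using up[OF that] low[OF that] by linarith
    then show ?case by blast
  qed
  from this[of d "\<lambda>_. 0"] obtain C where C: "\<And>x. \<forall>i<d. \<bar>x i\<bar> \<le> R \<Longrightarrow> \<forall>i\<ge>d. x i = 0 \<Longrightarrow> \<bar>f x\<bar> \<le> C" by blast
  have "\<bar>f x\<bar> \<le> C" if "\<forall>i<d. \<bar>x i\<bar> \<le> R" for x
    using C[of "\<lambda>i. if i < d then x i else 0"] dep[of x "\<lambda>i. if i < d then x i else 0"] that by simp
  then show ?thesis by blast
qed

lemma cylinder_cong: "(\<And>i. i < d \<Longrightarrow> x i = y i) \<Longrightarrow> cylinder d f x = cylinder d f y"
  unfolding cylinder_def by (auto intro!: arg_cong[of _ _ f] restrict_ext)

text \<open>
  Borel measurability is part of directional convexity precisely for this: it excludes the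
  locally unbounded solutions of the Wright inequality in each coordinate.
\<close>

lemma tame_cylinder:
  assumes "dir_convex (Suc m) f"
  shows "tame m (cylinder (Suc m) f)"
  unfolding tame_def
proof (intro conjI allI)
  let ?f = "cylinder (Suc m) f"
  have D: "dirconvex_seq ?f" by (rule dirconvex_cylinder[OF assms])
  show M: "?f \<in> borel_measurable (PiM UNIV (\<lambda>_. borel))"
    by (rule measurable_cylinder) (use assms in \<open>simp add: dir_convex_def\<close>)
  have conv: "convex_on UNIV (\<lambda>t. ?f (x(j := t)))" for x j
  proof (rule convex_on_if_wright_convex_bounded)
    show W: "wright_convex (\<lambda>t. ?f (x(j := t)))"
      unfolding wright_convex_def
    proof (intro allI impI)
      fix a y z :: real assume yz: "0 \<le> y \<and> 0 \<le> z"
      define e where "e = (\<lambda>c i. if i = j then c else (0::real))"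
      have u: "(\<lambda>i. (x(j := a)) i + e c i) = x(j := a + c)"
        "(\<lambda>i. (x(j := a)) i + e c i + e c' i) = x(j := a + c + c')" for c c'
        by (auto simp: e_def)
      show "?f (x(j := a + y)) + ?f (x(j := a + z)) \<le> ?f (x(j := a + y + z)) + ?f (x(j := a))"
        using dirconvex_seqD[OF D, of "e y" "e z" "x(j := a)"] yz unfolding u by (simp add: e_def)
    qed
    have [measurable]: "(\<lambda>t::real. x(j := t)) \<in> borel \<rightarrow>\<^sub>M PiM UNIV (\<lambda>_. borel)"
      by (rule measurable_fun_upd[where J = UNIV]) (auto simp: space_PiM)
    note [measurable] = M
    show "\<exists>C. \<forall>t. \<bar>t\<bar> \<le> R \<longrightarrow> \<bar>?f (x(j := t))\<bar> \<le> C" for R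
      by (rule wright_convex_measurable_bounded[OF W]) measurable
  qed
  fix R :: real
  have "\<exists>C. \<forall>x. (\<forall>i<Suc m. \<bar>x i\<bar> \<le> max R 1) \<longrightarrow> \<bar>?f x\<bar> \<le> C"
    by (rule coordinatewise_convex_bounded[OF conv cylinder_cong]) auto
  then show "\<exists>C. \<forall>x. (\<forall>i\<le>m. \<bar>x i\<bar> \<le> R) \<longrightarrow> \<bar>?f x\<bar> \<le> C"
    by (metis le_max_iff_disj less_Suc_eq_le)
qed

section \<open>Affine minorants on orthants\<close>

text \<open>
  Relative to the corner with all coordinates \<open>a\<close>, directional convexity makes \<open>f\<close> superadditive in the increments, so
  \<open>f\<close> dominates a sum of convex functions of one variable, and each of these has an affine minorant. Outside of
  the orthants there need not be one.
\<close>

lemma dirconvex_orthant_minorant_up: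
  assumes f: "dirconvex_seq f" and conv: "\<And>x j. convex_on UNIV (\<lambda>t. f (x(j := t)))"
    and dep: "\<And>x y. (\<And>i. i < d \<Longrightarrow> x i = y i) \<Longrightarrow> f x = f y"
  shows "\<exists>c\<ge>0. \<forall>x. (\<forall>i<d. a \<le> x i) \<longrightarrow> - c * (1 + (\<Sum>i<d. \<bar>x i\<bar>)) \<le> f x"
proof -
  let ?a = "\<lambda>_::nat. a"
  have "\<exists>c. (\<forall>t. - c * (1 + \<bar>t\<bar>) \<le> f (?a(i := t))) \<and> c \<ge> 0" for i
    using convex_on_UNIV_affine_minorant[OF conv] by metis
  then obtain c where c: "\<And>i t. - c i * (1 + \<bar>t\<bar>) \<le> f (?a(i := t))" "\<And>i. c i \<ge> 0" by metis
  have super: "f ?a + (\<Sum>i<n. f (?a(i := x i)) - f ?a) \<le> f (\<lambda>i. if i < n then x i else a)"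
    if x: "\<forall>i<d. a \<le> x i" and n: "n \<le> d" for x n
    using n
  proof (induction n)
    case (Suc n)
    define y where "y = (\<lambda>i. if i < n then x i - a else 0)"
    define z where "z = (\<lambda>i. if i = n then x n - a else 0)"
    have "f (\<lambda>i. a + y i) + f (\<lambda>i. a + z i) \<le> f (\<lambda>i. a + y i + z i) + f ?a"
      by (rule dirconvex_seqD[OF f]) (use x Suc.prems in \<open>auto simp: y_def z_def\<close>)
    moreover have "(\<lambda>i. a + y i) = (\<lambda>i. if i < n then x i else a)" "(\<lambda>i. a + z i) = ?a(n := x n)"
      "(\<lambda>i. a + y i + z i) = (\<lambda>i. if i < Suc n then x i else a)"
      by (auto simp: y_def z_def)
    ultimately have "f (\<lambda>i. if i < n then x i else a) + f (?a(n := x n))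
       \<le> f (\<lambda>i. if i < Suc n then x i else a) + f ?a" by (simp only:)
    then show ?case using Suc.IH[OF Suc_leD[OF Suc.prems]] unfolding sum.lessThan_Suc by linarith
  qed simp
  define K where "K = \<bar>f ?a\<bar> + (\<Sum>i<d. c i + \<bar>f ?a\<bar>)"
  have K0: "K \<ge> 0" unfolding K_def using c(2) by (auto intro!: add_nonneg_nonneg sum_nonneg)
  have "- K * (1 + (\<Sum>i<d. \<bar>x i\<bar>)) \<le> f x" if x: "\<forall>i<d. a \<le> x i" for x
  proof -
    have s0: "0 \<le> (\<Sum>i<d. \<bar>x i\<bar>)" by (intro sum_nonneg) auto
    have "(\<Sum>i<d. - ((c i + \<bar>f ?a\<bar>) * (1 + (\<Sum>i<d. \<bar>x i\<bar>)))) \<le> (\<Sum>i<d. f (?a(i := x i)) - f ?a)"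
    proof (rule sum_mono)
      fix i assume i: "i \<in> {..<d}"
      have "\<bar>x i\<bar> \<le> (\<Sum>i<d. \<bar>x i\<bar>)" using i by (intro member_le_sum) auto
      then have "c i * (1 + \<bar>x i\<bar>) \<le> c i * (1 + (\<Sum>i<d. \<bar>x i\<bar>))" using c(2) by (intro mult_left_mono) auto
      moreover have "\<bar>f ?a\<bar> * 1 \<le> \<bar>f ?a\<bar> * (1 + (\<Sum>i<d. \<bar>x i\<bar>))" using s0 by (intro mult_left_mono) auto
      ultimately show "- ((c i + \<bar>f ?a\<bar>) * (1 + (\<Sum>i<d. \<bar>x i\<bar>))) \<le> f (?a(i := x i)) - f ?a"
        using c(1)[of i "x i"] by (simp only: distrib_right)
    qed
    also have "\<dots> \<le> f (\<lambda>i. if i < d then x i else a) - f ?a" using super[OF x, of d] by simp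
    also have "f (\<lambda>i. if i < d then x i else a) = f x" by (rule dep) auto
    finally have "- ((\<Sum>i<d. c i + \<bar>f ?a\<bar>) * (1 + (\<Sum>i<d. \<bar>x i\<bar>))) \<le> f x - f ?a"
      by (simp add: sum_negf flip: sum_distrib_right)
    moreover have "\<bar>f ?a\<bar> * 1 \<le> \<bar>f ?a\<bar> * (1 + (\<Sum>i<d. \<bar>x i\<bar>))" using s0 by (intro mult_left_mono) auto
    moreover have "- K * (1 + (\<Sum>i<d. \<bar>x i\<bar>)) = - (\<bar>f ?a\<bar> * (1 + (\<Sum>i<d. \<bar>x i\<bar>)))
        - (\<Sum>i<d. c i + \<bar>f ?a\<bar>) * (1 + (\<Sum>i<d. \<bar>x i\<bar>))"
      unfolding K_def minus_add_distrib by (simp only: left_diff_distrib diff_conv_add_uminus[symmetric] mult_minus_left)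
    ultimately show ?thesis using abs_ge_minus_self[of "f ?a"] by linarith
  qed
  then show ?thesis using K0 by blast
qed

text \<open>
  The reflection \<open>x \<mapsto> - x\<close> preserves directional convexity and exchanges the two kinds of orthants.
\<close>

lemma dirconvex_orthant_minorant:
  assumes f: "dirconvex_seq f" and t: "tame m f"
    and dep: "\<And>x y. (\<And>i. i < Suc m \<Longrightarrow> x i = y i) \<Longrightarrow> f x = f y"
  obtains c where "\<And>x. (\<forall>i\<le>m. a \<le> x i) \<or> (\<forall>i\<le>m. x i \<le> b) \<Longrightarrow> - c * (1 + (\<Sum>i\<le>m. \<bar>x i\<bar>)) \<le> f x"
proof -
  have conv: "convex_on UNIV (\<lambda>t. f (x(j := t)))" for x j
    by (rule ray_convex_coordinate[OF ray_convex_if_dirconvex[OF f t]])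
  obtain c1 where c1: "c1 \<ge> 0" "\<And>x. \<forall>i<Suc m. a \<le> x i \<Longrightarrow> - c1 * (1 + (\<Sum>i<Suc m. \<bar>x i\<bar>)) \<le> f x"
    using dirconvex_orthant_minorant_up[OF f conv dep] by blast
  define g where "g = (\<lambda>x. f (\<lambda>i. - x i))"
  have g: "dirconvex_seq g"
    unfolding dirconvex_seq_def
  proof (intro allI impI)
    fix x y z :: "nat \<Rightarrow> real" assume yz: "\<forall>i. 0 \<le> y i \<and> 0 \<le> z i"
    have "f (\<lambda>i. - (x i + y i + z i) + z i) + f (\<lambda>i. - (x i + y i + z i) + y i)
       \<le> f (\<lambda>i. - (x i + y i + z i) + z i + y i) + f (\<lambda>i. - (x i + y i + z i))"
      by (rule dirconvex_seqD[OF f]) (use yz in auto)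
    then show "g (\<lambda>i. x i + y i) + g (\<lambda>i. x i + z i) \<le> g (\<lambda>i. x i + y i + z i) + g x"
      by (simp add: g_def algebra_simps)
  qed
  have gconv: "convex_on UNIV (\<lambda>t. g (x(j := t)))" for x j
  proof (rule convex_onI)
    fix u p q :: real assume u: "0 < u" "u < 1"
    have e: "(\<lambda>i. - (x(j := p)) i) = (\<lambda>i. - x i)(j := - p)" for p by auto
    show "g (x(j := (1 - u) *\<^sub>R p + u *\<^sub>R q)) \<le> (1 - u) * g (x(j := p)) + u * g (x(j := q))"
      using convex_onD[OF conv, of u "- p" "- q" "\<lambda>i. - x i" j] u unfolding g_def e by simp
  qed simp
  obtain c2 where c2: "c2 \<ge> 0" "\<And>x. \<forall>i<Suc m. - b \<le> x i \<Longrightarrow> - c2 * (1 + (\<Sum>i<Suc m. \<bar>x i\<bar>)) \<le> g x"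
  proof -
    have "g x = g y" if "\<And>i. i < Suc m \<Longrightarrow> x i = y i" for x y
      unfolding g_def using that by (intro dep) simp
    from dirconvex_orthant_minorant_up[OF g gconv this, of "Suc m" "- b"] show ?thesis
      using that by blast
  qed
  have "- (c1 + c2) * (1 + (\<Sum>i\<le>m. \<bar>x i\<bar>)) \<le> f x" if "(\<forall>i\<le>m. a \<le> x i) \<or> (\<forall>i\<le>m. x i \<le> b)" for x
  proof -
    have s: "0 \<le> 1 + (\<Sum>i\<le>m. \<bar>x i\<bar>)" by (intro add_nonneg_nonneg sum_nonneg) auto
    have "0 \<le> c1 * (1 + (\<Sum>i\<le>m. \<bar>x i\<bar>))" "0 \<le> c2 * (1 + (\<Sum>i\<le>m. \<bar>x i\<bar>))"
      using s c1(1) c2(1) by auto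
    moreover have "- c1 * (1 + (\<Sum>i\<le>m. \<bar>x i\<bar>)) \<le> f x \<or> - c2 * (1 + (\<Sum>i\<le>m. \<bar>x i\<bar>)) \<le> f x"
      using that c1(2)[of x] c2(2)[of "\<lambda>i. - x i"] by (auto simp: g_def less_Suc_eq_le lessThan_Suc_atMost)
    moreover have "- (c1 + c2) * (1 + (\<Sum>i\<le>m. \<bar>x i\<bar>))
        = - c1 * (1 + (\<Sum>i\<le>m. \<bar>x i\<bar>)) - c2 * (1 + (\<Sum>i\<le>m. \<bar>x i\<bar>))"
      by (simp only: minus_add_distrib distrib_right)
    ultimately show ?thesis by linarith
  qed
  then show ?thesis using that by blast
qed

text \<open>
  An increasing function only decreases when all positive coordinates are replaced by \<open>0\<close>, which leads into an orthant.
\<close>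

lemma increasing_dirconvex_minorant:
  assumes f: "dirconvex_seq f" and i: "increasing_seq f" and t: "tame m f"
    and dep: "\<And>x y. (\<And>i. i < Suc m \<Longrightarrow> x i = y i) \<Longrightarrow> f x = f y"
  obtains c where "\<And>x. - c * (1 + (\<Sum>i\<le>m. \<bar>x i\<bar>)) \<le> f x"
proof -
  obtain c where c: "\<And>x. (\<forall>i\<le>m. 0 \<le> x i) \<or> (\<forall>i\<le>m. x i \<le> 0) \<Longrightarrow> - c * (1 + (\<Sum>i\<le>m. \<bar>x i\<bar>)) \<le> f x"
    using dirconvex_orthant_minorant[OF f t dep, of 0 0] by blast
  have "- \<bar>c\<bar> * (1 + (\<Sum>i\<le>m. \<bar>x i\<bar>)) \<le> f x" for x
  proof -
    define y where "y = (\<lambda>i. min (x i) 0)"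
    have "(\<Sum>i\<le>m. \<bar>y i\<bar>) \<le> (\<Sum>i\<le>m. \<bar>x i\<bar>)" by (intro sum_mono) (auto simp: y_def)
    moreover have "0 \<le> (\<Sum>i\<le>m. \<bar>y i\<bar>)" by (intro sum_nonneg) auto
    ultimately have "c * (1 + (\<Sum>i\<le>m. \<bar>y i\<bar>)) \<le> \<bar>c\<bar> * (1 + (\<Sum>i\<le>m. \<bar>x i\<bar>))"
      by (intro mult_mono) auto
    moreover have "- c * (1 + (\<Sum>i\<le>m. \<bar>y i\<bar>)) \<le> f y" by (rule c) (auto simp: y_def)
    moreover have "f y \<le> f x" using i unfolding increasing_seq_def y_def by simp
    ultimately show ?thesis by simp
  qed
  then show ?thesis using that by blast
qed

section \<open>Coefficients of the scheme\<close>

lemma lip_const_nonneg: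
  assumes "0 < T"
  shows "0 \<le> lip_const T g"
proof -
  have "ereal (\<bar>g 0 0 - g 0 1\<bar> / \<bar>0 - 1\<bar>) \<le> lip_const T g"
    unfolding lip_const_def using assms by (intro SUP_upper2[of "(0, 0, 1)"]) auto
  moreover have "0 \<le> ereal (\<bar>g 0 0 - g 0 1\<bar> / \<bar>0 - 1\<bar>)" by simp
  ultimately show ?thesis by (rule order_trans[rotated])
qed

lemma regular_coeffE:
  assumes "regular_coeff T g" and T: "0 < T"
  obtains L where "lip_const T g = ereal L" "0 \<le> L"
    "\<And>t x y. t \<in> {0..T} \<Longrightarrow> \<bar>g t x - g t y\<bar> \<le> L * \<bar>x - y\<bar>"
proof -
  obtain L where L: "lip_const T g = ereal L"
    using assms lip_const_nonneg[OF T, of g] unfolding regular_coeff_def by (cases "lip_const T g") auto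
  have L0: "0 \<le> L" using lip_const_nonneg[OF T, of g] by (simp add: L)
  have "\<bar>g t x - g t y\<bar> \<le> L * \<bar>x - y\<bar>" if t: "t \<in> {0..T}" for t x y
  proof (cases "x = y")
    case False
    have "ereal (\<bar>g t x - g t y\<bar> / \<bar>x - y\<bar>) \<le> ereal L"
      unfolding L[symmetric] lip_const_def using t False by (intro SUP_upper2[of "(t, x, y)"]) auto
    then show ?thesis using False by (simp add: field_simps)
  qed simp
  then show ?thesis using that L L0 by blast
qed

lemma regular_coeff_bounded:
  assumes "regular_coeff T g" and T: "0 < T"
  shows "\<exists>C. \<forall>t\<in>{0..T}. \<bar>g t x\<bar> \<le> C"
proof -
  obtain L where "lip_const T g = ereal L" "0 \<le> L"
    and L: "\<And>t x y. t \<in> {0..T} \<Longrightarrow> \<bar>g t x - g t y\<bar> \<le> L * \<bar>x - y\<bar>"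
    using that by (rule regular_coeffE[OF assms])
  let ?s = "SUP t\<in>{0..T}. ereal \<bar>g t 0\<bar>"
  have "ereal \<bar>g 0 0\<bar> \<le> ?s" using T by (intro SUP_upper) auto
  then have "?s \<noteq> - \<infinity>" by auto
  moreover have "?s < \<infinity>" using assms by (simp add: regular_coeff_def)
  ultimately obtain B where B: "?s = ereal B" by (cases ?s) auto
  have "\<bar>g t x\<bar> \<le> B + L * \<bar>x\<bar>" if t: "t \<in> {0..T}" for t
  proof -
    have "ereal \<bar>g t 0\<bar> \<le> ereal B" unfolding B[symmetric] using t by (intro SUP_upper) auto
    then show ?thesis using L[OF t, of x 0] by simp
  qed
  then show ?thesis by blast
qed

lemma regular_coeff_measurable:
  assumes "regular_coeff T g"
  shows "(\<lambda>t. g t x) \<in> borel_measurable (restrict_space borel {0..T})"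
proof -
  have "(\<lambda>t. (t, x)) \<in> restrict_space borel {0..T} \<rightarrow>\<^sub>M restrict_space borel ({0..T} \<times> UNIV)"
    by (intro measurable_restrict_space2 measurable_restrict_space1) (auto simp: space_restrict_space)
  moreover have "(\<lambda>(t, x). g t x) \<in> borel_measurable (restrict_space borel ({0..T} \<times> UNIV))"
    using assms unfolding regular_coeff_def by blast
  ultimately have "(\<lambda>t. (\<lambda>(t, x). g t x) (t, x)) \<in> borel_measurable (restrict_space borel {0..T})"
    by (rule measurable_compose)
  then show ?thesis by simp
qed

locale time_average = prob_space P for P :: "real measure" +
  fixes T :: real
  assumes space_P: "space P \<subseteq> {0..T}" and T_pos: "0 < T"
    and meas_P: "\<And>f. f \<in> borel_measurable (restrict_space borel {0..T}) \<Longrightarrow> (f :: real \<Rightarrow> real) \<in> borel_measurable P"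

text \<open>
  Both choices of coefficients average over \<open>t\<close> against a probability measure: uniform on the time
  step or a point mass at its left end. The diffusion coefficient enters through its square, since the frozen one may be
  negative.
\<close>

lemma coefficient_law:
  assumes T: "0 < T" and m: "0 < m" and k: "k < m"
  shows "\<exists>P. time_average P T \<and>
    (\<forall>g x. regular_coeff T g \<longrightarrow> drift_coeff ch T m g k x = (\<integral>t. g t x \<partial>P)) \<and>
    (\<forall>g x. regular_coeff T g \<longrightarrow> (diffusion_coeff ch T m g k x)\<^sup>2 = (\<integral>t. (g t x)\<^sup>2 \<partial>P))"
proof -
  have "real (Suc k) * T \<le> real m * T" using k T by (intro mult_right_mono) auto
  then have gk: "0 \<le> grid T m k" "grid T m (Suc k) \<le> T" "grid T m (Suc k) - grid T m k = T / real m"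
    using T m by (simp_all add: grid_def pos_divide_le_eq mult.commute flip: diff_divide_distrib)
      (simp add: algebra_simps)
  have step: "T / real m > 0" using T m by simp
  have gk': "grid T m k \<le> T" using gk step by linarith
  show ?thesis
  proof (cases ch)
    case Frozen
    let ?P = "return (restrict_space borel {0..T}) (grid T m k)"
    have sp: "grid T m k \<in> space (restrict_space borel {0..T})" using gk gk' by (simp add: space_restrict_space)
    interpret prob_space ?P using sp by (rule prob_space_return)
    show ?thesis
    proof (intro exI[of _ ?P] conjI allI impI)
      show "time_average ?P T" by standard (use T in \<open>auto simp: space_restrict_space\<close>)
      fix b :: "real \<Rightarrow> real \<Rightarrow> real" and x
      assume "regular_coeff T b"
      then have b: "(\<lambda>t. b t x) \<in> borel_measurable (restrict_space borel {0..T})"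
        by (rule regular_coeff_measurable)
      show "drift_coeff ch T m b k x = (\<integral>t. b t x \<partial>?P)"
        using integral_return[OF sp b] Frozen by (simp add: drift_coeff_def)
      show "(diffusion_coeff ch T m b k x)\<^sup>2 = (\<integral>t. (b t x)\<^sup>2 \<partial>?P)"
        using integral_return[OF sp borel_measurable_power[OF b, of 2]] Frozen by (simp add: diffusion_coeff_def)
    qed
  next
    case Averaged
    let ?I = "{grid T m k..grid T m (Suc k)}"
    let ?R = "restrict_space lborel ?I"
    let ?P = "density ?R (\<lambda>_. ennreal (real m / T))"
    have Ile: "?I \<subseteq> {0..T}" using gk gk' by auto
    have meas: "f \<in> borel_measurable ?R" if "f \<in> borel_measurable (restrict_space borel {0..T})" for f :: "real \<Rightarrow> real"
    proof -
      have "f \<in> borel_measurable (restrict_space borel ?I)"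
        by (rule measurable_restrict_mono[OF that Ile])
      then show ?thesis by (simp cong: measurable_cong_sets sets_restrict_space_cong)
    qed
    have int: "(\<integral>t. f t \<partial>?P) = real m / T * set_lebesgue_integral lborel ?I f"
      if "f \<in> borel_measurable (restrict_space borel {0..T})" for f
    proof -
      have "(\<integral>t. f t \<partial>?P) = (\<integral>t. (real m / T) *\<^sub>R f t \<partial>?R)"
        using meas[OF that] T by (subst integral_density) auto
      then show ?thesis
        by (simp add: set_lebesgue_integral_def integral_restrict_space)
    qed
    have P1: "prob_space ?P"
    proof
      have "emeasure ?R (space ?R) = ennreal (T / real m)"
        using gk step by (simp add: space_restrict_space emeasure_restrict_space)
      then have "emeasure ?P (space ?P) = ennreal (real m / T) * ennreal (T / real m)"
        using emeasure_density_const[OF sets.top, of ?R "ennreal (real m / T)"] by (simp only: space_density)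
      also have "\<dots> = 1" using T m by (simp flip: ennreal_mult ennreal_1)
      finally show "emeasure ?P (space ?P) = 1" .
    qed
    show ?thesis
    proof (intro exI[of _ ?P] conjI allI impI)
      interpret prob_space ?P by (rule P1)
      show "time_average ?P T"
      proof
        show "space ?P \<subseteq> {0..T}" using Ile by (simp add: space_restrict_space)
        show "f \<in> borel_measurable ?P" if "f \<in> borel_measurable (restrict_space borel {0..T})" for f :: "real \<Rightarrow> real"
          using meas[OF that] by simp
      qed (rule T)
      fix b :: "real \<Rightarrow> real \<Rightarrow> real" and x
      assume "regular_coeff T b"
      then have b: "(\<lambda>t. b t x) \<in> borel_measurable (restrict_space borel {0..T})"
        by (rule regular_coeff_measurable)
      show "drift_coeff ch T m b k x = (\<integral>t. b t x \<partial>?P)"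
        using int[OF b] Averaged by (simp add: drift_coeff_def)
      have b2: "(\<lambda>t. (b t x)\<^sup>2) \<in> borel_measurable (restrict_space borel {0..T})" using b by measurable
      have "0 \<le> (\<integral>t. (b t x)\<^sup>2 \<partial>?P)" by simp
      then show "(diffusion_coeff ch T m b k x)\<^sup>2 = (\<integral>t. (b t x)\<^sup>2 \<partial>?P)"
        unfolding int[OF b2] using Averaged by (simp add: diffusion_coeff_def)
    qed
  qed
qed

context time_average
begin

lemma integrable_bounded:
  assumes "(f :: real \<Rightarrow> real) \<in> borel_measurable (restrict_space borel {0..T})" "\<And>t. t \<in> {0..T} \<Longrightarrow> \<bar>f t\<bar> \<le> C"
  shows "integrable P f"
  using assms space_P by (intro integrable_const_bound[of _ C] AE_I2 meas_P) auto

lemma integrable_coeff: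
  assumes "regular_coeff T g"
  shows "integrable P (\<lambda>t. g t x)" "integrable P (\<lambda>t. (g t x)\<^sup>2)"
proof -
  obtain C where C: "\<And>t. t \<in> {0..T} \<Longrightarrow> \<bar>g t x\<bar> \<le> C" using regular_coeff_bounded[OF assms T_pos] by blast
  note m = regular_coeff_measurable[OF assms, of x]
  show "integrable P (\<lambda>t. g t x)" by (rule integrable_bounded[OF m C])
  have "\<bar>(g t x)\<^sup>2\<bar> \<le> C\<^sup>2" if "t \<in> {0..T}" for t
    using power_mono[OF C[OF that], of 2] by simp
  then show "integrable P (\<lambda>t. (g t x)\<^sup>2)"
    by (intro integrable_bounded borel_measurable_power m)
qed

lemma average_mono:
  assumes "integrable P f" "integrable P g" "\<And>t. t \<in> {0..T} \<Longrightarrow> f t \<le> (g t :: real)"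
  shows "(\<integral>t. f t \<partial>P) \<le> (\<integral>t. g t \<partial>P)"
  using assms space_P by (intro integral_mono) auto

lemma average_lipschitz:
  assumes g: "regular_coeff T g" and L: "\<And>t x y. t \<in> {0..T} \<Longrightarrow> \<bar>g t x - g t y\<bar> \<le> L * \<bar>x - y\<bar>"
  shows "\<bar>(\<integral>t. g t x \<partial>P) - (\<integral>t. g t y \<partial>P)\<bar> \<le> L * \<bar>x - y\<bar>"
proof -
  have "(\<integral>t. g t a \<partial>P) \<le> (\<integral>t. g t c + L * \<bar>a - c\<bar> \<partial>P)" for a c
  proof (rule average_mono)
    show "g t a \<le> g t c + L * \<bar>a - c\<bar>" if "t \<in> {0..T}" for t using L[OF that, of a c] by linarith
  qed (use integrable_coeff[OF g] in auto)
  then have *: "(\<integral>t. g t a \<partial>P) \<le> (\<integral>t. g t c \<partial>P) + L * \<bar>a - c\<bar>" for a c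
    using integrable_coeff[OF g] prob_space by simp
  show ?thesis using *[of x y] *[of y x] by (simp add: abs_le_iff abs_minus_commute)
qed

text \<open>
  Minkowski's inequality in \<open>L\<^sup>2\<close>, obtained by expanding \<open>(\<bar>g t c\<bar> + d)\<^sup>2\<close> and using that the mean of \<open>\<bar>g t c\<bar>\<close> is
  at most its root mean square.
\<close>

lemma root_mean_square_lipschitz:
  assumes g: "regular_coeff T g" and L: "\<And>t x y. t \<in> {0..T} \<Longrightarrow> \<bar>g t x - g t y\<bar> \<le> L * \<bar>x - y\<bar>" and L0: "0 \<le> L"
    and s: "\<And>x. 0 \<le> s x" "\<And>x. (s x)\<^sup>2 = (\<integral>t. (g t x)\<^sup>2 \<partial>P)"
  shows "\<bar>s x - s y\<bar> \<le> L * \<bar>x - y\<bar>"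
proof -
  have "s a \<le> s c + L * \<bar>a - c\<bar>" for a c
  proof -
    define d where "d = L * \<bar>a - c\<bar>"
    have d0: "0 \<le> d" using L0 by (simp add: d_def)
    have abs_int: "integrable P (\<lambda>t. \<bar>g t c\<bar>)" using integrable_coeff[OF g] by auto
    have sq_int: "integrable P (\<lambda>t. \<bar>g t c\<bar>\<^sup>2)" using integrable_coeff[OF g] by simp
    have "0 \<le> (\<integral>t. \<bar>g t c\<bar>\<^sup>2 \<partial>P) - (\<integral>t. \<bar>g t c\<bar> \<partial>P)\<^sup>2"
      using variance_eq[OF abs_int sq_int] variance_positive[of "\<lambda>t. \<bar>g t c\<bar>"] by simp
    then have "(\<integral>t. \<bar>g t c\<bar> \<partial>P)\<^sup>2 \<le> (s c)\<^sup>2" by (simp add: s)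
    then have J: "(\<integral>t. \<bar>g t c\<bar> \<partial>P) \<le> s c" by (rule power2_le_imp_le) (rule s)
    have "(\<integral>t. (g t a)\<^sup>2 \<partial>P) \<le> (\<integral>t. (g t c)\<^sup>2 + 2 * d * \<bar>g t c\<bar> + d\<^sup>2 \<partial>P)"
    proof (rule average_mono)
      fix t assume t: "t \<in> {0..T}"
      have "\<bar>g t a\<bar> \<le> \<bar>g t c\<bar> + d" using L[OF t, of a c] by (simp add: d_def)
      then have "\<bar>g t a\<bar>\<^sup>2 \<le> (\<bar>g t c\<bar> + d)\<^sup>2" by (rule power_mono) simp
      then show "(g t a)\<^sup>2 \<le> (g t c)\<^sup>2 + 2 * d * \<bar>g t c\<bar> + d\<^sup>2" by (simp add: power2_sum algebra_simps)
    qed (use integrable_coeff[OF g] abs_int in auto)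
    also have "\<dots> = (s c)\<^sup>2 + 2 * d * (\<integral>t. \<bar>g t c\<bar> \<partial>P) + d\<^sup>2"
      using integrable_coeff[OF g] abs_int prob_space by (simp add: s)
    also have "\<dots> \<le> (s c)\<^sup>2 + 2 * d * s c + d\<^sup>2" using J d0 by (simp add: mult_left_mono)
    finally have "(s a)\<^sup>2 \<le> (s c + d)\<^sup>2" by (simp add: s(2) power2_sum algebra_simps)
    then show ?thesis unfolding d_def by (rule power2_le_imp_le) (use s(1)[of c] d0 in \<open>simp add: d_def\<close>)
  qed
  from this[of x y] this[of y x] show ?thesis by (simp add: abs_le_iff abs_minus_commute)
qed

lemma average_convex:
  fixes g :: "real \<Rightarrow> real \<Rightarrow> real"
  assumes int: "\<And>x. integrable P (\<lambda>t. g t x)" and c: "\<And>t. t \<in> {0..T} \<Longrightarrow> convex_on UNIV (g t)"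
  shows "convex_on UNIV (\<lambda>x. \<integral>t. g t x \<partial>P)"
proof (rule convex_onI)
  fix u x y :: real assume u: "0 < u" "u < 1"
  have "(\<integral>t. g t ((1 - u) *\<^sub>R x + u *\<^sub>R y) \<partial>P) \<le> (\<integral>t. (1 - u) * g t x + u * g t y \<partial>P)"
    using convex_onD[OF c] u int by (intro average_mono) auto
  then show "(\<integral>t. g t ((1 - u) *\<^sub>R x + u *\<^sub>R y) \<partial>P) \<le> (1 - u) * (\<integral>t. g t x \<partial>P) + u * (\<integral>t. g t y \<partial>P)"
    using int by simp
qed simp

end

lemma coefficient_lipschitz:
  assumes T: "0 < T" and m: "0 < m" and k: "k < m" and g: "regular_coeff T g"
    and L: "\<And>t x y. t \<in> {0..T} \<Longrightarrow> \<bar>g t x - g t y\<bar> \<le> L * \<bar>x - y\<bar>" "0 \<le> L"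
  shows "\<bar>drift_coeff ch T m g k x - drift_coeff ch T m g k y\<bar> \<le> L * \<bar>x - y\<bar>"
    "\<bar>diffusion_coeff ch T m g k x - diffusion_coeff ch T m g k y\<bar> \<le> L * \<bar>x - y\<bar>"
proof -
  obtain P where P: "time_average P T"
    "\<And>g x. regular_coeff T g \<Longrightarrow> drift_coeff ch T m g k x = (\<integral>t. g t x \<partial>P)"
    "\<And>g x. regular_coeff T g \<Longrightarrow> (diffusion_coeff ch T m g k x)\<^sup>2 = (\<integral>t. (g t x)\<^sup>2 \<partial>P)"
    using coefficient_law[OF T m k, of ch] by blast
  interpret P: time_average P T by (rule P(1))
  show "\<bar>drift_coeff ch T m g k x - drift_coeff ch T m g k y\<bar> \<le> L * \<bar>x - y\<bar>"
    unfolding P(2)[OF g] by (rule P.average_lipschitz[OF g L(1)])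
  show "\<bar>diffusion_coeff ch T m g k x - diffusion_coeff ch T m g k y\<bar> \<le> L * \<bar>x - y\<bar>"
  proof (cases ch)
    case Frozen
    have "grid T m k \<in> {0..T}" using T m k by (auto simp: grid_def field_simps)
    then show ?thesis using L Frozen by (simp add: diffusion_coeff_def)
  next
    case Averaged
    have "0 \<le> diffusion_coeff ch T m g k x" for x
    proof -
      have "0 \<le> set_lebesgue_integral lborel {grid T m k..grid T m (Suc k)} (\<lambda>t. (g t x)\<^sup>2)"
        unfolding set_lebesgue_integral_def by (intro Bochner_Integration.integral_nonneg) simp
      then show ?thesis using Averaged T by (simp add: diffusion_coeff_def)
    qed
    from P.root_mean_square_lipschitz[where s = "diffusion_coeff ch T m g k", OF g L this P(3)[OF g]]
    show ?thesis .
  qed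
qed

lemma coefficient_mono:
  assumes T: "0 < T" and m: "0 < m" and k: "k < m" and f: "regular_coeff T f" and g: "regular_coeff T g"
  shows "(\<And>t. t \<in> {0..T} \<Longrightarrow> f t x \<le> g t x) \<Longrightarrow> drift_coeff ch T m f k x \<le> drift_coeff ch T m g k x"
    "(\<And>t. t \<in> {0..T} \<Longrightarrow> \<bar>f t x\<bar> \<le> \<bar>g t x\<bar>) \<Longrightarrow> \<bar>diffusion_coeff ch T m f k x\<bar> \<le> \<bar>diffusion_coeff ch T m g k x\<bar>"
proof -
  obtain P where P: "time_average P T"
    "\<And>g x. regular_coeff T g \<Longrightarrow> drift_coeff ch T m g k x = (\<integral>t. g t x \<partial>P)"
    "\<And>g x. regular_coeff T g \<Longrightarrow> (diffusion_coeff ch T m g k x)\<^sup>2 = (\<integral>t. (g t x)\<^sup>2 \<partial>P)"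
    using coefficient_law[OF T m k, of ch] by blast
  interpret P: time_average P T by (rule P(1))
  show "drift_coeff ch T m f k x \<le> drift_coeff ch T m g k x" if "\<And>t. t \<in> {0..T} \<Longrightarrow> f t x \<le> g t x"
    unfolding P(2)[OF f] P(2)[OF g]
    by (rule P.average_mono[OF P.integrable_coeff(1)[OF f] P.integrable_coeff(1)[OF g] that])
  assume le: "\<And>t. t \<in> {0..T} \<Longrightarrow> \<bar>f t x\<bar> \<le> \<bar>g t x\<bar>"
  have "(f t x)\<^sup>2 \<le> (g t x)\<^sup>2" if "t \<in> {0..T}" for t
    using le[OF that] by (simp add: abs_le_square_iff)
  then have "(diffusion_coeff ch T m f k x)\<^sup>2 \<le> (diffusion_coeff ch T m g k x)\<^sup>2"
    unfolding P(3)[OF f] P(3)[OF g]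
    by (intro P.average_mono P.integrable_coeff f g)
  then show "\<bar>diffusion_coeff ch T m f k x\<bar> \<le> \<bar>diffusion_coeff ch T m g k x\<bar>"
    by (simp add: abs_le_square_iff)
qed

text \<open>
  The infimum is a limit of elements of the set, and convexity passes to pointwise limits.
\<close>

lemma a_const_attained:
  assumes "a_const T \<sigma> < \<infinity>"
  obtains a where "a_const T \<sigma> = ereal a" "0 \<le> a" "\<And>t. t \<in> {0..T} \<Longrightarrow> convex_on UNIV (\<lambda>x. (\<sigma> t x)\<^sup>2 + a * x\<^sup>2)"
proof -
  let ?A = "{a. 0 \<le> a \<and> (\<forall>t\<in>{0..T}. convex_on UNIV (\<lambda>x. (\<sigma> t x)\<^sup>2 + a * x\<^sup>2))}"
  have nn: "0 \<le> a_const T \<sigma>" unfolding a_const_def by (auto intro: Inf_greatest)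
  then obtain a where a: "a_const T \<sigma> = ereal a" using assms by (cases "a_const T \<sigma>") auto
  have a0: "0 \<le> a" using nn by (simp add: a)
  have "\<exists>c\<in>?A. c < a + 1 / real (Suc n)" for n
  proof -
    have "Inf (ereal ` ?A) < ereal (a + 1 / real (Suc n))" using a unfolding a_const_def by simp
    then show ?thesis unfolding Inf_less_iff by auto
  qed
  then have "\<forall>n. \<exists>c. c \<in> ?A \<and> c < a + 1 / real (Suc n)" unfolding Bex_def by (intro allI)
  from choice[OF this] obtain c where c: "\<And>n. c n \<in> ?A" "\<And>n. c n < a + 1 / real (Suc n)" by blast
  have ac: "a \<le> c n" for n
  proof -
    have "ereal a \<le> ereal (c n)" unfolding a[symmetric] a_const_def using c(1)[of n] by (intro Inf_lower) auto
    then show ?thesis by simp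
  qed
  have lim: "c \<longlonglongrightarrow> a"
  proof (rule tendsto_sandwich[where f = "\<lambda>_. a"])
    show "(\<lambda>n. a + 1 / real (Suc n)) \<longlonglongrightarrow> a"
      using tendsto_add[OF tendsto_const[of a] LIMSEQ_Suc[OF lim_1_over_n]] by simp
  qed (use ac c(2) in \<open>auto intro!: always_eventually less_imp_le\<close>)
  have "convex_on UNIV (\<lambda>x. (\<sigma> t x)\<^sup>2 + a * x\<^sup>2)" if "t \<in> {0..T}" for t
    by (rule convex_on_pointwise_limit[where u = "\<lambda>n x. (\<sigma> t x)\<^sup>2 + c n * x\<^sup>2"])
      (use c(1) that in \<open>auto intro!: tendsto_intros lim\<close>)
  then show ?thesis using that a a0 by blast
qed

lemma cb_const_attained:
  assumes b: "regular_coeff T b" and T: "0 < T"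
  obtains c where "cb_const T b = ereal c" "0 \<le> c" "\<And>t. t \<in> {0..T} \<Longrightarrow> mono (\<lambda>x. b t x + c * x)"
proof -
  let ?A = "{c. 0 \<le> c \<and> (\<forall>t\<in>{0..T}. mono (\<lambda>x. b t x + c * x))}"
  obtain L where "lip_const T b = ereal L" and L: "0 \<le> L" "\<And>t x y. t \<in> {0..T} \<Longrightarrow> \<bar>b t x - b t y\<bar> \<le> L * \<bar>x - y\<bar>"
    using that by (rule regular_coeffE[OF b T])
  have "mono (\<lambda>x. b t x + L * x)" if "t \<in> {0..T}" for t
  proof (rule monoI)
    fix x y :: real assume "x \<le> y"
    then show "b t x + L * x \<le> b t y + L * y" using L(2)[OF that, of x y] by (simp add: abs_le_iff algebra_simps)
  qed
  then have "cb_const T b \<le> ereal L" unfolding cb_const_def using L(1) by (intro Inf_lower) auto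
  moreover have nn: "0 \<le> cb_const T b" unfolding cb_const_def by (auto intro: Inf_greatest)
  ultimately obtain a where a: "cb_const T b = ereal a" by (cases "cb_const T b") auto
  have a0: "0 \<le> a" using nn by (simp add: a)
  have "mono (\<lambda>x. b t x + a * x)" if t: "t \<in> {0..T}" for t
  proof (rule monoI)
    fix x y :: real assume xy: "x \<le> y"
    have "(b t x - b t y) \<le> a * (y - x) + e" if e: "e > 0" for e
    proof -
      define e' where "e' = e / (y - x + 1)"
      have e': "e' > 0" "e' * (y - x) \<le> e" using e xy by (auto simp: e'_def field_simps)
      have "Inf (ereal ` ?A) < ereal (a + e')" using a e' unfolding cb_const_def by simp
      then obtain c where c: "c \<in> ?A" "c < a + e'" unfolding Inf_less_iff by auto
      then have "b t x + c * x \<le> b t y + c * y" using t xy by (auto dest: monoD)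
      then have "b t x - b t y \<le> c * (y - x)" by (simp add: algebra_simps)
      also have "\<dots> \<le> (a + e') * (y - x)" using c xy by (intro mult_right_mono) auto
      finally show ?thesis using e' by (simp add: algebra_simps)
    qed
    then have "b t x - b t y \<le> a * (y - x)" by (rule field_le_epsilon)
    then show "b t x + a * x \<le> b t y + a * y" by (simp add: algebra_simps)
  qed
  then show ?thesis using that a a0 by blast
qed

text \<open>The lower bound on \<open>m\<close> says that \<open>\<surd>h\<close> lies below the positive root of \<open>c h + \<surd>(c' h) = 1/2\<close>.\<close>

lemma step_small:
  fixes c c' h :: real
  assumes c: "0 \<le> c" and c': "0 \<le> c'" and h: "0 < h"
    and le: "(if c = 0 then 2 * sqrt c' else 2 * c / (sqrt (c' + 2 * c) - sqrt c'))\<^sup>2 * h \<le> 1"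
  shows "c * h + sqrt (c' * h) \<le> 1 / 2"
proof (cases "c = 0")
  case True
  then have "(2 * sqrt (c' * h))\<^sup>2 \<le> 1\<^sup>2" using le c' h by (simp add: power_mult_distrib real_sqrt_mult)
  then have "2 * sqrt (c' * h) \<le> 1" by (rule power2_le_imp_le) simp
  then show ?thesis using True by simp
next
  case False
  then have cp: "c > 0" using c by simp
  define u where "u = sqrt (c' + 2 * c)"
  define v where "v = sqrt c'"
  define w where "w = sqrt h"
  have uv: "u > v" "v \<ge> 0" using cp c' by (auto simp: u_def v_def)
  have w: "w > 0" "h = w\<^sup>2" using h by (auto simp: w_def)
  have diff: "u\<^sup>2 - v\<^sup>2 = 2 * c" using cp c' by (simp add: u_def v_def)
  have "(2 * c / (u - v) * w)\<^sup>2 \<le> 1\<^sup>2"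
    using le False unfolding w(2) power_mult_distrib u_def v_def by simp
  then have "2 * c / (u - v) * w \<le> 1" by (rule power2_le_imp_le) simp
  then have w1: "2 * c * w \<le> u - v" using uv by (simp add: field_simps)
  have "2 * c * (2 * c * w\<^sup>2 + 2 * v * w) = (2 * c * w) * (2 * c * w + 2 * v)" by (simp add: power2_eq_square algebra_simps)
  also have "\<dots> \<le> (u - v) * ((u - v) + 2 * v)" using w1 uv cp w by (intro mult_mono) auto
  also have "\<dots> = 2 * c" using diff by (simp add: power2_eq_square algebra_simps)
  finally have "2 * c * (2 * c * w\<^sup>2 + 2 * v * w) \<le> 2 * c * 1" by simp
  then have "2 * c * w\<^sup>2 + 2 * v * w \<le> 1" using cp by (subst (asm) mult_le_cancel_left_pos) auto
  moreover have "sqrt (c' * h) = v * w" by (simp add: v_def w_def real_sqrt_mult)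
  ultimately show ?thesis by (simp add: w(2))
qed

definition drift_map :: "coeff_choice \<Rightarrow> real \<Rightarrow> nat \<Rightarrow> (real \<Rightarrow> real \<Rightarrow> real) \<Rightarrow> nat \<Rightarrow> real \<Rightarrow> real" where
  "drift_map ch T m b k x = x + T / real m * drift_coeff ch T m b k x"

definition spread :: "coeff_choice \<Rightarrow> real \<Rightarrow> nat \<Rightarrow> (real \<Rightarrow> real \<Rightarrow> real) \<Rightarrow> nat \<Rightarrow> real \<Rightarrow> real" where
  "spread ch T m \<sigma> k x = sqrt (T / real m) * diffusion_coeff ch T m \<sigma> k x"

lemma noise_level_bound:
  assumes T: "0 < T" and m: "0 < m" and L: "lip_const T \<sigma> = ereal L" "0 \<le> L" and adm: "admissible T m s b \<sigma>"
    and g: "ereal \<bar>z\<bar> \<le> s"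
  shows "\<bar>z\<bar> * L * sqrt (T / real m) \<le> 1 / 2"
proof (cases "L = 0")
  case False
  then have Lp: "L > 0" using L by simp
  have "s \<le> ereal (sqrt (real m)) / (2 * lip_const T \<sigma> * ereal (sqrt T))"
    using adm by (simp add: admissible_def)
  also have "\<dots> = ereal (sqrt (real m) / (2 * L * sqrt T))"
  proof -
    have "2 * lip_const T \<sigma> * ereal (sqrt T) = ereal (2 * L * sqrt T)"
      unfolding L(1) by (metis numeral_eq_ereal times_ereal.simps(1))
    then show ?thesis using Lp T by simp
  qed
  finally have "\<bar>z\<bar> \<le> sqrt (real m) / (2 * L * sqrt T)" using g by (metis ereal_less_eq(3) order_trans)
  then show ?thesis using Lp T m by (simp add: real_sqrt_divide field_simps)
qed simp

text \<open>
  With \<open>h = T / m\<close>, the Lipschitz constant of the spread is \<open>sqrt h * Lip \<sigma>\<close> and its square becomes convex after adding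
  \<open>h * a * x\<^sup>2\<close>. Over an increment \<open>y - x\<close> the drift map grows by at least \<open>(1 - c * h) * (y - x)\<close>, of which the
  truncated noise takes away at most one half; hence \<open>\<kappa> = 1/2 - c * h\<close>, and \<open>step_small\<close> is the required inequality
  between the constants.
\<close>

lemma euler_convex_step:
  assumes T: "0 < T" and m: "0 < m" and k: "k < m" and b: "regular_coeff T b" and \<sigma>: "regular_coeff T \<sigma>"
    and cc: "cond_conv T b \<sigma>" and adm: "admissible T m s b \<sigma>"
  shows "convex_step s (drift_map ch T m b k) (spread ch T m \<sigma> k)"
proof -
  obtain P where P: "time_average P T"
    "\<And>g x. regular_coeff T g \<Longrightarrow> drift_coeff ch T m g k x = (\<integral>t. g t x \<partial>P)"
    "\<And>g x. regular_coeff T g \<Longrightarrow> (diffusion_coeff ch T m g k x)\<^sup>2 = (\<integral>t. (g t x)\<^sup>2 \<partial>P)"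
    using coefficient_law[OF T m k, of ch] by blast
  interpret P: time_average P T by (rule P(1))
  obtain Lb where "lip_const T b = ereal Lb" and Lb: "0 \<le> Lb" "\<And>t x y. t \<in> {0..T} \<Longrightarrow> \<bar>b t x - b t y\<bar> \<le> Lb * \<bar>x - y\<bar>"
    using that by (rule regular_coeffE[OF b T])
  obtain Ls where Ls: "lip_const T \<sigma> = ereal Ls" "0 \<le> Ls" "\<And>t x y. t \<in> {0..T} \<Longrightarrow> \<bar>\<sigma> t x - \<sigma> t y\<bar> \<le> Ls * \<bar>x - y\<bar>"
    using that by (rule regular_coeffE[OF \<sigma> T])
  have "a_const T \<sigma> < \<infinity>" using cc by (simp add: cond_conv_def)
  then obtain a where a: "a_const T \<sigma> = ereal a" "0 \<le> a" "\<And>t. t \<in> {0..T} \<Longrightarrow> convex_on UNIV (\<lambda>x. (\<sigma> t x)\<^sup>2 + a * x\<^sup>2)"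
    using a_const_attained by blast
  obtain c where c: "cb_const T b = ereal c" "0 \<le> c" "\<And>t. t \<in> {0..T} \<Longrightarrow> mono (\<lambda>x. b t x + c * x)"
    using cb_const_attained[OF b T] by blast
  define h where "h = T / real m"
  have h: "h > 0" using T m by (simp add: h_def)
  define c' where "c' = a + Ls\<^sup>2"
  have c'0: "0 \<le> c'" using a by (simp add: c'_def)
  have cs: "cs_const T \<sigma> = ereal c'" by (simp add: cs_const_def a Ls c'_def power2_eq_square)
  have small: "c * h + sqrt (c' * h) \<le> 1 / 2"
  proof (rule step_small[OF c(2) c'0 h])
    define q where "q = (if c = 0 then 2 * sqrt c' else 2 * c / (sqrt (c' + 2 * c) - sqrt c'))\<^sup>2"
    have "q * T \<le> real m" using adm unfolding admissible_def m_const_def Let_def cs c(1) real_of_ereal.simps q_def by blast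
    then show "q * h \<le> 1" using m by (simp add: h_def field_simps)
  qed
  define \<kappa> where "\<kappa> = 1 / 2 - c * h"
  have rt: "sqrt (c' * h) \<le> \<kappa>" using small by (simp add: \<kappa>_def)
  have rt0: "0 \<le> sqrt (c' * h)" using c'0 h by simp
  note lipb = coefficient_lipschitz(1)[OF T m k b Lb(2,1), where ch = ch]
  note lips = coefficient_lipschitz(2)[OF T m k \<sigma> Ls(3,2), where ch = ch]
  show ?thesis
    unfolding convex_step_def
  proof (rule exI[of _ "1 + h * Lb"], rule exI[of _ "sqrt h * Ls"], rule exI[of _ "h * a"], rule exI[of _ \<kappa>],
      intro conjI allI impI)
    fix x y :: real
    have "h * \<bar>drift_coeff ch T m b k x - drift_coeff ch T m b k y\<bar> \<le> h * (Lb * \<bar>x - y\<bar>)"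
      using h lipb by (intro mult_left_mono) auto
    then have "\<bar>h * (drift_coeff ch T m b k x - drift_coeff ch T m b k y)\<bar> \<le> h * (Lb * \<bar>x - y\<bar>)"
      using h by (simp add: abs_mult)
    moreover have "drift_map ch T m b k x - drift_map ch T m b k y
       = (x - y) + h * (drift_coeff ch T m b k x - drift_coeff ch T m b k y)"
      by (simp add: drift_map_def h_def algebra_simps)
    ultimately show "\<bar>drift_map ch T m b k x - drift_map ch T m b k y\<bar> \<le> (1 + h * Lb) * \<bar>x - y\<bar>"
      by (simp add: distrib_right)
    have sl: "\<bar>spread ch T m \<sigma> k x - spread ch T m \<sigma> k y\<bar> \<le> sqrt h * Ls * \<bar>x - y\<bar>" for x y
    proof -
      have "spread ch T m \<sigma> k x - spread ch T m \<sigma> k y = sqrt h * (diffusion_coeff ch T m \<sigma> k x - diffusion_coeff ch T m \<sigma> k y)"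
        by (simp add: spread_def h_def algebra_simps)
      then show ?thesis using mult_left_mono[OF lips[of x y], of "sqrt h"] h by (simp add: abs_mult)
    qed
    show "\<bar>spread ch T m \<sigma> k x - spread ch T m \<sigma> k y\<bar> \<le> sqrt h * Ls * \<bar>x - y\<bar>" by (rule sl)
    show "\<kappa> * (y - x) \<le> drift_map ch T m b k y - drift_map ch T m b k x - \<bar>spread ch T m \<sigma> k y - spread ch T m \<sigma> k x\<bar> * \<bar>z\<bar>"
      if xy: "x \<le> y" and z: "ereal \<bar>z\<bar> \<le> s" for z
    proof -
      have "(\<integral>t. b t x + c * x \<partial>P) \<le> (\<integral>t. b t y + c * y \<partial>P)"
        using P.integrable_coeff[OF b] c(3) xy by (intro P.average_mono) (auto dest: monoD)
      then have "drift_coeff ch T m b k x + c * x \<le> drift_coeff ch T m b k y + c * y"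
        using P.integrable_coeff[OF b] P.prob_space by (simp add: P(2)[OF b])
      then have "h * (drift_coeff ch T m b k x + c * x) \<le> h * (drift_coeff ch T m b k y + c * y)"
        using h by (intro mult_left_mono) auto
      then have 1: "drift_map ch T m b k y - drift_map ch T m b k x \<ge> (1 - c * h) * (y - x)"
        by (simp add: drift_map_def flip: h_def) (simp add: algebra_simps)
      have "\<bar>spread ch T m \<sigma> k y - spread ch T m \<sigma> k x\<bar> * \<bar>z\<bar> \<le> (sqrt h * Ls * \<bar>y - x\<bar>) * \<bar>z\<bar>"
        using sl by (intro mult_right_mono) auto
      also have "\<dots> = (\<bar>z\<bar> * Ls * sqrt h) * (y - x)" using xy by simp
      also have "\<dots> \<le> 1 / 2 * (y - x)"
        using noise_level_bound[OF T m Ls(1,2) adm z] xy by (intro mult_right_mono) (auto simp: h_def)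
      moreover have "\<kappa> * (y - x) = (1 - c * h) * (y - x) - 1 / 2 * (y - x)"
        unfolding \<kappa>_def left_diff_distrib[symmetric] by simp
      ultimately show ?thesis using 1 by linarith
    qed
    have cvx: "convex_on UNIV (\<lambda>x. \<integral>t. (\<sigma> t x)\<^sup>2 + a * x\<^sup>2 \<partial>P)"
      using P.integrable_coeff[OF \<sigma>] a(3) by (intro P.average_convex) auto
    have "(\<lambda>x. (spread ch T m \<sigma> k x)\<^sup>2 + h * a * x\<^sup>2) = (\<lambda>x. h * (\<integral>t. (\<sigma> t x)\<^sup>2 + a * x\<^sup>2 \<partial>P))"
      using P.integrable_coeff[OF \<sigma>] P.prob_space h
      by (simp add: spread_def power_mult_distrib P(3)[OF \<sigma>] algebra_simps flip: h_def)
    then show "convex_on UNIV (\<lambda>x. (spread ch T m \<sigma> k x)\<^sup>2 + h * a * x\<^sup>2)"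
      using convex_on_cmul[OF _ cvx, of h] h by simp
    show "0 \<le> h * a" using h a by simp
    show "0 \<le> \<kappa>" using rt rt0 by linarith
    have "(sqrt (c' * h))\<^sup>2 \<le> \<kappa>\<^sup>2" using rt rt0 by (intro power_mono)
    then show "h * a + (sqrt h * Ls)\<^sup>2 \<le> \<kappa>\<^sup>2"
    proof -
      have "(sqrt (c' * h))\<^sup>2 = h * a + (sqrt h * Ls)\<^sup>2"
        using c'0 h by (simp add: power_mult_distrib) (simp add: c'_def algebra_simps)
      then show ?thesis using \<open>(sqrt (c' * h))\<^sup>2 \<le> \<kappa>\<^sup>2\<close> by simp
    qed
  qed
qed

lemma drift_map_convex:
  assumes T: "0 < T" and m: "0 < m" and k: "k < m" and b: "regular_coeff T b"
    and c: "\<And>t. t \<in> {0..T} \<Longrightarrow> convex_on UNIV (b t)"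
  shows "convex_on UNIV (drift_map ch T m b k)"
proof -
  obtain P where P: "time_average P T"
    "\<And>g x. regular_coeff T g \<Longrightarrow> drift_coeff ch T m g k x = (\<integral>t. g t x \<partial>P)"
    "\<And>g x. regular_coeff T g \<Longrightarrow> (diffusion_coeff ch T m g k x)\<^sup>2 = (\<integral>t. (g t x)\<^sup>2 \<partial>P)"
    using coefficient_law[OF T m k, of ch] by blast
  interpret P: time_average P T by (rule P(1))
  have "convex_on UNIV (\<lambda>x. \<integral>t. b t x \<partial>P)"
    using P.integrable_coeff[OF b] c by (intro P.average_convex) auto
  moreover have "drift_coeff ch T m b k = (\<lambda>x. \<integral>t. b t x \<partial>P)" by (rule ext) (rule P(2)[OF b])
  ultimately have "convex_on UNIV (drift_coeff ch T m b k)" by simp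
  then have "convex_on UNIV (\<lambda>x. x + T / real m * drift_coeff ch T m b k x)"
    using T by (intro convex_on_add convex_on_cmul) (auto simp: convex_on_ident)
  then show ?thesis by (simp add: drift_map_def[abs_def])
qed

lemma drift_map_affine:
  assumes T: "0 < T" and m: "0 < m" and k: "k < m" and b: "regular_coeff T b"
    and aff: "\<And>t x. t \<in> {0..T} \<Longrightarrow> b t x = l t + \<mu> t * x"
  shows "\<exists>a c. \<forall>x. drift_map ch T m b k x = a + c * x"
proof -
  obtain P where P: "time_average P T"
    "\<And>g x. regular_coeff T g \<Longrightarrow> drift_coeff ch T m g k x = (\<integral>t. g t x \<partial>P)"
    "\<And>g x. regular_coeff T g \<Longrightarrow> (diffusion_coeff ch T m g k x)\<^sup>2 = (\<integral>t. (g t x)\<^sup>2 \<partial>P)"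
    using coefficient_law[OF T m k, of ch] by blast
  interpret P: time_average P T by (rule P(1))
  define d where "d = (\<lambda>x. drift_coeff ch T m b k x)"
  have d: "d x = (\<integral>t. b t x \<partial>P)" for x by (simp add: d_def P(2)[OF b])
  have lin: "d x = d 0 + (d 1 - d 0) * x" for x
  proof -
    have "d x = (\<integral>t. b t 0 + (b t 1 - b t 0) * x \<partial>P)"
      unfolding d using P.space_P aff by (intro Bochner_Integration.integral_cong) (auto simp: subset_iff)
    also have "\<dots> = d 0 + (d 1 - d 0) * x"
      using P.integrable_coeff[OF b] by (simp add: d)
    finally show ?thesis .
  qed
  have "drift_map ch T m b k x = T / real m * d 0 + (1 + T / real m * (d 1 - d 0)) * x" for x
  proof -
    have "drift_map ch T m b k x = x + T / real m * d x" by (simp add: drift_map_def d_def)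
    also have "\<dots> = T / real m * d 0 + (1 + T / real m * (d 1 - d 0)) * x"
      by (subst lin[of x]) (simp add: algebra_simps)
    finally show ?thesis .
  qed
  then show ?thesis by blast
qed

section \<open>Comparison of schemes driven by the same noise\<close>

definition lipschitz_scheme :: "nat \<Rightarrow> (nat \<Rightarrow> real \<Rightarrow> real) \<Rightarrow> (nat \<Rightarrow> real \<Rightarrow> real) \<Rightarrow> bool" where
  "lipschitz_scheme n \<mu> \<rho> \<longleftrightarrow> (\<exists>K\<ge>0. \<forall>k<n. \<forall>x y. \<bar>\<mu> k x - \<mu> k y\<bar> \<le> K * \<bar>x - y\<bar> \<and> \<bar>\<rho> k x - \<rho> k y\<bar> \<le> K * \<bar>x - y\<bar>)"

lemma lipschitz_scheme_continuous:
  assumes "lipschitz_scheme n \<mu> \<rho>" "k < n"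
  shows "continuous_on UNIV (\<mu> k)" "continuous_on UNIV (\<rho> k)"
proof -
  obtain K where K: "K \<ge> 0" "\<forall>k<n. \<forall>x y. \<bar>\<mu> k x - \<mu> k y\<bar> \<le> K * \<bar>x - y\<bar> \<and> \<bar>\<rho> k x - \<rho> k y\<bar> \<le> K * \<bar>x - y\<bar>"
    using assms(1) unfolding lipschitz_scheme_def by blast
  show "continuous_on UNIV (\<mu> k)" "continuous_on UNIV (\<rho> k)"
    using K assms(2) by (intro lipschitz_on_continuous_on[of K]; auto simp: lipschitz_on_def dist_real_def)+
qed

lemma lipschitz_scheme_growth:
  assumes "lipschitz_scheme n \<mu> \<rho>"
  shows "\<exists>B\<ge>0. \<forall>k<n. \<forall>x. \<bar>\<mu> k x\<bar> \<le> B * (1 + \<bar>x\<bar>) \<and> \<bar>\<rho> k x\<bar> \<le> B * (1 + \<bar>x\<bar>)"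
proof -
  obtain K where K: "K \<ge> 0" "\<And>k x y. k < n \<Longrightarrow> \<bar>\<mu> k x - \<mu> k y\<bar> \<le> K * \<bar>x - y\<bar> \<and> \<bar>\<rho> k x - \<rho> k y\<bar> \<le> K * \<bar>x - y\<bar>"
    using assms unfolding lipschitz_scheme_def by blast
  define B where "B = K + (\<Sum>k<n. \<bar>\<mu> k 0\<bar> + \<bar>\<rho> k 0\<bar>)"
  have B0: "B \<ge> K" unfolding B_def by (simp add: sum_nonneg)
  have "\<bar>\<mu> k x\<bar> \<le> B * (1 + \<bar>x\<bar>) \<and> \<bar>\<rho> k x\<bar> \<le> B * (1 + \<bar>x\<bar>)" if k: "k < n" for k x
  proof -
    have "\<bar>\<mu> k 0\<bar> + \<bar>\<rho> k 0\<bar> \<le> (\<Sum>k<n. \<bar>\<mu> k 0\<bar> + \<bar>\<rho> k 0\<bar>)"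
      using k by (intro member_le_sum) auto
    then have 1: "\<bar>\<mu> k 0\<bar> \<le> B" "\<bar>\<rho> k 0\<bar> \<le> B" using K(1) by (auto simp: B_def)
    have "K * \<bar>x\<bar> \<le> B * \<bar>x\<bar>" using B0 by (intro mult_right_mono) auto
    moreover have "\<bar>\<mu> k x - \<mu> k 0\<bar> \<le> K * \<bar>x\<bar>" "\<bar>\<rho> k x - \<rho> k 0\<bar> \<le> K * \<bar>x\<bar>"
      using K(2)[OF k, of x 0] by simp_all
    ultimately show ?thesis using 1 unfolding distrib_left mult_1_right by linarith
  qed
  then show ?thesis using B0 K(1) by (intro exI[of _ B]) auto
qed

text \<open>
  The bound is a product of functions of independent variables, so its mean is a product of finite means.
\<close>

lemma path_seq_growth:
  assumes B: "B \<ge> 0" "\<And>k x. k < n \<Longrightarrow> \<bar>\<mu> k x\<bar> \<le> B * (1 + \<bar>x\<bar>) \<and> \<bar>\<rho> k x\<bar> \<le> B * (1 + \<bar>x\<bar>)"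
  shows "i \<le> n \<Longrightarrow> 1 + \<bar>path_seq \<mu> \<rho> s (\<lambda>_. x) g n i\<bar> \<le> (1 + \<bar>x\<bar>) * (\<Prod>j\<in>{1..n}. (1 + B) * (1 + \<bar>g j\<bar>))"
  using B(2)
proof (induction n arbitrary: i)
  case (Suc n)
  let ?P = "\<Prod>j\<in>{1..n}. (1 + B) * (1 + \<bar>g j\<bar>)"
  have ins: "{1..Suc n} = insert (Suc n) {1..n}" by auto
  have P: "(\<Prod>j\<in>{1..Suc n}. (1 + B) * (1 + \<bar>g j\<bar>)) = ((1 + B) * (1 + \<bar>g (Suc n)\<bar>)) * ?P"
    unfolding ins by simp
  have IH: "1 + \<bar>path_seq \<mu> \<rho> s (\<lambda>_. x) g n i\<bar> \<le> (1 + \<bar>x\<bar>) * ?P" if "i \<le> n" for i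
    using Suc.IH[OF that] Suc.prems(2) by simp
  have big: "1 \<le> (1 + B) * (1 + \<bar>g (Suc n)\<bar>)" using B(1) by (simp add: distrib_left distrib_right)
  show ?case
  proof (cases "i = Suc n")
    case False
    then have "1 + \<bar>path_seq \<mu> \<rho> s (\<lambda>_. x) g n i\<bar> \<le> (1 + \<bar>x\<bar>) * ?P" using Suc.prems IH by simp
    also have "\<dots> \<le> ((1 + B) * (1 + \<bar>g (Suc n)\<bar>)) * ((1 + \<bar>x\<bar>) * ?P)"
    proof -
      have "0 \<le> ?P" using B(1) by (intro prod_nonneg) auto
      then have "0 \<le> (1 + \<bar>x\<bar>) * ?P" by simp
      then show ?thesis using mult_right_mono[OF big] by simp
    qed
    finally show ?thesis using False unfolding P by (simp add: ac_simps)
  next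
    case True
    define y where "y = path_seq \<mu> \<rho> s (\<lambda>_. x) g n n"
    define z where "z = truncate s (g (Suc n))"
    have z: "\<bar>z\<bar> \<le> \<bar>g (Suc n)\<bar>" by (simp add: z_def truncate_def)
    have b: "\<bar>\<mu> n y\<bar> \<le> B * (1 + \<bar>y\<bar>)" "\<bar>\<rho> n y\<bar> \<le> B * (1 + \<bar>y\<bar>)" using Suc.prems(2) by auto
    have "\<bar>\<rho> n y * z\<bar> \<le> (B * (1 + \<bar>y\<bar>)) * \<bar>g (Suc n)\<bar>"
      unfolding abs_mult using b(2) z B(1) by (intro mult_mono) auto
    then have "1 + \<bar>\<mu> n y + \<rho> n y * z\<bar> \<le> 1 + B * (1 + \<bar>y\<bar>) + B * (1 + \<bar>y\<bar>) * \<bar>g (Suc n)\<bar>"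
      using b(1) by linarith
    also have "\<dots> \<le> (1 + \<bar>y\<bar>) * ((1 + B) * (1 + \<bar>g (Suc n)\<bar>))"
      by (simp add: distrib_left distrib_right)
    also have "\<dots> \<le> ((1 + \<bar>x\<bar>) * ?P) * ((1 + B) * (1 + \<bar>g (Suc n)\<bar>))"
      using IH[of n] B(1) by (intro mult_right_mono) (auto simp: y_def)
    finally show ?thesis unfolding P True by (simp add: y_def z_def ac_simps)
  qed
qed simp

lemma path_seq_mono:
  assumes "\<And>k x y z. k < n \<Longrightarrow> x \<le> y \<Longrightarrow> ereal \<bar>z\<bar> \<le> s \<Longrightarrow> \<mu> k x + \<rho> k x * z \<le> \<mu> k y + \<rho> k y * z"
    and s: "0 \<le> s" and x: "\<And>i. x i \<le> y i"
  shows "path_seq \<mu> \<rho> s x g n i \<le> path_seq \<mu> \<rho> s y g n i"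
  using assms(1)
proof (induction n arbitrary: i)
  case (Suc n)
  have "ereal \<bar>truncate s (g (Suc n))\<bar> \<le> s" using s by (simp add: truncate_def zero_ereal_def)
  then show ?case using Suc by simp
qed (simp add: x)

text \<open>
  The lowest value that can follow \<open>v\<close> is at least \<open>\<mu> k v - \<eta> k v * S\<close>, which increases with \<open>v\<close>, so a lower bound for
  the present value gives one for the next; likewise for upper bounds.
\<close>

lemma path_seq_one_sided:
  assumes inc: "\<And>k x y. k < n \<Longrightarrow> x \<le> y \<Longrightarrow> \<mu> k x - \<eta> k x * S \<le> \<mu> k y - \<eta> k y * S \<and> \<mu> k x + \<eta> k x * S \<le> \<mu> k y + \<eta> k y * S"
    and \<rho>: "\<And>k x. k < n \<Longrightarrow> \<bar>\<rho> k x\<bar> \<le> \<eta> k x" and S: "\<And>g. \<bar>truncate s g\<bar> \<le> S"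
  shows "\<exists>B\<ge>0. \<forall>x g i. i \<le> n \<longrightarrow> (0 \<le> x \<longrightarrow> - B \<le> path_seq \<mu> \<rho> s (\<lambda>_. x) g n i) \<and> (x \<le> 0 \<longrightarrow> path_seq \<mu> \<rho> s (\<lambda>_. x) g n i \<le> B)"
  using inc \<rho>
proof (induction n)
  case (Suc n)
  obtain B where B: "B \<ge> 0" "\<And>x g i. i \<le> n \<Longrightarrow> (0 \<le> x \<longrightarrow> - B \<le> path_seq \<mu> \<rho> s (\<lambda>_. x) g n i) \<and> (x \<le> 0 \<longrightarrow> path_seq \<mu> \<rho> s (\<lambda>_. x) g n i \<le> B)"
  proof -
    have "\<exists>B\<ge>0. \<forall>x g i. i \<le> n \<longrightarrow> (0 \<le> x \<longrightarrow> - B \<le> path_seq \<mu> \<rho> s (\<lambda>_. x) g n i) \<and> (x \<le> 0 \<longrightarrow> path_seq \<mu> \<rho> s (\<lambda>_. x) g n i \<le> B)"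
      by (rule Suc.IH; rule Suc.prems) auto
    then show ?thesis using that by blast
  qed
  define B' where "B' = max B (max (- (\<mu> n (- B) - \<eta> n (- B) * S)) (\<mu> n B + \<eta> n B * S))"
  have b: "\<bar>\<rho> n y * truncate s z\<bar> \<le> \<eta> n y * S" for y z
  proof -
    have "\<bar>\<rho> n y\<bar> \<le> \<eta> n y" using Suc.prems(2) by simp
    then show ?thesis unfolding abs_mult using S[of z] by (intro mult_mono) auto
  qed
  have "(0 \<le> x \<longrightarrow> - B' \<le> path_seq \<mu> \<rho> s (\<lambda>_. x) g (Suc n) i) \<and> (x \<le> 0 \<longrightarrow> path_seq \<mu> \<rho> s (\<lambda>_. x) g (Suc n) i \<le> B')"
    if i: "i \<le> Suc n" for x g i
  proof (cases "i = Suc n")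
    case False
    then show ?thesis using B(2)[of i x g] i by (auto simp: B'_def)
  next
    case True
    define y where "y = path_seq \<mu> \<rho> s (\<lambda>_. x) g n n"
    have y: "0 \<le> x \<Longrightarrow> - B \<le> y" "x \<le> 0 \<Longrightarrow> y \<le> B" using B(2)[of n x g] by (auto simp: y_def)
    have "0 \<le> x \<Longrightarrow> \<mu> n (- B) - \<eta> n (- B) * S \<le> \<mu> n y - \<eta> n y * S" using Suc.prems(1)[of n "- B" y] y by simp
    moreover have "x \<le> 0 \<Longrightarrow> \<mu> n y + \<eta> n y * S \<le> \<mu> n B + \<eta> n B * S" using Suc.prems(1)[of n y B] y by simp
    moreover have "\<bar>\<rho> n y * truncate s (g (Suc n))\<bar> \<le> \<eta> n y * S" by (rule b)
    ultimately have "(0 \<le> x \<longrightarrow> - B' \<le> \<mu> n y + \<rho> n y * truncate s (g (Suc n)))"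
      "(x \<le> 0 \<longrightarrow> \<mu> n y + \<rho> n y * truncate s (g (Suc n)) \<le> B')"
      unfolding B'_def by linarith+
    then show ?thesis unfolding True by (simp add: y_def)
  qed
  moreover have "B' \<ge> 0" using B(1) by (simp add: B'_def)
  ultimately show ?case by blast
qed (rule exI[of _ 0], auto)

lemma path_seq_affine:
  assumes "\<And>k x. k < n \<Longrightarrow> \<mu> k x = a k + c k * x" "\<And>k. k < n \<Longrightarrow> 0 \<le> c k" "\<And>k x. k < n \<Longrightarrow> \<rho> k x = d k"
  shows "\<exists>p q. (\<forall>i. 0 \<le> q i) \<and> (\<forall>t. path_seq \<mu> \<rho> s (\<lambda>_. t) g n = (\<lambda>i. p i + t * q i))"
  using assms
proof (induction n)
  case 0
  show ?case by (rule exI[of _ "\<lambda>_. 0"], rule exI[of _ "\<lambda>_. 1"]) auto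
next
  case (Suc n)
  obtain p q where pq: "\<forall>i. 0 \<le> q i" "\<And>t. path_seq \<mu> \<rho> s (\<lambda>_. t) g n = (\<lambda>i. p i + t * q i)"
  proof -
    have "\<exists>p q. (\<forall>i. 0 \<le> q i) \<and> (\<forall>t. path_seq \<mu> \<rho> s (\<lambda>_. t) g n = (\<lambda>i. p i + t * q i))"
      by (rule Suc.IH; rule Suc.prems) auto
    then show ?thesis using that by blast
  qed
  show ?case
    by (rule exI[of _ "p(Suc n := a n + c n * p n + d n * truncate s (g (Suc n)))"], rule exI[of _ "q(Suc n := c n * q n)"])
      (use pq Suc.prems in \<open>auto simp: fun_eq_iff algebra_simps\<close>)
qed

locale driven_scheme = prob_space M for M :: "'w measure" +
  fixes n :: nat and s :: ereal and G :: "nat \<Rightarrow> 'w \<Rightarrow> real"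
  assumes n_pos: "0 < n" and s_nonneg: "0 \<le> s"
    and G_normal: "\<And>k. k \<in> {1..n} \<Longrightarrow> distributed M lborel (G k) (\<lambda>x. ennreal (std_normal_density x))"
    and G_indep: "indep_vars (\<lambda>_. borel) G {1..n}"
begin

definition noise :: "'w \<Rightarrow> nat \<Rightarrow> real" where
  "noise \<omega> = (\<lambda>k\<in>{1..n}. G k \<omega>)"

abbreviation flow :: "(nat \<Rightarrow> real \<Rightarrow> real) \<Rightarrow> (nat \<Rightarrow> real \<Rightarrow> real) \<Rightarrow> real \<Rightarrow> (nat \<Rightarrow> real) \<Rightarrow> nat \<Rightarrow> real" where
  "flow \<mu> \<rho> x g \<equiv> path_seq \<mu> \<rho> s (\<lambda>_. x) g n"

text \<open>
  The windows that make the noise bounded: all finite ones, and also \<open>\<infinity>\<close> if the truncation level is finite.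
\<close>

definition level :: "ereal \<Rightarrow> bool" where
  "level r \<longleftrightarrow> 0 \<le> r \<and> min s r < \<infinity>"

definition windowed_mean ::
  "(nat \<Rightarrow> real \<Rightarrow> real) \<Rightarrow> (nat \<Rightarrow> real \<Rightarrow> real) \<Rightarrow> ereal \<Rightarrow> ((nat \<Rightarrow> real) \<Rightarrow> real) \<Rightarrow> real \<Rightarrow> real" where
  "windowed_mean \<mu> \<rho> r F x = (\<integral>g. F (flow \<mu> \<rho> x g) * windows r n g \<partial>gauss_vector n)"

lemma levelE:
  assumes "level r"
  obtains S where "min s r = ereal S" "0 \<le> S"
proof -
  have "0 \<le> min s r" "min s r < \<infinity>" using assms s_nonneg by (auto simp: level_def)
  then show ?thesis using that by (cases "min s r") auto
qed

lemma level_nat: "level (ereal (real N))"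
proof -
  have "min s (ereal (real N)) \<le> ereal (real N)" by simp
  also have "\<dots> < \<infinity>" by simp
  finally show ?thesis by (simp only: level_def) simp
qed

lemma level_infinite: "s < \<infinity> \<Longrightarrow> level \<infinity>"
  unfolding level_def by (simp add: min_less_iff_disj)

lemma windows_infinite: "windows \<infinity> n g = 1"
  by (simp add: windows_eq)

lemma independent_start_constant: "independent_start M G n (\<lambda>_. x)"
  by (rule independent_start_const[OF prob_space_axioms n_pos G_normal G_indep])

lemma flow_measurable:
  assumes F: "tame n F" and l: "lipschitz_scheme n \<mu> \<rho>"
  shows "(\<lambda>p. F (flow \<mu> \<rho> (fst p) (snd p))) \<in> borel_measurable (borel \<Otimes>\<^sub>M gauss_vector n)"
proof (rule measurable_compose[OF _ tameD_measurable[OF F]])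
  show "(\<lambda>p. flow \<mu> \<rho> (fst p) (snd p)) \<in> borel \<Otimes>\<^sub>M gauss_vector n \<rightarrow>\<^sub>M PiM UNIV (\<lambda>_. borel)"
  proof (rule measurable_path_seq)
    show "(\<lambda>p::real \<times> (nat \<Rightarrow> real). (\<lambda>_. fst p)) \<in> borel \<Otimes>\<^sub>M gauss_vector n \<rightarrow>\<^sub>M PiM UNIV (\<lambda>_. borel)"
      by (rule measurable_PiM_single') (auto simp: space_PiM)
    show "(\<lambda>p::real \<times> (nat \<Rightarrow> real). snd p j) \<in> borel_measurable (borel \<Otimes>\<^sub>M gauss_vector n)" if "j \<in> {1..n}" for j
      by (rule measurable_compose[OF measurable_snd measurable_gauss_component[OF that]])
  qed (use lipschitz_scheme_continuous[OF l] in \<open>auto intro: borel_measurable_continuous_onI\<close>)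
qed

lemma windowed_flow_measurable:
  assumes F: "tame n F" and l: "lipschitz_scheme n \<mu> \<rho>"
  shows "(\<lambda>p. F (flow \<mu> \<rho> (fst p) (snd p)) * windows r n (snd p)) \<in> borel_measurable (borel \<Otimes>\<^sub>M gauss_vector n)"
  by (intro borel_measurable_times flow_measurable[OF F l] measurable_compose[OF measurable_snd measurable_windows])

lemma windowed_mean_backward:
  assumes "level r" "tame n F" "lipschitz_scheme n \<mu> \<rho>"
  shows "windowed_mean \<mu> \<rho> r F x = stein_noise.backward (truncated_gauss s r) \<mu> \<rho> n F (\<lambda>_. x)"
proof -
  obtain S where S: "min s r = ereal S" using levelE[OF assms(1)] by blast
  show ?thesis
    unfolding windowed_mean_def
    by (rule backward_eq_integral[symmetric, OF assms(2) order_refl s_nonneg _ S])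
      (use assms lipschitz_scheme_continuous in \<open>auto simp: level_def\<close>)
qed

lemma windowed_flow_integrable:
  assumes "level r" "tame n F" "lipschitz_scheme n \<mu> \<rho>"
  shows "integrable (gauss_vector n) (\<lambda>g. F (flow \<mu> \<rho> x g) * windows r n g)"
proof -
  obtain S where S: "min s r = ereal S" "0 \<le> S" using levelE[OF assms(1)] by blast
  show ?thesis
    by (rule path_seq_integrable[OF assms(2) order_refl S]) (use assms lipschitz_scheme_continuous in auto)
qed

lemma windowed_fubini:
  assumes r: "level r" and F: "tame n F" and l: "lipschitz_scheme n \<mu> \<rho>" and U: "independent_start M G n U"
    and fin: "(\<integral>\<^sup>+ \<omega>. ennreal (F (flow \<mu> \<rho> (U \<omega>) (noise \<omega>)) * windows r n (noise \<omega>)) \<partial>M) < \<infinity> \<or>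
      neg_part_integrable M (\<lambda>\<omega>. F (flow \<mu> \<rho> (U \<omega>) (noise \<omega>)) * windows r n (noise \<omega>))"
  shows "ext_expectation M (\<lambda>\<omega>. F (flow \<mu> \<rho> (U \<omega>) (noise \<omega>)) * windows r n (noise \<omega>))
    = ext_expectation M (\<lambda>\<omega>. windowed_mean \<mu> \<rho> r F (U \<omega>))"
  using ext_expectation_fubini[OF U windowed_flow_measurable[OF F l, of r]] windowed_flow_integrable[OF r F l] fin
  by (simp add: noise_def windowed_mean_def neg_part_integrable_def)

lemma flow_random_measurable:
  assumes "tame n F" "lipschitz_scheme n \<mu> \<rho>" "independent_start M G n U"
  shows "(\<lambda>\<omega>. F (flow \<mu> \<rho> (U \<omega>) (noise \<omega>))) \<in> borel_measurable M"
  using independent_start_measurable[OF assms(3) flow_measurable[OF assms(1,2)]] by (simp add: noise_def)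

lemma windows_random_measurable: "(\<lambda>\<omega>. windows r n (noise \<omega>)) \<in> borel_measurable M"
  using measurable_compose[OF gauss_vector_measurable[OF prob_space_axioms G_normal] measurable_windows]
  by (simp add: noise_def)

lemma neg_part_integrable_windowed:
  assumes "neg_part_integrable M (\<lambda>\<omega>. f \<omega>)"
  shows "neg_part_integrable M (\<lambda>\<omega>. f \<omega> * windows r n (noise \<omega>))"
proof -
  have "(\<integral>\<^sup>+ \<omega>. ennreal (- (f \<omega> * windows r n (noise \<omega>))) \<partial>M) \<le> (\<integral>\<^sup>+ \<omega>. ennreal (- f \<omega>) \<partial>M)"
    by (intro nn_integral_mono) (auto simp: windows_eq)
  then show ?thesis using assms unfolding neg_part_integrable_def by (rule le_less_trans)
qed

text \<open>
  The conditional means given the start are ordered, and the order of the starting points is applied to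
  whichever of them is convex. On the right-hand side nothing is to be shown unless the mean of the positive part is
  finite, and then the expectation is again the mean of a conditional mean.
\<close>

lemma windowed_comparison:
  assumes r: "level r" and F: "tame n F" and l: "lipschitz_scheme n \<mu> \<rho>" "lipschitz_scheme n \<mu>' \<rho>'"
    and U: "independent_start M G n U" and V: "independent_start M G n V"
    and le: "\<And>x. windowed_mean \<mu> \<rho> r F x \<le> windowed_mean \<mu>' \<rho>' r F x"
    and ord: "ext_expectation M (\<lambda>\<omega>. windowed_mean \<mu> \<rho> r F (U \<omega>)) \<le> ext_expectation M (\<lambda>\<omega>. windowed_mean \<mu> \<rho> r F (V \<omega>))
      \<or> ext_expectation M (\<lambda>\<omega>. windowed_mean \<mu>' \<rho>' r F (U \<omega>)) \<le> ext_expectation M (\<lambda>\<omega>. windowed_mean \<mu>' \<rho>' r F (V \<omega>))"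
    and neg: "neg_part_integrable M (\<lambda>\<omega>. F (flow \<mu> \<rho> (U \<omega>) (noise \<omega>)))"
  shows "ext_expectation M (\<lambda>\<omega>. F (flow \<mu> \<rho> (U \<omega>) (noise \<omega>)) * windows r n (noise \<omega>))
    \<le> ext_expectation M (\<lambda>\<omega>. F (flow \<mu>' \<rho>' (V \<omega>) (noise \<omega>)) * windows r n (noise \<omega>))"
proof (cases "(\<integral>\<^sup>+ \<omega>. ennreal (F (flow \<mu>' \<rho>' (V \<omega>) (noise \<omega>)) * windows r n (noise \<omega>)) \<partial>M) < \<infinity>")
  case False
  then show ?thesis by (simp add: ext_expectation_infinite less_top[symmetric])
next
  case True
  have "ext_expectation M (\<lambda>\<omega>. F (flow \<mu> \<rho> (U \<omega>) (noise \<omega>)) * windows r n (noise \<omega>))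
     = ext_expectation M (\<lambda>\<omega>. windowed_mean \<mu> \<rho> r F (U \<omega>))"
    using neg_part_integrable_windowed[OF neg] by (intro windowed_fubini[OF r F l(1) U]) simp
  also have "\<dots> \<le> ext_expectation M (\<lambda>\<omega>. windowed_mean \<mu>' \<rho>' r F (V \<omega>))"
    using ord
  proof
    assume "ext_expectation M (\<lambda>\<omega>. windowed_mean \<mu> \<rho> r F (U \<omega>)) \<le> ext_expectation M (\<lambda>\<omega>. windowed_mean \<mu> \<rho> r F (V \<omega>))"
    also have "\<dots> \<le> ext_expectation M (\<lambda>\<omega>. windowed_mean \<mu>' \<rho>' r F (V \<omega>))" by (intro ext_expectation_mono le)
    finally show ?thesis .
  next
    assume o: "ext_expectation M (\<lambda>\<omega>. windowed_mean \<mu>' \<rho>' r F (U \<omega>)) \<le> ext_expectation M (\<lambda>\<omega>. windowed_mean \<mu>' \<rho>' r F (V \<omega>))"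
    have "ext_expectation M (\<lambda>\<omega>. windowed_mean \<mu> \<rho> r F (U \<omega>)) \<le> ext_expectation M (\<lambda>\<omega>. windowed_mean \<mu>' \<rho>' r F (U \<omega>))"
      by (intro ext_expectation_mono le)
    then show ?thesis using o by (rule order_trans)
  qed
  also have "\<dots> = ext_expectation M (\<lambda>\<omega>. F (flow \<mu>' \<rho>' (V \<omega>) (noise \<omega>)) * windows r n (noise \<omega>))"
    using True by (intro windowed_fubini[OF r F l(2) V, symmetric]) simp
  finally show ?thesis .
qed

lemma window_limit:
  assumes F: "tame n F" and l: "lipschitz_scheme n \<mu> \<rho>" and U: "independent_start M G n U"
    and neg: "neg_part_integrable M (\<lambda>\<omega>. F (flow \<mu> \<rho> (U \<omega>) (noise \<omega>)))"
  shows "(\<lambda>N. ext_expectation M (\<lambda>\<omega>. F (flow \<mu> \<rho> (U \<omega>) (noise \<omega>)) * windows (ereal (real N)) n (noise \<omega>)))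
    \<longlonglongrightarrow> ext_expectation M (\<lambda>\<omega>. F (flow \<mu> \<rho> (U \<omega>) (noise \<omega>)))"
proof (rule ext_expectation_window_limit[OF flow_random_measurable[OF F l U] neg windows_random_measurable])
  show "windows (ereal (real N)) n (noise \<omega>) = 0 \<or> windows (ereal (real N)) n (noise \<omega>) = 1" for N \<omega>
    by (simp add: windows_eq)
  show "incseq (\<lambda>N. windows (ereal (real N)) n (noise \<omega>))" for \<omega>
    unfolding incseq_def windows_eq by (auto intro: order_trans)
  show "\<exists>N. windows (ereal (real N)) n (noise \<omega>) = 1" for \<omega>
  proof -
    obtain N :: nat where "(\<Sum>j\<in>{1..n}. \<bar>noise \<omega> j\<bar>) \<le> real N" using real_arch_simple by blast
    moreover have "\<bar>noise \<omega> j\<bar> \<le> (\<Sum>j\<in>{1..n}. \<bar>noise \<omega> j\<bar>)" if "j \<in> {1..n}" for j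
      using that by (intro member_le_sum) auto
    ultimately have "\<forall>j\<in>{1..n}. ereal \<bar>noise \<omega> j\<bar> \<le> ereal (real N)" by fastforce
    then show ?thesis unfolding windows_eq by (intro exI[of _ N]) simp
  qed
qed

lemma flow_integrable:
  assumes l: "lipschitz_scheme n \<mu> \<rho>" and U: "independent_start M G n U" "integrable M U" and i: "i \<le> n"
  shows "integrable M (\<lambda>\<omega>. flow \<mu> \<rho> (U \<omega>) (noise \<omega>) i)"
proof (rule integrableI_bounded)
  have "tame n (\<lambda>x. x i)"
    unfolding tame_def using i by (auto intro!: measurable_component_singleton)
  then show "(\<lambda>\<omega>. flow \<mu> \<rho> (U \<omega>) (noise \<omega>) i) \<in> borel_measurable M"
    by (rule flow_random_measurable[OF _ l U(1)])
  obtain B where B: "B \<ge> 0" "\<And>k x. k < n \<Longrightarrow> \<bar>\<mu> k x\<bar> \<le> B * (1 + \<bar>x\<bar>) \<and> \<bar>\<rho> k x\<bar> \<le> B * (1 + \<bar>x\<bar>)"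
    using lipschitz_scheme_growth[OF l] by blast
  interpret N: prob_space std_normal_distribution by (rule prob_space_std_normal)
  interpret product_sigma_finite "\<lambda>_::nat. std_normal_distribution" by standard
  let ?\<Psi> = "\<lambda>p :: real \<times> (nat \<Rightarrow> real). ennreal (1 + \<bar>fst p\<bar>) * (\<Prod>j\<in>{1..n}. ennreal ((1 + B) * (1 + \<bar>snd p j\<bar>)))"
  have hm: "(\<lambda>z::real. ennreal ((1 + B) * (1 + \<bar>z\<bar>))) \<in> borel_measurable borel" by measurable
  have \<Psi>_meas: "?\<Psi> \<in> borel_measurable (borel \<Otimes>\<^sub>M gauss_vector n)"
  proof (intro borel_measurable_times_ennreal borel_measurable_prod_ennreal)
    fix j assume "j \<in> {1..n}"
    then have "(\<lambda>p::real \<times> (nat \<Rightarrow> real). snd p j) \<in> borel_measurable (borel \<Otimes>\<^sub>M gauss_vector n)"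
      by (rule measurable_compose[OF measurable_snd measurable_gauss_component])
    from measurable_compose[OF this hm]
    show "(\<lambda>p :: real \<times> (nat \<Rightarrow> real). ennreal ((1 + B) * (1 + \<bar>snd p j\<bar>))) \<in> borel_measurable (borel \<Otimes>\<^sub>M gauss_vector n)" .
  qed measurable
  have "(\<integral>\<^sup>+ \<omega>. ennreal (norm (flow \<mu> \<rho> (U \<omega>) (noise \<omega>) i)) \<partial>M) \<le> (\<integral>\<^sup>+ \<omega>. ?\<Psi> (U \<omega>, noise \<omega>) \<partial>M)"
  proof (rule nn_integral_mono)
    fix \<omega>
    have "norm (flow \<mu> \<rho> (U \<omega>) (noise \<omega>) i) \<le> (1 + \<bar>U \<omega>\<bar>) * (\<Prod>j\<in>{1..n}. (1 + B) * (1 + \<bar>noise \<omega> j\<bar>))"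
      using path_seq_growth[where n = n and \<mu> = \<mu> and \<rho> = \<rho>, OF B i, of s "U \<omega>" "noise \<omega>"] by simp
    also have "ennreal \<dots> = ?\<Psi> (U \<omega>, noise \<omega>)"
    proof -
      have "(\<Prod>j\<in>{1..n}. ennreal ((1 + B) * (1 + \<bar>noise \<omega> j\<bar>))) = ennreal (\<Prod>j\<in>{1..n}. (1 + B) * (1 + \<bar>noise \<omega> j\<bar>))"
        by (rule prod_ennreal) (use B(1) in auto)
      moreover have "ennreal ((1 + \<bar>U \<omega>\<bar>) * (\<Prod>j\<in>{1..n}. (1 + B) * (1 + \<bar>noise \<omega> j\<bar>)))
         = ennreal (1 + \<bar>U \<omega>\<bar>) * ennreal (\<Prod>j\<in>{1..n}. (1 + B) * (1 + \<bar>noise \<omega> j\<bar>))"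
        by (rule ennreal_mult) (use B(1) in \<open>auto intro: prod_nonneg\<close>)
      ultimately show ?thesis by (simp only: fst_conv snd_conv)
    qed
    finally show "ennreal (norm (flow \<mu> \<rho> (U \<omega>) (noise \<omega>) i)) \<le> ?\<Psi> (U \<omega>, noise \<omega>)" by (simp add: ennreal_leI)
  qed
  also have "\<dots> = (\<integral>\<^sup>+ \<omega>. \<integral>\<^sup>+ g. ?\<Psi> (U \<omega>, g) \<partial>gauss_vector n \<partial>M)"
    unfolding noise_def
    by (rule bspec[OF U(1)[unfolded independent_start_def, THEN conjunct2, THEN conjunct2] \<Psi>_meas])
  also have "\<dots> = (\<integral>\<^sup>+ \<omega>. ennreal (1 + \<bar>U \<omega>\<bar>) * (\<Prod>j\<in>{1..n}. \<integral>\<^sup>+ z. ennreal ((1 + B) * (1 + \<bar>z\<bar>)) \<partial>std_normal_distribution) \<partial>M)"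
  proof (rule nn_integral_cong)
    fix \<omega>
    have "(\<integral>\<^sup>+ g. ?\<Psi> (U \<omega>, g) \<partial>gauss_vector n)
       = ennreal (1 + \<bar>U \<omega>\<bar>) * (\<integral>\<^sup>+ g. (\<Prod>j\<in>{1..n}. ennreal ((1 + B) * (1 + \<bar>g j\<bar>))) \<partial>gauss_vector n)"
      unfolding fst_conv snd_conv
    proof (rule nn_integral_cmult, rule borel_measurable_prod_ennreal)
      fix j assume "j \<in> {1..n}"
      from measurable_compose[OF measurable_gauss_component[OF this] hm]
      show "(\<lambda>g. ennreal ((1 + B) * (1 + \<bar>g j\<bar>))) \<in> borel_measurable (gauss_vector n)" .
    qed
    also have "(\<integral>\<^sup>+ g. (\<Prod>j\<in>{1..n}. ennreal ((1 + B) * (1 + \<bar>g j\<bar>))) \<partial>gauss_vector n)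
       = (\<Prod>j\<in>{1..n}. \<integral>\<^sup>+ z. ennreal ((1 + B) * (1 + \<bar>z\<bar>)) \<partial>std_normal_distribution)"
      by (rule product_nn_integral_prod) auto
    finally show "(\<integral>\<^sup>+ g. ?\<Psi> (U \<omega>, g) \<partial>gauss_vector n) = ennreal (1 + \<bar>U \<omega>\<bar>) * (\<Prod>j\<in>{1..n}. \<integral>\<^sup>+ z. ennreal ((1 + B) * (1 + \<bar>z\<bar>)) \<partial>std_normal_distribution)" .
  qed
  also have "\<dots> < \<infinity>"
  proof -
    have Um: "U \<in> borel_measurable M" using U(1) by (simp add: independent_start_def)
    have "integrable std_normal_distribution (\<lambda>z. \<bar>z\<bar>)"
      using integrable_std_normal_moment_abs[of 1] by (subst integrable_density) (auto simp: normal_density_nonneg)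
    then have "integrable std_normal_distribution (\<lambda>z. (1 + B) * (1 + \<bar>z\<bar>))" by simp
    then have 1: "(\<integral>\<^sup>+ z. ennreal ((1 + B) * (1 + \<bar>z\<bar>)) \<partial>std_normal_distribution) < \<infinity>"
      by (simp only: real_integrable_def less_top[symmetric] infinity_ennreal_def) blast
    have "integrable M (\<lambda>\<omega>. 1 + \<bar>U \<omega>\<bar>)" using U(2) by simp
    then have 2: "(\<integral>\<^sup>+ \<omega>. ennreal (1 + \<bar>U \<omega>\<bar>) \<partial>M) < \<infinity>"
      by (simp only: real_integrable_def less_top[symmetric] infinity_ennreal_def) blast
    show ?thesis
      using 1 2 Um by (subst nn_integral_multc) (auto simp: ennreal_mult_less_top power_less_top_ennreal)
  qed
  finally show "(\<integral>\<^sup>+ \<omega>. ennreal (norm (flow \<mu> \<rho> (U \<omega>) (noise \<omega>) i)) \<partial>M) < \<infinity>" .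
qed

lemma neg_part_integrable_linear_growth:
  assumes l: "lipschitz_scheme n \<mu> \<rho>" and U: "independent_start M G n U" "integrable M U"
    and F: "\<And>\<omega>. - c * (1 + (\<Sum>i\<le>n. \<bar>flow \<mu> \<rho> (U \<omega>) (noise \<omega>) i\<bar>)) \<le> F (flow \<mu> \<rho> (U \<omega>) (noise \<omega>))"
  shows "neg_part_integrable M (\<lambda>\<omega>. F (flow \<mu> \<rho> (U \<omega>) (noise \<omega>)))"
proof (rule neg_part_integrable_minorant[OF _ F])
  have "integrable M (\<lambda>\<omega>. \<Sum>i\<le>n. \<bar>flow \<mu> \<rho> (U \<omega>) (noise \<omega>) i\<bar>)"
    by (intro Bochner_Integration.integrable_sum integrable_abs flow_integrable[OF l U]) auto
  then show "integrable M (\<lambda>\<omega>. - c * (1 + (\<Sum>i\<le>n. \<bar>flow \<mu> \<rho> (U \<omega>) (noise \<omega>) i\<bar>)))" by simp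
qed

end

definition convex_scheme :: "nat \<Rightarrow> ereal \<Rightarrow> (nat \<Rightarrow> real \<Rightarrow> real) \<Rightarrow> (nat \<Rightarrow> real \<Rightarrow> real) \<Rightarrow> bool" where
  "convex_scheme n s \<mu> \<rho> \<longleftrightarrow> (\<forall>k<n. convex_step s (\<mu> k) (\<rho> k))"

lemma convex_schemeD: "convex_scheme n s \<mu> \<rho> \<Longrightarrow> k < n \<Longrightarrow> convex_step s (\<mu> k) (\<rho> k)"
  by (simp add: convex_scheme_def)

context driven_scheme
begin

lemma truncated_noise: 
  assumes "level r" "min s r = ereal S"
  shows "stein_noise (truncated_gauss s r) S"
  using assms s_nonneg by (intro truncated_gauss_stein_noise) (auto simp: level_def)

lemma windowed_mean_class:
  assumes r: "level r" and l: "lipschitz_scheme n \<mu> \<rho>" and C: "\<And>F. C F \<Longrightarrow> tame n F" and F: "C F"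
    and stable: "\<And>k F. k < n \<Longrightarrow> C F \<Longrightarrow> C (stein_noise.kernel (truncated_gauss s r) (\<mu> k) (\<rho> k) k F)"
  obtains H where "C H" "\<And>x. windowed_mean \<mu> \<rho> r F x = H (\<lambda>_. x)"
proof -
  obtain S where S: "min s r = ereal S" using levelE[OF r] by blast
  interpret N: stein_noise "truncated_gauss s r" S by (rule truncated_noise[OF r S])
  show ?thesis
  proof (rule that)
    show "C (N.backward \<mu> \<rho> n F)" by (rule N.backward_preserves[OF F stable])
    show "windowed_mean \<mu> \<rho> r F x = N.backward \<mu> \<rho> n F (\<lambda>_. x)" for x
      by (rule windowed_mean_backward[OF r C[OF F] l])
  qed
qed

text \<open>
  A functional of the class is convex in the new coordinate, hence the kernels are ordered on it.
\<close>

lemma windowed_mean_compare: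
  assumes r: "level r" and l: "lipschitz_scheme n \<mu> \<rho>" "lipschitz_scheme n \<mu>' \<rho>'"
    and C: "\<And>F. C F \<Longrightarrow> tame n F" and F: "C F"
    and ray: "\<And>F. C F \<Longrightarrow> ray_convex F"
    and drift: "\<And>k x F. k < n \<Longrightarrow> C F \<Longrightarrow> \<mu> k x = \<mu>' k x \<or> (increasing_seq F \<and> \<mu> k x \<le> \<mu>' k x)"
    and spread: "\<And>k x. k < n \<Longrightarrow> \<bar>\<rho> k x\<bar> \<le> \<bar>\<rho>' k x\<bar>"
    and stable: "(\<forall>k<n. \<forall>F. C F \<longrightarrow> C (stein_noise.kernel (truncated_gauss s r) (\<mu> k) (\<rho> k) k F)) \<or>
       (\<forall>k<n. \<forall>F. C F \<longrightarrow> C (stein_noise.kernel (truncated_gauss s r) (\<mu>' k) (\<rho>' k) k F))"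
  shows "windowed_mean \<mu> \<rho> r F x \<le> windowed_mean \<mu>' \<rho>' r F x"
proof -
  obtain S where S: "min s r = ereal S" using levelE[OF r] by blast
  interpret N: stein_noise "truncated_gauss s r" S by (rule truncated_noise[OF r S])
  have "N.backward \<mu> \<rho> n F (\<lambda>_. x) \<le> N.backward \<mu>' \<rho>' n F (\<lambda>_. x)"
  proof (rule N.backward_compare[where C = C and N = n, OF _ _ _ _ C order_refl F _ stable])
    show "N.kernel (\<mu> k) (\<rho> k) k f x \<le> N.kernel (\<mu>' k) (\<rho>' k) k f x" if "k < n" "C f" for k f x
      using that drift spread by (intro N.kernel_spread_mono[OF C ray]) auto
  qed (use lipschitz_scheme_continuous[OF l(1)] lipschitz_scheme_continuous[OF l(2)] in auto)
  then show ?thesis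
    by (simp add: windowed_mean_backward[OF r C[OF F] l(1)] windowed_mean_backward[OF r C[OF F] l(2)])
qed

lemma ray_convex_diagonal:
  assumes "ray_convex H"
  shows "convex_on UNIV (\<lambda>x. H (\<lambda>_. x))"
proof -
  show ?thesis
    using assms[unfolded ray_convex_def, THEN spec[of _ "\<lambda>_. 0"], THEN spec[of _ "\<lambda>_. 1"]] by simp
qed

definition inc_class :: "((nat \<Rightarrow> real) \<Rightarrow> real) \<Rightarrow> bool" where
  "inc_class F \<longleftrightarrow> tame n F \<and> dirconvex_seq F \<and> increasing_seq F"

definition dir_class :: "((nat \<Rightarrow> real) \<Rightarrow> real) \<Rightarrow> bool" where
  "dir_class F \<longleftrightarrow> tame n F \<and> dirconvex_seq F"

definition ray_class :: "((nat \<Rightarrow> real) \<Rightarrow> real) \<Rightarrow> bool" where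
  "ray_class F \<longleftrightarrow> tame n F \<and> ray_convex F"

lemma inc_class_stable:
  assumes r: "level r" and l: "lipschitz_scheme n \<mu> \<rho>" and c: "convex_scheme n s \<mu> \<rho>"
    and d: "\<And>k. k < n \<Longrightarrow> convex_on UNIV (\<mu> k)" and k: "k < n" and F: "inc_class F"
  shows "inc_class (stein_noise.kernel (truncated_gauss s r) (\<mu> k) (\<rho> k) k F)"
proof -
  obtain S where S: "min s r = ereal S" using levelE[OF r] by blast
  interpret N: stein_noise "truncated_gauss s r" S by (rule truncated_noise[OF r S])
  have "ereal S \<le> s" unfolding S[symmetric] by simp
  then have p: "convex_step (ereal S) (\<mu> k) (\<rho> k)"
    by (rule convex_step_level[OF convex_schemeD[OF c k]])
  show ?thesis
    using F d[OF k] lipschitz_scheme_continuous[OF l k] k unfolding inc_class_def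
    by (auto intro: N.tame_kernel N.kernel_dirconvex[OF _ _ p] N.kernel_increasing[OF _ _ p])
qed

lemma dir_class_stable:
  assumes r: "level r" and l: "lipschitz_scheme n \<mu> \<rho>" and c: "convex_scheme n s \<mu> \<rho>"
    and d: "\<And>k. k < n \<Longrightarrow> \<exists>a b. \<forall>x. \<mu> k x = a + b * x" and k: "k < n" and F: "dir_class F"
  shows "dir_class (stein_noise.kernel (truncated_gauss s r) (\<mu> k) (\<rho> k) k F)"
proof -
  obtain S where S: "min s r = ereal S" using levelE[OF r] by blast
  interpret N: stein_noise "truncated_gauss s r" S by (rule truncated_noise[OF r S])
  have "ereal S \<le> s" unfolding S[symmetric] by simp
  then have p: "convex_step (ereal S) (\<mu> k) (\<rho> k)"
    by (rule convex_step_level[OF convex_schemeD[OF c k]])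
  show ?thesis
    using F d[OF k] lipschitz_scheme_continuous[OF l k] k unfolding dir_class_def
    by (auto intro: N.tame_kernel N.kernel_dirconvex[OF _ _ p])
qed

lemma ray_class_stable:
  assumes r: "level r" and l: "lipschitz_scheme n \<mu> \<rho>"
    and d: "\<mu> k = (\<lambda>x. a + b * x)" "0 \<le> b" "\<And>x. \<rho> k x = v" and k: "k < n" and F: "ray_class F"
  shows "ray_class (stein_noise.kernel (truncated_gauss s r) (\<mu> k) (\<rho> k) k F)"
proof -
  obtain S where S: "min s r = ereal S" using levelE[OF r] by blast
  interpret N: stein_noise "truncated_gauss s r" S by (rule truncated_noise[OF r S])
  show ?thesis
    using F lipschitz_scheme_continuous[OF l k] k unfolding ray_class_def
    by (auto intro: N.tame_kernel N.kernel_ray_convex[where a = a and b = b and c = v] simp: d)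
qed

lemma inc_class_ray_convex: "inc_class F \<Longrightarrow> ray_convex F"
  by (auto simp: inc_class_def intro: ray_convex_if_dirconvex)

lemma dir_class_ray_convex: "dir_class F \<Longrightarrow> ray_convex F"
  by (auto simp: dir_class_def intro: ray_convex_if_dirconvex)

lemma windowed_mean_inc:
  assumes "level r" "lipschitz_scheme n \<mu> \<rho>" "convex_scheme n s \<mu> \<rho>" "\<And>k. k < n \<Longrightarrow> convex_on UNIV (\<mu> k)" "inc_class F"
  shows "convex_on UNIV (windowed_mean \<mu> \<rho> r F)" "mono (windowed_mean \<mu> \<rho> r F)"
proof -
  obtain H where H: "inc_class H" "\<And>x. windowed_mean \<mu> \<rho> r F x = H (\<lambda>_. x)"
    using windowed_mean_class[where C = inc_class, OF assms(1,2) _ assms(5) inc_class_stable[OF assms(1-4)]]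
    by (auto simp: inc_class_def)
  then have eq: "windowed_mean \<mu> \<rho> r F = (\<lambda>x. H (\<lambda>_. x))" by auto
  show "convex_on UNIV (windowed_mean \<mu> \<rho> r F)"
    unfolding eq by (rule ray_convex_diagonal[OF inc_class_ray_convex[OF H(1)]])
  show "mono (windowed_mean \<mu> \<rho> r F)"
    unfolding eq using H(1) by (auto simp: inc_class_def increasing_seq_def intro: monoI)
qed

lemma windowed_mean_dir:
  assumes "level r" "lipschitz_scheme n \<mu> \<rho>" "convex_scheme n s \<mu> \<rho>"
    "\<And>k. k < n \<Longrightarrow> \<exists>a b. \<forall>x. \<mu> k x = a + b * x" "dir_class F"
  shows "convex_on UNIV (windowed_mean \<mu> \<rho> r F)"
proof -
  obtain H where H: "dir_class H" "\<And>x. windowed_mean \<mu> \<rho> r F x = H (\<lambda>_. x)"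
    using windowed_mean_class[where C = dir_class, OF assms(1,2) _ assms(5) dir_class_stable[OF assms(1-4)]]
    by (auto simp: dir_class_def)
  then have eq: "windowed_mean \<mu> \<rho> r F = (\<lambda>x. H (\<lambda>_. x))" by auto
  show ?thesis unfolding eq by (rule ray_convex_diagonal[OF dir_class_ray_convex[OF H(1)]])
qed

definition affine_increasing :: "(nat \<Rightarrow> real \<Rightarrow> real) \<Rightarrow> bool" where
  "affine_increasing \<mu> \<longleftrightarrow> (\<forall>k<n. \<exists>a b. 0 \<le> b \<and> \<mu> k = (\<lambda>x. a + b * x))"

definition constant_spread :: "(nat \<Rightarrow> real \<Rightarrow> real) \<Rightarrow> bool" where
  "constant_spread \<rho> \<longleftrightarrow> (\<forall>k<n. \<exists>v. \<forall>x. \<rho> k x = v)"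

lemma ray_class_stable':
  assumes "level r" "lipschitz_scheme n \<mu> \<rho>" "affine_increasing \<mu>" "constant_spread \<rho>" "k < n" "ray_class F"
  shows "ray_class (stein_noise.kernel (truncated_gauss s r) (\<mu> k) (\<rho> k) k F)"
proof -
  obtain a b where ab: "0 \<le> b" "\<mu> k = (\<lambda>x. a + b * x)" using assms(3,5) unfolding affine_increasing_def by blast
  obtain v where v: "\<And>x. \<rho> k x = v" using assms(4,5) unfolding constant_spread_def by blast
  show ?thesis by (rule ray_class_stable[OF assms(1,2) ab(2,1) v assms(5,6)])
qed

lemma windowed_mean_ray:
  assumes "level r" "lipschitz_scheme n \<mu> \<rho>" "affine_increasing \<mu>" "constant_spread \<rho>" "ray_class F"
  shows "convex_on UNIV (windowed_mean \<mu> \<rho> r F)"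
proof -
  obtain H where H: "ray_class H" "\<And>x. windowed_mean \<mu> \<rho> r F x = H (\<lambda>_. x)"
    using windowed_mean_class[where C = ray_class, OF assms(1,2) _ assms(5) ray_class_stable'[OF assms(1-4)]]
    by (auto simp: ray_class_def)
  then have eq: "windowed_mean \<mu> \<rho> r F = (\<lambda>x. H (\<lambda>_. x))" by auto
  show ?thesis unfolding eq using H(1) by (auto simp: ray_class_def intro: ray_convex_diagonal)
qed

lemma windowed_mean_constant_start:
  assumes r: "level r" and t: "tame n H" and l: "lipschitz_scheme n \<mu> \<rho>"
  shows "ext_expectation M (\<lambda>\<omega>. H (flow \<mu> \<rho> x (noise \<omega>)) * windows r n (noise \<omega>)) = ereal (windowed_mean \<mu> \<rho> r H x)"
    "integrable M (\<lambda>\<omega>. H (flow \<mu> \<rho> x (noise \<omega>)) * windows r n (noise \<omega>))"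
proof -
  show I: "integrable M (\<lambda>\<omega>. H (flow \<mu> \<rho> x (noise \<omega>)) * windows r n (noise \<omega>))"
  proof -
    have Gm: "noise \<in> M \<rightarrow>\<^sub>M gauss_vector n"
      unfolding noise_def[abs_def] by (rule gauss_vector_measurable[OF prob_space_axioms G_normal])
    have "distr M (gauss_vector n) noise = gauss_vector n"
      unfolding noise_def[abs_def] distr_cong[OF refl sets_gauss_vector refl]
      by (rule gauss_vector_distr[OF prob_space_axioms n_pos G_normal G_indep])
    then have "integrable (distr M (gauss_vector n) noise) (\<lambda>g. H (flow \<mu> \<rho> x g) * windows r n g)"
      using windowed_flow_integrable[OF r t l] by metis
    then show ?thesis by (rule integrable_distr[OF Gm])
  qed
  have "neg_part_integrable M (\<lambda>\<omega>. H (flow \<mu> \<rho> x (noise \<omega>)) * windows r n (noise \<omega>))"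
    by (rule neg_part_integrable_minorant[OF I]) simp
  then have "ext_expectation M (\<lambda>\<omega>. H (flow \<mu> \<rho> x (noise \<omega>)) * windows r n (noise \<omega>))
      = ext_expectation M (\<lambda>\<omega>. windowed_mean \<mu> \<rho> r H x)"
    by (intro windowed_fubini[OF r t l independent_start_constant]) simp
  also have "\<dots> = ereal (windowed_mean \<mu> \<rho> r H x)"
    by (subst ext_expectation_integrable) (auto simp: prob_space)
  finally show "ext_expectation M (\<lambda>\<omega>. H (flow \<mu> \<rho> x (noise \<omega>)) * windows r n (noise \<omega>)) = ereal (windowed_mean \<mu> \<rho> r H x)" .
qed

section \<open>Increasing directionally convex functionals\<close>

context
  fixes F :: "(nat \<Rightarrow> real) \<Rightarrow> real"
  assumes F: "inc_class F" and dep: "\<And>x y. (\<And>i. i < Suc n \<Longrightarrow> x i = y i) \<Longrightarrow> F x = F y"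
begin

lemma inc_neg_part:
  assumes "lipschitz_scheme n \<mu> \<rho>" "independent_start M G n U" "integrable M U"
  shows "neg_part_integrable M (\<lambda>\<omega>. F (flow \<mu> \<rho> (U \<omega>) (noise \<omega>)))"
proof -
  obtain c where "\<And>x. - c * (1 + (\<Sum>i\<le>n. \<bar>x i\<bar>)) \<le> F x"
    using increasing_dirconvex_minorant[where f = F and m = n, OF _ _ _ dep] F unfolding inc_class_def by blast
  then show ?thesis by (intro neg_part_integrable_linear_growth[OF assms]) auto
qed

text \<open>
  In every window the conditional means are finite, and those of the convex scheme are convex and increasing in the
  start. Both negative parts are integrable, so the inequality
  persists when the window grows.
\<close>

lemma inc_comparison:
  assumes l: "lipschitz_scheme n \<mu> \<rho>" "lipschitz_scheme n \<mu>' \<rho>'"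
    and U: "independent_start M G n U" "integrable M U" and V: "independent_start M G n V" "integrable M V"
    and ord: "\<And>\<psi>. convex_on UNIV \<psi> \<Longrightarrow> mono \<psi> \<Longrightarrow> ext_expectation M (\<lambda>\<omega>. \<psi> (U \<omega>)) \<le> ext_expectation M (\<lambda>\<omega>. \<psi> (V \<omega>))"
    and drift: "\<And>k x. k < n \<Longrightarrow> \<mu> k x \<le> \<mu>' k x" and spread: "\<And>k x. k < n \<Longrightarrow> \<bar>\<rho> k x\<bar> \<le> \<bar>\<rho>' k x\<bar>"
    and c: "(convex_scheme n s \<mu> \<rho> \<and> (\<forall>k<n. convex_on UNIV (\<mu> k))) \<or> (convex_scheme n s \<mu>' \<rho>' \<and> (\<forall>k<n. convex_on UNIV (\<mu>' k)))"
  shows "ext_expectation M (\<lambda>\<omega>. F (flow \<mu> \<rho> (U \<omega>) (noise \<omega>))) \<le> ext_expectation M (\<lambda>\<omega>. F (flow \<mu>' \<rho>' (V \<omega>) (noise \<omega>)))"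
proof (rule LIMSEQ_le)
  have t: "tame n F" using F by (simp add: inc_class_def)
  show "(\<lambda>N. ext_expectation M (\<lambda>\<omega>. F (flow \<mu> \<rho> (U \<omega>) (noise \<omega>)) * windows (ereal (real N)) n (noise \<omega>)))
    \<longlonglongrightarrow> ext_expectation M (\<lambda>\<omega>. F (flow \<mu> \<rho> (U \<omega>) (noise \<omega>)))"
    by (rule window_limit[OF t l(1) U(1) inc_neg_part[OF l(1) U]])
  show "(\<lambda>N. ext_expectation M (\<lambda>\<omega>. F (flow \<mu>' \<rho>' (V \<omega>) (noise \<omega>)) * windows (ereal (real N)) n (noise \<omega>)))
    \<longlonglongrightarrow> ext_expectation M (\<lambda>\<omega>. F (flow \<mu>' \<rho>' (V \<omega>) (noise \<omega>)))"
    by (rule window_limit[OF t l(2) V(1) inc_neg_part[OF l(2) V]])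
  have "ext_expectation M (\<lambda>\<omega>. F (flow \<mu> \<rho> (U \<omega>) (noise \<omega>)) * windows (ereal (real N)) n (noise \<omega>))
    \<le> ext_expectation M (\<lambda>\<omega>. F (flow \<mu>' \<rho>' (V \<omega>) (noise \<omega>)) * windows (ereal (real N)) n (noise \<omega>))" for N
  proof (rule windowed_comparison[OF level_nat t l U(1) V(1) _ _ inc_neg_part[OF l(1) U]])
    show "windowed_mean \<mu> \<rho> (ereal (real N)) F x \<le> windowed_mean \<mu>' \<rho>' (ereal (real N)) F x" for x
    proof (rule windowed_mean_compare[where C = inc_class, OF level_nat l _ F inc_class_ray_convex _ spread])
      show "(\<forall>k<n. \<forall>F. inc_class F \<longrightarrow> inc_class (stein_noise.kernel (truncated_gauss s (ereal (real N))) (\<mu> k) (\<rho> k) k F)) \<or>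
        (\<forall>k<n. \<forall>F. inc_class F \<longrightarrow> inc_class (stein_noise.kernel (truncated_gauss s (ereal (real N))) (\<mu>' k) (\<rho>' k) k F))"
        using c inc_class_stable[OF level_nat l(1)] inc_class_stable[OF level_nat l(2)] by blast
    qed (use drift in \<open>auto simp: inc_class_def\<close>)
    show "ext_expectation M (\<lambda>\<omega>. windowed_mean \<mu> \<rho> (ereal (real N)) F (U \<omega>)) \<le> ext_expectation M (\<lambda>\<omega>. windowed_mean \<mu> \<rho> (ereal (real N)) F (V \<omega>))
      \<or> ext_expectation M (\<lambda>\<omega>. windowed_mean \<mu>' \<rho>' (ereal (real N)) F (U \<omega>)) \<le> ext_expectation M (\<lambda>\<omega>. windowed_mean \<mu>' \<rho>' (ereal (real N)) F (V \<omega>))"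
      using c
    proof (elim disjE conjE)
      assume "convex_scheme n s \<mu> \<rho>" "\<forall>k<n. convex_on UNIV (\<mu> k)"
      then show ?thesis using windowed_mean_inc[OF level_nat l(1) _ _ F] by (intro disjI1 ord) auto
    next
      assume "convex_scheme n s \<mu>' \<rho>'" "\<forall>k<n. convex_on UNIV (\<mu>' k)"
      then show ?thesis using windowed_mean_inc[OF level_nat l(2) _ _ F] by (intro disjI2 ord) auto
    qed
  qed
  then show "\<exists>N0. \<forall>N\<ge>N0. ext_expectation M (\<lambda>\<omega>. F (flow \<mu> \<rho> (U \<omega>) (noise \<omega>)) * windows (ereal (real N)) n (noise \<omega>))
    \<le> ext_expectation M (\<lambda>\<omega>. F (flow \<mu>' \<rho>' (V \<omega>) (noise \<omega>)) * windows (ereal (real N)) n (noise \<omega>))"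
    by blast
qed

lemma inc_mean_mono:
  assumes c: "convex_scheme n s \<mu> \<rho>"
  shows "mono (\<lambda>x. ext_expectation M (\<lambda>\<omega>. F (flow \<mu> \<rho> x (noise \<omega>))))"
proof (rule monoI, rule ext_expectation_mono)
  fix x y :: real and \<omega> assume "x \<le> y"
  then have "flow \<mu> \<rho> x (noise \<omega>) i \<le> flow \<mu> \<rho> y (noise \<omega>) i" for i
    by (intro path_seq_mono convex_step_mono[OF convex_schemeD[OF c]] s_nonneg) auto
  then show "F (flow \<mu> \<rho> x (noise \<omega>)) \<le> F (flow \<mu> \<rho> y (noise \<omega>))"
    using F unfolding inc_class_def increasing_seq_def by blast
qed

lemma inc_mean_convex:
  assumes l: "lipschitz_scheme n \<mu> \<rho>" and c: "convex_scheme n s \<mu> \<rho>" and d: "\<And>k. k < n \<Longrightarrow> convex_on UNIV (\<mu> k)"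
  shows "convex_ext (\<lambda>x. ext_expectation M (\<lambda>\<omega>. F (flow \<mu> \<rho> x (noise \<omega>))))"
proof -
  have t: "tame n F" using F by (simp add: inc_class_def)
  define \<phi> where "\<phi> = (\<lambda>x. ext_expectation M (\<lambda>\<omega>. F (flow \<mu> \<rho> x (noise \<omega>))))"
  have neg: "neg_part_integrable M (\<lambda>\<omega>. F (flow \<mu> \<rho> x (noise \<omega>)))" for x
    using inc_neg_part[OF l independent_start_constant[of x]] by simp
  have fin: "\<phi> x \<noteq> - \<infinity>" for x unfolding \<phi>_def by (rule ext_expectation_not_minf[OF neg])
  have lim: "(\<lambda>N. ereal (windowed_mean \<mu> \<rho> (ereal (real N)) F x)) \<longlonglongrightarrow> \<phi> x" for x
    unfolding \<phi>_def using window_limit[OF t l independent_start_constant neg]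
    by (simp add: windowed_mean_constant_start[OF level_nat t l])
  have "\<phi> ((1 - u) * x + u * y) \<le> ereal (1 - u) * \<phi> x + ereal u * \<phi> y" if u: "0 \<le> u" "u \<le> 1" for x y u
  proof (rule LIMSEQ_le[OF lim])
    show "(\<lambda>N. ereal (1 - u) * ereal (windowed_mean \<mu> \<rho> (ereal (real N)) F x) + ereal u * ereal (windowed_mean \<mu> \<rho> (ereal (real N)) F y))
       \<longlonglongrightarrow> ereal (1 - u) * \<phi> x + ereal u * \<phi> y"
    proof (rule tendsto_add_ereal_general)
      have "ereal (1 - u) * \<phi> x \<noteq> - \<infinity>" "ereal u * \<phi> y \<noteq> - \<infinity>"
        using fin[of x] fin[of y] u by (cases "\<phi> x"; cases "\<phi> y"; auto)+
      then show "\<not> ((ereal (1 - u) * \<phi> x = \<infinity> \<and> ereal u * \<phi> y = - \<infinity>) \<or> (ereal (1 - u) * \<phi> x = - \<infinity> \<and> ereal u * \<phi> y = \<infinity>))"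
        by blast
    qed (intro tendsto_cmult_ereal lim; simp)+
    have "windowed_mean \<mu> \<rho> (ereal (real N)) F ((1 - u) * x + u * y)
      \<le> (1 - u) * windowed_mean \<mu> \<rho> (ereal (real N)) F x + u * windowed_mean \<mu> \<rho> (ereal (real N)) F y" for N
      using convex_onD[OF windowed_mean_inc(1)[OF level_nat l c d F] u, of x y] by simp
    then show "\<exists>N0. \<forall>N\<ge>N0. ereal (windowed_mean \<mu> \<rho> (ereal (real N)) F ((1 - u) * x + u * y))
      \<le> ereal (1 - u) * ereal (windowed_mean \<mu> \<rho> (ereal (real N)) F x) + ereal u * ereal (windowed_mean \<mu> \<rho> (ereal (real N)) F y)"
      by simp
  qed
  then show ?thesis using fin unfolding convex_ext_def \<phi>_def by blast
qed

end

end

context driven_scheme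
begin

section \<open>Directionally convex functionals of a bounded noise\<close>

context
  fixes F :: "(nat \<Rightarrow> real) \<Rightarrow> real"
  assumes F: "dir_class F" and dep: "\<And>x y. (\<And>i. i < Suc n \<Longrightarrow> x i = y i) \<Longrightarrow> F x = F y" and s_fin: "s < \<infinity>"
begin

text \<open>
  With bounded noise a path that starts at \<open>x \<ge> 0\<close> has all its coordinates above some \<open>- B\<close>, and one that starts at
  \<open>x \<le> 0\<close> below \<open>B\<close>; on both orthants \<open>F\<close> has an affine minorant. The spread of a convex scheme serves as a bound for
  smaller spreads.
\<close>

lemma dir_neg_part:
  assumes l: "lipschitz_scheme n \<mu> \<rho>" and U: "independent_start M G n U" "integrable M U"
    and c: "convex_scheme n s \<mu>' \<rho>'" and drift: "\<And>k. k < n \<Longrightarrow> \<mu> k = \<mu>' k"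
    and spread: "\<And>k x. k < n \<Longrightarrow> \<bar>\<rho> k x\<bar> \<le> \<bar>\<rho>' k x\<bar>"
  shows "neg_part_integrable M (\<lambda>\<omega>. F (flow \<mu> \<rho> (U \<omega>) (noise \<omega>)))"
proof -
  obtain S where S: "s = ereal S" "0 \<le> S" using s_fin s_nonneg by (cases s) auto
  have "\<exists>B\<ge>0. \<forall>x g i. i \<le> n \<longrightarrow> (0 \<le> x \<longrightarrow> - B \<le> flow \<mu> \<rho> x g i) \<and> (x \<le> 0 \<longrightarrow> flow \<mu> \<rho> x g i \<le> B)"
  proof (rule path_seq_one_sided[where \<eta> = "\<lambda>k x. \<bar>\<rho>' k x\<bar>" and S = S])
    fix k and x y :: real assume k: "k < n" and xy: "x \<le> y"
    have "\<bar>\<rho>' k y - \<rho>' k x\<bar> * S \<le> \<mu> k y - \<mu> k x"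
      using convex_step_increment[OF convex_schemeD[OF c k] xy, of S] S drift[OF k] by simp
    moreover have "\<bar>\<rho>' k y\<bar> * S \<le> (\<bar>\<rho>' k x\<bar> + \<bar>\<rho>' k y - \<rho>' k x\<bar>) * S"
      "\<bar>\<rho>' k x\<bar> * S \<le> (\<bar>\<rho>' k y\<bar> + \<bar>\<rho>' k y - \<rho>' k x\<bar>) * S"
      using S by (intro mult_right_mono; simp)+
    ultimately show "\<mu> k x - \<bar>\<rho>' k x\<bar> * S \<le> \<mu> k y - \<bar>\<rho>' k y\<bar> * S \<and> \<mu> k x + \<bar>\<rho>' k x\<bar> * S \<le> \<mu> k y + \<bar>\<rho>' k y\<bar> * S"
      by (simp add: distrib_right)
  next
    show "\<bar>\<rho> k x\<bar> \<le> \<bar>\<rho>' k x\<bar>" if "k < n" for k x by (rule spread[OF that])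
  next
    show "\<bar>truncate s g\<bar> \<le> S" for g using truncate_bounded[of s \<infinity> S g] S by simp
  qed
  then obtain B where B: "\<And>x g i. i \<le> n \<Longrightarrow> 0 \<le> x \<Longrightarrow> - B \<le> flow \<mu> \<rho> x g i"
    "\<And>x g i. i \<le> n \<Longrightarrow> x \<le> 0 \<Longrightarrow> flow \<mu> \<rho> x g i \<le> B" by blast
  obtain c where c: "\<And>x. (\<forall>i\<le>n. - B \<le> x i) \<or> (\<forall>i\<le>n. x i \<le> B) \<Longrightarrow> - c * (1 + (\<Sum>i\<le>n. \<bar>x i\<bar>)) \<le> F x"
    using dirconvex_orthant_minorant[where f = F and m = n and a = "- B" and b = B, OF _ _ dep] F
    unfolding dir_class_def by blast
  show ?thesis
  proof (rule neg_part_integrable_linear_growth[OF l U])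
    show "- c * (1 + (\<Sum>i\<le>n. \<bar>flow \<mu> \<rho> (U \<omega>) (noise \<omega>) i\<bar>)) \<le> F (flow \<mu> \<rho> (U \<omega>) (noise \<omega>))" for \<omega>
      by (rule c) (use B in \<open>cases "0 \<le> U \<omega>"; simp\<close>)
  qed
qed

lemma dir_comparison:
  assumes l: "lipschitz_scheme n \<mu> \<rho>" "lipschitz_scheme n \<mu>' \<rho>'"
    and U: "independent_start M G n U" "integrable M U" and V: "independent_start M G n V"
    and ord: "\<And>\<psi>. convex_on UNIV \<psi> \<Longrightarrow> ext_expectation M (\<lambda>\<omega>. \<psi> (U \<omega>)) \<le> ext_expectation M (\<lambda>\<omega>. \<psi> (V \<omega>))"
    and drift: "\<And>k. k < n \<Longrightarrow> \<mu> k = \<mu>' k" and aff: "\<And>k. k < n \<Longrightarrow> \<exists>a b. \<forall>x. \<mu> k x = a + b * x"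
    and spread: "\<And>k x. k < n \<Longrightarrow> \<bar>\<rho> k x\<bar> \<le> \<bar>\<rho>' k x\<bar>"
    and c: "convex_scheme n s \<mu> \<rho> \<or> convex_scheme n s \<mu>' \<rho>'"
  shows "ext_expectation M (\<lambda>\<omega>. F (flow \<mu> \<rho> (U \<omega>) (noise \<omega>))) \<le> ext_expectation M (\<lambda>\<omega>. F (flow \<mu>' \<rho>' (V \<omega>) (noise \<omega>)))"
    "ext_expectation M (\<lambda>\<omega>. F (flow \<mu> \<rho> (U \<omega>) (noise \<omega>))) \<noteq> - \<infinity>"
proof -
  have t: "tame n F" using F by (simp add: dir_class_def)
  note r = level_infinite[OF s_fin]
  have aff': "\<exists>a b. \<forall>x. \<mu>' k x = a + b * x" if "k < n" for k using aff[OF that] drift[OF that] by simp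
  have neg: "neg_part_integrable M (\<lambda>\<omega>. F (flow \<mu> \<rho> (U \<omega>) (noise \<omega>)))"
    using c
  proof
    assume "convex_scheme n s \<mu> \<rho>"
    then show ?thesis by (rule dir_neg_part[OF l(1) U]) auto
  next
    assume "convex_scheme n s \<mu>' \<rho>'"
    then show ?thesis by (rule dir_neg_part[OF l(1) U _ drift spread])
  qed
  then show "ext_expectation M (\<lambda>\<omega>. F (flow \<mu> \<rho> (U \<omega>) (noise \<omega>))) \<noteq> - \<infinity>" by (rule ext_expectation_not_minf)
  have "ext_expectation M (\<lambda>\<omega>. F (flow \<mu> \<rho> (U \<omega>) (noise \<omega>)) * windows \<infinity> n (noise \<omega>))
    \<le> ext_expectation M (\<lambda>\<omega>. F (flow \<mu>' \<rho>' (V \<omega>) (noise \<omega>)) * windows \<infinity> n (noise \<omega>))"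
  proof (rule windowed_comparison[OF r t l U(1) V _ _ neg])
    show "windowed_mean \<mu> \<rho> \<infinity> F x \<le> windowed_mean \<mu>' \<rho>' \<infinity> F x" for x
    proof (rule windowed_mean_compare[where C = dir_class, OF r l _ F dir_class_ray_convex _ spread])
      show "(\<forall>k<n. \<forall>F. dir_class F \<longrightarrow> dir_class (stein_noise.kernel (truncated_gauss s \<infinity>) (\<mu> k) (\<rho> k) k F)) \<or>
        (\<forall>k<n. \<forall>F. dir_class F \<longrightarrow> dir_class (stein_noise.kernel (truncated_gauss s \<infinity>) (\<mu>' k) (\<rho>' k) k F))"
        using c dir_class_stable[OF r l(1) _ aff] dir_class_stable[OF r l(2) _ aff'] by blast
    qed (use drift in \<open>auto simp: dir_class_def\<close>)
    show "ext_expectation M (\<lambda>\<omega>. windowed_mean \<mu> \<rho> \<infinity> F (U \<omega>)) \<le> ext_expectation M (\<lambda>\<omega>. windowed_mean \<mu> \<rho> \<infinity> F (V \<omega>))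
      \<or> ext_expectation M (\<lambda>\<omega>. windowed_mean \<mu>' \<rho>' \<infinity> F (U \<omega>)) \<le> ext_expectation M (\<lambda>\<omega>. windowed_mean \<mu>' \<rho>' \<infinity> F (V \<omega>))"
      using c
    proof
      assume "convex_scheme n s \<mu> \<rho>"
      then show ?thesis using windowed_mean_dir[OF r l(1) _ aff F] by (intro disjI1 ord)
    next
      assume "convex_scheme n s \<mu>' \<rho>'"
      then show ?thesis using windowed_mean_dir[OF r l(2) _ aff' F] by (intro disjI2 ord)
    qed
  qed
  then show "ext_expectation M (\<lambda>\<omega>. F (flow \<mu> \<rho> (U \<omega>) (noise \<omega>))) \<le> ext_expectation M (\<lambda>\<omega>. F (flow \<mu>' \<rho>' (V \<omega>) (noise \<omega>)))"
    by (simp add: windows_infinite)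
qed

lemma dir_mean:
  assumes l: "lipschitz_scheme n \<mu> \<rho>" and c: "convex_scheme n s \<mu> \<rho>"
    and aff: "\<And>k. k < n \<Longrightarrow> \<exists>a b. \<forall>x. \<mu> k x = a + b * x"
  shows "neg_part_integrable M (\<lambda>\<omega>. F (flow \<mu> \<rho> x (noise \<omega>)))"
    "convex_ext (\<lambda>x. ext_expectation M (\<lambda>\<omega>. F (flow \<mu> \<rho> x (noise \<omega>))))"
proof -
  have t: "tame n F" using F by (simp add: dir_class_def)
  note r = level_infinite[OF s_fin]
  have E: "ext_expectation M (\<lambda>\<omega>. F (flow \<mu> \<rho> x (noise \<omega>))) = ereal (windowed_mean \<mu> \<rho> \<infinity> F x)" for x
    using windowed_mean_constant_start(1)[OF r t l, of x] by (simp add: windows_infinite)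
  show "neg_part_integrable M (\<lambda>\<omega>. F (flow \<mu> \<rho> x (noise \<omega>)))"
    using windowed_mean_constant_start(2)[OF r t l, of x]
    by (intro neg_part_integrable_minorant[where h = "\<lambda>\<omega>. F (flow \<mu> \<rho> x (noise \<omega>))"]) (simp_all add: windows_infinite)
  show "convex_ext (\<lambda>x. ext_expectation M (\<lambda>\<omega>. F (flow \<mu> \<rho> x (noise \<omega>))))"
    unfolding convex_ext_def E
    using convex_onD[OF windowed_mean_dir[OF r l c aff F]] by simp
qed

end

section \<open>Affine schemes with unbounded noise\<close>

lemma convex_on_max_const:
  fixes f :: "real \<Rightarrow> real"
  assumes "convex_on UNIV f"
  shows "convex_on UNIV (\<lambda>x. max (f x) c + d)"
proof (rule convex_onI)
  fix t x y :: real assume t: "0 < t" "t < 1"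
  have "f ((1 - t) *\<^sub>R x + t *\<^sub>R y) \<le> (1 - t) * f x + t * f y" using convex_onD[OF assms] t by simp
  also have "\<dots> \<le> (1 - t) * max (f x) c + t * max (f y) c"
    using t by (intro add_mono mult_left_mono) auto
  finally have 1: "f ((1 - t) *\<^sub>R x + t *\<^sub>R y) \<le> (1 - t) * max (f x) c + t * max (f y) c" .
  have "c = (1 - t) * c + t * c" by (simp add: algebra_simps)
  also have "\<dots> \<le> (1 - t) * max (f x) c + t * max (f y) c"
    using t by (intro add_mono mult_left_mono) auto
  finally have "max (f ((1 - t) *\<^sub>R x + t *\<^sub>R y)) c \<le> (1 - t) * max (f x) c + t * max (f y) c"
    using 1 by simp
  then show "max (f ((1 - t) *\<^sub>R x + t *\<^sub>R y)) c + d \<le> (1 - t) * (max (f x) c + d) + t * (max (f y) c + d)"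
    by (simp add: algebra_simps)
qed simp

lemma ray_class_truncate:
  assumes "ray_class F"
  shows "ray_class (\<lambda>x. max (F x) c + d)"
proof -
  have t: "tame n F" and r: "ray_convex F" using assms by (auto simp: ray_class_def)
  note [measurable] = tameD_measurable[OF t]
  have "tame n (\<lambda>x. max (F x) c + d)"
    unfolding tame_def
  proof (intro conjI allI)
    show "(\<lambda>x. max (F x) c + d) \<in> borel_measurable (PiM UNIV (\<lambda>_. borel))" by measurable
    fix R :: real
    obtain C where C: "\<And>x. (\<And>i. i \<le> n \<Longrightarrow> \<bar>x i\<bar> \<le> R) \<Longrightarrow> \<bar>F x\<bar> \<le> C" using tameD_bounded[OF t] by blast
    have "\<bar>max (F x) c + d\<bar> \<le> C + \<bar>c\<bar> + \<bar>d\<bar>" if "\<forall>i\<le>n. \<bar>x i\<bar> \<le> R" for x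
      using C[of x] that by (simp add: max_def) linarith
    then show "\<exists>C. \<forall>x. (\<forall>i\<le>n. \<bar>x i\<bar> \<le> R) \<longrightarrow> \<bar>max (F x) c + d\<bar> \<le> C" by blast
  qed
  moreover have "ray_convex (\<lambda>x. max (F x) c + d)"
    using r unfolding ray_convex_def by (auto intro: convex_on_max_const)
  ultimately show ?thesis by (simp add: ray_class_def)
qed

text \<open>
  Nonnegative functionals satisfy the comparison whatever the size of their means, by growing windows.
\<close>

lemma ray_comparison_nonneg:
  assumes F: "ray_class F" and F0: "\<And>x. 0 \<le> F x"
    and l: "lipschitz_scheme n \<mu> \<rho>" "lipschitz_scheme n \<mu>' \<rho>'"
    and U: "independent_start M G n U" and V: "independent_start M G n V"
    and ord: "\<And>\<psi>. convex_on UNIV \<psi> \<Longrightarrow> ext_expectation M (\<lambda>\<omega>. \<psi> (U \<omega>)) \<le> ext_expectation M (\<lambda>\<omega>. \<psi> (V \<omega>))"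
    and drift: "\<And>k. k < n \<Longrightarrow> \<mu> k = \<mu>' k" and aff: "affine_increasing \<mu>"
    and spread: "\<And>k x. k < n \<Longrightarrow> \<bar>\<rho> k x\<bar> \<le> \<bar>\<rho>' k x\<bar>"
    and c: "constant_spread \<rho> \<or> constant_spread \<rho>'"
  shows "ext_expectation M (\<lambda>\<omega>. F (flow \<mu> \<rho> (U \<omega>) (noise \<omega>))) \<le> ext_expectation M (\<lambda>\<omega>. F (flow \<mu>' \<rho>' (V \<omega>) (noise \<omega>)))"
proof (rule LIMSEQ_le)
  have t: "tame n F" using F by (simp add: ray_class_def)
  have aff': "affine_increasing \<mu>'" using aff drift by (simp add: affine_increasing_def)
  have neg: "neg_part_integrable M (\<lambda>\<omega>. F (f \<omega>))" for f :: "'w \<Rightarrow> nat \<Rightarrow> real"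
    by (rule neg_part_integrable_minorant[of _ "\<lambda>_. 0"]) (auto simp: F0)
  show "(\<lambda>N. ext_expectation M (\<lambda>\<omega>. F (flow \<mu> \<rho> (U \<omega>) (noise \<omega>)) * windows (ereal (real N)) n (noise \<omega>)))
    \<longlonglongrightarrow> ext_expectation M (\<lambda>\<omega>. F (flow \<mu> \<rho> (U \<omega>) (noise \<omega>)))"
    by (rule window_limit[OF t l(1) U neg])
  show "(\<lambda>N. ext_expectation M (\<lambda>\<omega>. F (flow \<mu>' \<rho>' (V \<omega>) (noise \<omega>)) * windows (ereal (real N)) n (noise \<omega>)))
    \<longlonglongrightarrow> ext_expectation M (\<lambda>\<omega>. F (flow \<mu>' \<rho>' (V \<omega>) (noise \<omega>)))"
    by (rule window_limit[OF t l(2) V neg])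
  have "ext_expectation M (\<lambda>\<omega>. F (flow \<mu> \<rho> (U \<omega>) (noise \<omega>)) * windows (ereal (real N)) n (noise \<omega>))
    \<le> ext_expectation M (\<lambda>\<omega>. F (flow \<mu>' \<rho>' (V \<omega>) (noise \<omega>)) * windows (ereal (real N)) n (noise \<omega>))" for N
  proof (rule windowed_comparison[OF level_nat t l U V _ _ neg])
    show "windowed_mean \<mu> \<rho> (ereal (real N)) F x \<le> windowed_mean \<mu>' \<rho>' (ereal (real N)) F x" for x
    proof (rule windowed_mean_compare[where C = ray_class, OF level_nat l _ F _ _ spread])
      show "(\<forall>k<n. \<forall>F. ray_class F \<longrightarrow> ray_class (stein_noise.kernel (truncated_gauss s (ereal (real N))) (\<mu> k) (\<rho> k) k F)) \<or>
        (\<forall>k<n. \<forall>F. ray_class F \<longrightarrow> ray_class (stein_noise.kernel (truncated_gauss s (ereal (real N))) (\<mu>' k) (\<rho>' k) k F))"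
        using c ray_class_stable'[OF level_nat l(1) aff] ray_class_stable'[OF level_nat l(2) aff'] by blast
    qed (use drift in \<open>auto simp: ray_class_def\<close>)
    show "ext_expectation M (\<lambda>\<omega>. windowed_mean \<mu> \<rho> (ereal (real N)) F (U \<omega>)) \<le> ext_expectation M (\<lambda>\<omega>. windowed_mean \<mu> \<rho> (ereal (real N)) F (V \<omega>))
      \<or> ext_expectation M (\<lambda>\<omega>. windowed_mean \<mu>' \<rho>' (ereal (real N)) F (U \<omega>)) \<le> ext_expectation M (\<lambda>\<omega>. windowed_mean \<mu>' \<rho>' (ereal (real N)) F (V \<omega>))"
      using c
    proof
      assume "constant_spread \<rho>"
      then show ?thesis using windowed_mean_ray[OF level_nat l(1) aff _ F] by (intro disjI1 ord)
    next
      assume "constant_spread \<rho>'"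
      then show ?thesis using windowed_mean_ray[OF level_nat l(2) aff' _ F] by (intro disjI2 ord)
    qed
  qed
  then show "\<exists>N0. \<forall>N\<ge>N0. ext_expectation M (\<lambda>\<omega>. F (flow \<mu> \<rho> (U \<omega>) (noise \<omega>)) * windows (ereal (real N)) n (noise \<omega>))
    \<le> ext_expectation M (\<lambda>\<omega>. F (flow \<mu>' \<rho>' (V \<omega>) (noise \<omega>)) * windows (ereal (real N)) n (noise \<omega>))"
    by blast
qed

text \<open>
  The functionals \<open>max F (- N) + N\<close> stay in the class and are nonnegative.
\<close>

lemma ray_comparison:
  assumes F: "ray_class F"
    and l: "lipschitz_scheme n \<mu> \<rho>" "lipschitz_scheme n \<mu>' \<rho>'"
    and U: "independent_start M G n U" and V: "independent_start M G n V"
    and ord: "\<And>\<psi>. convex_on UNIV \<psi> \<Longrightarrow> ext_expectation M (\<lambda>\<omega>. \<psi> (U \<omega>)) \<le> ext_expectation M (\<lambda>\<omega>. \<psi> (V \<omega>))"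
    and drift: "\<And>k. k < n \<Longrightarrow> \<mu> k = \<mu>' k" and aff: "affine_increasing \<mu>"
    and spread: "\<And>k x. k < n \<Longrightarrow> \<bar>\<rho> k x\<bar> \<le> \<bar>\<rho>' k x\<bar>"
    and c: "constant_spread \<rho> \<or> constant_spread \<rho>'"
  shows "ext_expectation M (\<lambda>\<omega>. F (flow \<mu> \<rho> (U \<omega>) (noise \<omega>))) \<le> ext_expectation M (\<lambda>\<omega>. F (flow \<mu>' \<rho>' (V \<omega>) (noise \<omega>)))"
proof (rule ext_expectation_le_if_truncations_le[OF prob_space_axioms])
  have t: "tame n F" using F by (simp add: ray_class_def)
  show "(\<lambda>\<omega>. F (flow \<mu> \<rho> (U \<omega>) (noise \<omega>))) \<in> borel_measurable M" by (rule flow_random_measurable[OF t l(1) U])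
  show "(\<lambda>\<omega>. F (flow \<mu>' \<rho>' (V \<omega>) (noise \<omega>))) \<in> borel_measurable M" by (rule flow_random_measurable[OF t l(2) V])
  fix N :: nat
  have 0: "0 \<le> max (F x) (- real N) + real N" for x by simp
  show "(\<integral>\<^sup>+ \<omega>. ennreal (max (F (flow \<mu> \<rho> (U \<omega>) (noise \<omega>))) (- real N) + real N) \<partial>M)
      \<le> (\<integral>\<^sup>+ \<omega>. ennreal (max (F (flow \<mu>' \<rho>' (V \<omega>) (noise \<omega>))) (- real N) + real N) \<partial>M)"
    using ray_comparison_nonneg[OF ray_class_truncate[OF F, of "- real N" "real N"] 0 l U V ord drift aff spread c]
    unfolding ext_expectation_nonneg[OF 0] by (simp add: less_eq_ennreal.rep_eq)
qed

lemma path_seq_zero_spread: "path_seq \<mu> (\<lambda>_ _. 0) t x g k = path_seq \<mu> (\<lambda>_ _. 0) t x g' k"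
  by (induction k) auto

text \<open>
  Without noise the path is an affine function of the start, so \<open>F\<close> of it is convex in the start and dominates an affine
  function of \<open>U\<close>; adding noise only increases the expectation.
\<close>

lemma ray_not_minf:
  assumes F: "ray_class F" and l: "lipschitz_scheme n \<mu> \<rho>" and U: "independent_start M G n U" "integrable M U"
    and aff: "affine_increasing \<mu>"
  shows "ext_expectation M (\<lambda>\<omega>. F (flow \<mu> \<rho> (U \<omega>) (noise \<omega>))) \<noteq> - \<infinity>"
proof -
  let ?z = "\<lambda>_ _. 0 :: real"
  have lz: "lipschitz_scheme n \<mu> ?z" using l unfolding lipschitz_scheme_def by (auto intro: order_trans[OF abs_ge_zero])
  obtain a b where ab: "\<And>k. k < n \<Longrightarrow> 0 \<le> b k" "\<And>k. k < n \<Longrightarrow> \<mu> k = (\<lambda>x. a k + b k * x)"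
    using aff unfolding affine_increasing_def by metis
  have "\<exists>p q. (\<forall>i. 0 \<le> q i) \<and> (\<forall>t. flow \<mu> ?z t (\<lambda>_. 0) = (\<lambda>i. p i + t * q i))"
    by (rule path_seq_affine[where a = a and c = b and d = "\<lambda>_. 0"]) (use ab in auto)
  then obtain p q where pq: "\<forall>i. 0 \<le> q i" "\<And>t. flow \<mu> ?z t (\<lambda>_. 0) = (\<lambda>i. p i + t * q i)" by blast
  have "convex_on UNIV (\<lambda>t. F (\<lambda>i. p i + t * q i))"
    using F pq(1) unfolding ray_class_def ray_convex_def by blast
  then obtain c where c: "\<And>t. - c * (1 + \<bar>t\<bar>) \<le> F (\<lambda>i. p i + t * q i)"
    using convex_on_UNIV_affine_minorant by blast
  have "neg_part_integrable M (\<lambda>\<omega>. F (flow \<mu> ?z (U \<omega>) (noise \<omega>)))"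
  proof (rule neg_part_integrable_minorant)
    show "integrable M (\<lambda>\<omega>. - c * (1 + \<bar>U \<omega>\<bar>))" using U(2) by simp
    show "- c * (1 + \<bar>U \<omega>\<bar>) \<le> F (flow \<mu> ?z (U \<omega>) (noise \<omega>))" for \<omega>
      using c[of "U \<omega>"] by (simp only: path_seq_zero_spread[of \<mu> s _ "noise \<omega>" n "\<lambda>_. 0"] pq(2))
  qed
  then have "ext_expectation M (\<lambda>\<omega>. F (flow \<mu> ?z (U \<omega>) (noise \<omega>))) \<noteq> - \<infinity>" by (rule ext_expectation_not_minf)
  moreover have "ext_expectation M (\<lambda>\<omega>. F (flow \<mu> ?z (U \<omega>) (noise \<omega>))) \<le> ext_expectation M (\<lambda>\<omega>. F (flow \<mu> \<rho> (U \<omega>) (noise \<omega>)))"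
    by (rule ray_comparison[OF F lz l U(1) U(1) _ _ aff]) (auto simp: constant_spread_def)
  ultimately show ?thesis by auto
qed

text \<open>
  For each value of the noise the path is affine in the start with nonnegative slopes, hence \<open>F\<close> of it is convex. The
  inequality is integrated when both endpoints have finite value, and is trivial otherwise.
\<close>

lemma ray_mean_convex:
  assumes F: "ray_class F" and l: "lipschitz_scheme n \<mu> \<rho>" and aff: "affine_increasing \<mu>" and c: "constant_spread \<rho>"
  shows "convex_ext (\<lambda>x. ext_expectation M (\<lambda>\<omega>. F (flow \<mu> \<rho> x (noise \<omega>))))"
proof -
  have t: "tame n F" using F by (simp add: ray_class_def)
  define \<phi> where "\<phi> = (\<lambda>x. ext_expectation M (\<lambda>\<omega>. F (flow \<mu> \<rho> x (noise \<omega>))))"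
  have fin: "\<phi> x \<noteq> - \<infinity>" for x
    unfolding \<phi>_def using ray_not_minf[OF F l independent_start_constant[of x] _ aff] by simp
  obtain a b where ab: "\<And>k. k < n \<Longrightarrow> 0 \<le> b k" "\<And>k. k < n \<Longrightarrow> \<mu> k = (\<lambda>x. a k + b k * x)"
    using aff unfolding affine_increasing_def by metis
  obtain d where d: "\<And>k x. k < n \<Longrightarrow> \<rho> k x = d k"
    using c unfolding constant_spread_def by metis
  have conv: "convex_on UNIV (\<lambda>x. F (flow \<mu> \<rho> x g))" for g
  proof -
    have "\<exists>p q. (\<forall>i. 0 \<le> q i) \<and> (\<forall>t. flow \<mu> \<rho> t g = (\<lambda>i. p i + t * q i))"
      by (rule path_seq_affine[where a = a and c = b and d = d]) (use ab d in auto)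
    then obtain p q where pq: "\<forall>i. 0 \<le> q i" "\<And>t. flow \<mu> \<rho> t g = (\<lambda>i. p i + t * q i)" by blast
    show ?thesis unfolding pq(2) using F pq(1) unfolding ray_class_def ray_convex_def by blast
  qed
  have meas: "(\<lambda>\<omega>. F (flow \<mu> \<rho> x (noise \<omega>))) \<in> borel_measurable M" for x
    by (rule flow_random_measurable[OF t l independent_start_constant])
  have int: "integrable M (\<lambda>\<omega>. F (flow \<mu> \<rho> x (noise \<omega>)))" if "\<phi> x \<noteq> \<infinity>" for x
  proof -
    have "(\<integral>\<^sup>+ \<omega>. ennreal (F (flow \<mu> \<rho> x (noise \<omega>))) \<partial>M) \<noteq> \<infinity>"
      using that ext_expectation_infinite[where f = "\<lambda>\<omega>. F (flow \<mu> \<rho> x (noise \<omega>))" and M = M]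
      unfolding \<phi>_def by blast
    moreover have "(\<integral>\<^sup>+ \<omega>. ennreal (- F (flow \<mu> \<rho> x (noise \<omega>))) \<partial>M) \<noteq> \<infinity>"
      using fin[of x] calculation unfolding \<phi>_def ext_expectation_def
      by (cases "\<integral>\<^sup>+ \<omega>. ennreal (F (flow \<mu> \<rho> x (noise \<omega>))) \<partial>M" rule: ennreal_cases) auto
    ultimately show ?thesis using meas by (simp add: real_integrable_def)
  qed
  have "\<phi> ((1 - u) * x + u * y) \<le> ereal (1 - u) * \<phi> x + ereal u * \<phi> y" if u: "0 \<le> u" "u \<le> 1" for x y u
  proof (cases "u = 0 \<or> u = 1")
    case True
    then show ?thesis by (auto simp: zero_ereal_def[symmetric] one_ereal_def[symmetric])
  next
    case False
    then have u': "0 < u" "u < 1" using u by auto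
    show ?thesis
    proof (cases "\<phi> x = \<infinity> \<or> \<phi> y = \<infinity>")
      case True
      then have "ereal (1 - u) * \<phi> x + ereal u * \<phi> y = \<infinity>"
        using u' fin[of x] fin[of y] by (cases "\<phi> x"; cases "\<phi> y") auto
      then show ?thesis by (simp only: ereal_less_eq(1))
    next
      case False
      then have I: "integrable M (\<lambda>\<omega>. F (flow \<mu> \<rho> x (noise \<omega>)))" "integrable M (\<lambda>\<omega>. F (flow \<mu> \<rho> y (noise \<omega>)))"
        using int by auto
      then have I2: "integrable M (\<lambda>\<omega>. (1 - u) * F (flow \<mu> \<rho> x (noise \<omega>)) + u * F (flow \<mu> \<rho> y (noise \<omega>)))" by simp
      have "\<phi> ((1 - u) * x + u * y) \<le> ext_expectation M (\<lambda>\<omega>. (1 - u) * F (flow \<mu> \<rho> x (noise \<omega>)) + u * F (flow \<mu> \<rho> y (noise \<omega>)))"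
        unfolding \<phi>_def using convex_onD[OF conv u, of x y] by (intro ext_expectation_mono) simp
      also have "\<dots> = ereal (1 - u) * \<phi> x + ereal u * \<phi> y"
        unfolding \<phi>_def ext_expectation_integrable[OF I2] ext_expectation_integrable[OF I(1)] ext_expectation_integrable[OF I(2)]
        using I by simp
      finally show ?thesis .
    qed
  qed
  then show ?thesis using fin unfolding convex_ext_def \<phi>_def by blast
qed

end

section \<open>The truncated Euler schemes\<close>

lemma path_seq_euler:
  "path_seq (drift_map ch T m b) (spread ch T m \<sigma>) s (\<lambda>_. x) g n i = (if i \<le> n then euler ch T m s b \<sigma> g x i else x)"
  by (induction n arbitrary: i) (auto simp: drift_map_def spread_def le_Suc_eq)

lemma euler_lipschitz_scheme:
  assumes T: "0 < T" and m: "0 < m" and b: "regular_coeff T b" and \<sigma>: "regular_coeff T \<sigma>"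
  shows "lipschitz_scheme m (drift_map ch T m b) (spread ch T m \<sigma>)"
proof -
  obtain Lb where "lip_const T b = ereal Lb" and Lb: "0 \<le> Lb" "\<And>t x y. t \<in> {0..T} \<Longrightarrow> \<bar>b t x - b t y\<bar> \<le> Lb * \<bar>x - y\<bar>"
    using that by (rule regular_coeffE[OF b T])
  obtain Ls where "lip_const T \<sigma> = ereal Ls" and Ls: "0 \<le> Ls" "\<And>t x y. t \<in> {0..T} \<Longrightarrow> \<bar>\<sigma> t x - \<sigma> t y\<bar> \<le> Ls * \<bar>x - y\<bar>"
    using that by (rule regular_coeffE[OF \<sigma> T])
  define h where "h = T / real m"
  have h: "0 < h" using T m by (simp add: h_def)
  define K where "K = 1 + h * Lb + sqrt h * Ls"
  have K: "1 + h * Lb \<le> K" "sqrt h * Ls \<le> K" "0 \<le> K" using h Lb Ls by (auto simp: K_def)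
  have "\<bar>drift_map ch T m b k x - drift_map ch T m b k y\<bar> \<le> K * \<bar>x - y\<bar> \<and> \<bar>spread ch T m \<sigma> k x - spread ch T m \<sigma> k y\<bar> \<le> K * \<bar>x - y\<bar>"
    if k: "k < m" for k x y
  proof
    have "\<bar>h * (drift_coeff ch T m b k x - drift_coeff ch T m b k y)\<bar> \<le> h * (Lb * \<bar>x - y\<bar>)"
      unfolding abs_mult using coefficient_lipschitz(1)[OF T m k b Lb(2,1)] h by (intro mult_mono) auto
    moreover have "drift_map ch T m b k x - drift_map ch T m b k y
       = (x - y) + h * (drift_coeff ch T m b k x - drift_coeff ch T m b k y)"
      by (simp add: drift_map_def h_def algebra_simps)
    ultimately have "\<bar>drift_map ch T m b k x - drift_map ch T m b k y\<bar> \<le> (1 + h * Lb) * \<bar>x - y\<bar>"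
      by (simp add: distrib_right)
    also have "\<dots> \<le> K * \<bar>x - y\<bar>" using K by (intro mult_right_mono) auto
    finally show "\<bar>drift_map ch T m b k x - drift_map ch T m b k y\<bar> \<le> K * \<bar>x - y\<bar>" .
    have "\<bar>sqrt h * (diffusion_coeff ch T m \<sigma> k x - diffusion_coeff ch T m \<sigma> k y)\<bar> \<le> sqrt h * (Ls * \<bar>x - y\<bar>)"
      unfolding abs_mult using coefficient_lipschitz(2)[OF T m k \<sigma> Ls(2,1)] h by (intro mult_mono) auto
    also have "\<dots> \<le> K * \<bar>x - y\<bar>" using mult_right_mono[OF K(2), of "\<bar>x - y\<bar>"] by simp
    finally show "\<bar>spread ch T m \<sigma> k x - spread ch T m \<sigma> k y\<bar> \<le> K * \<bar>x - y\<bar>"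
      by (simp add: spread_def h_def right_diff_distrib)
  qed
  then show ?thesis unfolding lipschitz_scheme_def using K(3) by blast
qed

lemma euler_convex_scheme:
  assumes "0 < T" "0 < m" "regular_coeff T b" "regular_coeff T \<sigma>" "cond_conv T b \<sigma>" "admissible T m s b \<sigma>"
  shows "convex_scheme m s (drift_map ch T m b) (spread ch T m \<sigma>)"
  using euler_convex_step[OF assms(1,2) _ assms(3-6)] by (simp add: convex_scheme_def)

lemma drift_map_mono_coeff:
  assumes "0 < T" "0 < m" "k < m" "regular_coeff T b" "regular_coeff T \<beta>" "\<And>t. t \<in> {0..T} \<Longrightarrow> b t x \<le> \<beta> t x"
  shows "drift_map ch T m b k x \<le> drift_map ch T m \<beta> k x"
proof -
  have "drift_coeff ch T m b k x \<le> drift_coeff ch T m \<beta> k x" by (rule coefficient_mono(1)[OF assms])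
  then show ?thesis using assms(1) by (simp add: drift_map_def mult_left_mono divide_right_mono)
qed

lemma spread_mono_coeff:
  assumes "0 < T" "0 < m" "k < m" "regular_coeff T \<sigma>" "regular_coeff T \<theta>" "\<And>t. t \<in> {0..T} \<Longrightarrow> \<bar>\<sigma> t x\<bar> \<le> \<bar>\<theta> t x\<bar>"
  shows "\<bar>spread ch T m \<sigma> k x\<bar> \<le> \<bar>spread ch T m \<theta> k x\<bar>"
proof -
  have "\<bar>diffusion_coeff ch T m \<sigma> k x\<bar> \<le> \<bar>diffusion_coeff ch T m \<theta> k x\<bar>" by (rule coefficient_mono(2)[OF assms])
  then show ?thesis using assms(1) by (simp add: spread_def abs_mult mult_left_mono)
qed

text \<open>The upper bound imposed on the truncation level is infinite only if \<open>Lip \<sigma> = 0\<close>.\<close>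

lemma infinite_level_constant_spread:
  assumes T: "0 < T" and m: "0 < m" and \<sigma>: "regular_coeff T \<sigma>" and adm: "admissible T m \<infinity> b \<sigma>" and k: "k < m"
  shows "spread ch T m \<sigma> k x = spread ch T m \<sigma> k 0"
proof -
  obtain L where L: "lip_const T \<sigma> = ereal L" "0 \<le> L" "\<And>t x y. t \<in> {0..T} \<Longrightarrow> \<bar>\<sigma> t x - \<sigma> t y\<bar> \<le> L * \<bar>x - y\<bar>"
    using that by (rule regular_coeffE[OF \<sigma> T])
  have h: "0 < sqrt (T / real m)" using T m by simp
  have "L = 0"
  proof (rule ccontr)
    assume "L \<noteq> 0"
    then have Lp: "L > 0" using L(2) by simp
    have "\<bar>1 / (L * sqrt (T / real m))\<bar> * L * sqrt (T / real m) \<le> 1 / 2"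
      by (rule noise_level_bound[OF T m L(1,2) adm]) simp
    then show False using Lp h T m by (simp add: abs_of_pos)
  qed
  then have "\<bar>diffusion_coeff ch T m \<sigma> k x - diffusion_coeff ch T m \<sigma> k 0\<bar> \<le> 0"
    using coefficient_lipschitz(2)[OF T m k \<sigma> L(3,2), of ch x 0] by simp
  then show ?thesis by (simp add: spread_def)
qed

theorem proposition4p6:
  fixes M :: "'w measure" and T :: real and m :: nat and s :: ereal and ch :: coeff_choice
    and b \<beta> \<sigma> \<theta> :: "real \<Rightarrow> real \<Rightarrow> real"
    and X0 Y0 :: "'w \<Rightarrow> real" and G :: "nat \<Rightarrow> 'w \<Rightarrow> real"
  assumes "prob_space M" and "T > 0" and "m > 0"
    and "\<And>k. k \<in> {1..m} \<Longrightarrow> distributed M lborel (G k) (\<lambda>x. ennreal (std_normal_density x))"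
    and "prob_space.indep_vars M (\<lambda>_. borel) G {1..m}"
    and "prob_space.indep_set M
           (sets (vimage_algebra (space M) (\<lambda>\<omega>. (X0 \<omega>, Y0 \<omega>)) (borel \<Otimes>\<^sub>M borel)))
           (sets (vimage_algebra (space M) (\<lambda>\<omega>. \<lambda>k\<in>{1..m}. G k \<omega>) (PiM {1..m} (\<lambda>_. borel))))"
    and "integrable M X0" and "integrable M Y0"
    and "regular_coeff T b" and "regular_coeff T \<beta>"
    and "regular_coeff T \<sigma>" and "regular_coeff T \<theta>"
    and "(cond_conv T b \<sigma> \<and> admissible T m s b \<sigma>) \<or> (cond_conv T \<beta> \<theta> \<and> admissible T m s \<beta> \<theta>)"
  shows
    \<comment> \<open>(a)\<close>
    "((\<forall>t\<in>{0..T}. \<forall>x. b t x \<le> \<beta> t x \<and> 0 \<le> \<sigma> t x \<and> \<sigma> t x \<le> \<theta> t x) \<and> le_icv M X0 Y0 \<longrightarrow>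
        le_diricv M (Suc m) (euler_path ch T m s b \<sigma> G X0) (euler_path ch T m s \<beta> \<theta> G Y0))
     \<and>
     (cond_conv T b \<sigma> \<and> admissible T m s b \<sigma> \<longrightarrow>
        (\<forall>f. dir_convex (Suc m) f \<and> nondecreasing_each (Suc m) f \<longrightarrow>
           (\<forall>x. neg_part_integrable M (\<lambda>\<omega>. f (euler_path ch T m s b \<sigma> G (\<lambda>_. x) \<omega>))) \<and>
           mono (\<lambda>x. ext_expectation M (\<lambda>\<omega>. f (euler_path ch T m s b \<sigma> G (\<lambda>_. x) \<omega>))) \<and>
           convex_ext (\<lambda>x. ext_expectation M (\<lambda>\<omega>. f (euler_path ch T m s b \<sigma> G (\<lambda>_. x) \<omega>)))))
     \<and>
     (cond_conv T \<beta> \<theta> \<and> admissible T m s \<beta> \<theta> \<longrightarrow>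
        (\<forall>f. dir_convex (Suc m) f \<and> nondecreasing_each (Suc m) f \<longrightarrow>
           (\<forall>y. neg_part_integrable M (\<lambda>\<omega>. f (euler_path ch T m s \<beta> \<theta> G (\<lambda>_. y) \<omega>))) \<and>
           mono (\<lambda>y. ext_expectation M (\<lambda>\<omega>. f (euler_path ch T m s \<beta> \<theta> G (\<lambda>_. y) \<omega>))) \<and>
           convex_ext (\<lambda>y. ext_expectation M (\<lambda>\<omega>. f (euler_path ch T m s \<beta> \<theta> G (\<lambda>_. y) \<omega>)))))
     \<and>
     \<comment> \<open>(b)\<close>
     (\<forall>lam mu :: real \<Rightarrow> real.
        lam \<in> borel_measurable (restrict_space borel {0..T}) \<and> bounded (lam ` {0..T}) \<and>
        mu \<in> borel_measurable (restrict_space borel {0..T}) \<and> bounded (mu ` {0..T}) \<and>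
        (\<forall>t\<in>{0..T}. \<forall>x. b t x = lam t + mu t * x \<and> \<beta> t x = lam t + mu t * x) \<longrightarrow>
        ((\<forall>t\<in>{0..T}. \<forall>x. 0 \<le> \<sigma> t x \<and> \<sigma> t x \<le> \<theta> t x) \<and> le_cvx M X0 Y0 \<longrightarrow>
           le_dircvx M (Suc m) (euler_path ch T m s b \<sigma> G X0) (euler_path ch T m s \<beta> \<theta> G Y0))
        \<and>
        (cond_conv T b \<sigma> \<and> admissible T m s b \<sigma> \<longrightarrow>
           (\<forall>f. dir_convex (Suc m) f \<longrightarrow>
              (s < \<infinity> \<longrightarrow>
                (\<forall>x. neg_part_integrable M (\<lambda>\<omega>. f (euler_path ch T m s b \<sigma> G (\<lambda>_. x) \<omega>)))) \<and>
              convex_ext (\<lambda>x. ext_expectation M (\<lambda>\<omega>. f (euler_path ch T m s b \<sigma> G (\<lambda>_. x) \<omega>)))))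
        \<and>
        (cond_conv T \<beta> \<theta> \<and> admissible T m s \<beta> \<theta> \<longrightarrow>
           (\<forall>f. dir_convex (Suc m) f \<longrightarrow>
              (s < \<infinity> \<longrightarrow>
                (\<forall>y. neg_part_integrable M (\<lambda>\<omega>. f (euler_path ch T m s \<beta> \<theta> G (\<lambda>_. y) \<omega>)))) \<and>
              convex_ext (\<lambda>y. ext_expectation M (\<lambda>\<omega>. f (euler_path ch T m s \<beta> \<theta> G (\<lambda>_. y) \<omega>))))))"
proof -
  note T = assms(2) and m = assms(3) and regs = assms(9-12)
  interpret prob_space M by (rule assms(1))
  have s0: "0 \<le> s" using assms(13) by (auto simp: admissible_def)
  interpret D: driven_scheme M m s G
    by standard (use assms(3-5) s0 in auto)
  let ?\<mu> = "drift_map ch T m" and ?\<rho> = "spread ch T m"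
  have [measurable]: "X0 \<in> borel_measurable M" "Y0 \<in> borel_measurable M" using assms(7,8) by auto
  have X0: "independent_start M G m X0"
    using independent_start_if_indep[OF assms(1,3,4,5,6), of fst] by simp
  have Y0: "independent_start M G m Y0"
    using independent_start_if_indep[OF assms(1,3,4,5,6), of snd] by simp
  have euler_flow: "euler ch T m s B S (\<lambda>j. G j \<omega>) x i = D.flow (?\<mu> B) (?\<rho> S) x (D.noise \<omega>) i" if "i \<le> m" for B S \<omega> x i
  proof -
    have "D.flow (?\<mu> B) (?\<rho> S) x (D.noise \<omega>) = D.flow (?\<mu> B) (?\<rho> S) x (\<lambda>j. G j \<omega>)"
      by (rule path_seq_cong) (simp add: D.noise_def)
    then show ?thesis using that by (simp add: path_seq_euler)
  qed
  have path: "f (euler_path ch T m s B S G U \<omega>) = cylinder (Suc m) f (D.flow (?\<mu> B) (?\<rho> S) (U \<omega>) (D.noise \<omega>))" for f B S U \<omega>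
    unfolding euler_path_def cylinder_def using euler_flow by (auto intro!: arg_cong[of _ _ f] restrict_ext)
  have path_int: "integrable M (\<lambda>\<omega>. euler_path ch T m s B S G U \<omega> i)"
    if "regular_coeff T B" "regular_coeff T S" "independent_start M G m U" "integrable M U" "i < Suc m" for B S U i
    using D.flow_integrable[OF euler_lipschitz_scheme[OF T m that(1,2)] that(3,4), of i ch] that(5)
    by (simp add: euler_path_def euler_flow)
  have inc: "D.inc_class (cylinder (Suc m) f)" if "dir_convex (Suc m) f" "nondecreasing_each (Suc m) f" for f
    using that by (simp add: D.inc_class_def tame_cylinder dirconvex_cylinder increasing_cylinder)
  have dir: "D.dir_class (cylinder (Suc m) f)" if "dir_convex (Suc m) f" for f
    using that by (simp add: D.dir_class_def tame_cylinder dirconvex_cylinder)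
  have ray: "D.ray_class (cylinder (Suc m) f)" if "dir_convex (Suc m) f" for f
    using D.dir_class_ray_convex[OF dir[OF that]] that by (simp add: D.ray_class_def tame_cylinder)
  note dep = cylinder_cong[of "Suc m"]
  note lip = euler_lipschitz_scheme[OF T m]
  have scheme: "convex_scheme m s (?\<mu> B) (?\<rho> S)" "\<forall>k<m. convex_on UNIV (?\<mu> B k)"
    if "regular_coeff T B" "regular_coeff T S" "cond_conv T B S" "admissible T m s B S" for B S
    using that euler_convex_scheme[OF T m that] drift_map_convex[OF T m _ that(1)] by (auto simp: cond_conv_def)

  have a_single: "(\<forall>x. neg_part_integrable M (\<lambda>\<omega>. f (euler_path ch T m s B S G (\<lambda>_. x) \<omega>))) \<and>
     mono (\<lambda>x. ext_expectation M (\<lambda>\<omega>. f (euler_path ch T m s B S G (\<lambda>_. x) \<omega>))) \<and>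
     convex_ext (\<lambda>x. ext_expectation M (\<lambda>\<omega>. f (euler_path ch T m s B S G (\<lambda>_. x) \<omega>)))"
    if r: "regular_coeff T B" "regular_coeff T S" and c: "cond_conv T B S" "admissible T m s B S"
      and f: "dir_convex (Suc m) f" "nondecreasing_each (Suc m) f" for B S f
    unfolding path
    using D.inc_neg_part[OF inc[OF f] dep lip[OF r] D.independent_start_constant]
      D.inc_mean_mono[OF inc[OF f] dep scheme(1)[OF r c]]
      D.inc_mean_convex[OF inc[OF f] dep lip[OF r] scheme(1)[OF r c]] scheme(2)[OF r c]
    by simp

  have a_order: "le_diricv M (Suc m) (euler_path ch T m s b \<sigma> G X0) (euler_path ch T m s \<beta> \<theta> G Y0)"
    if le: "\<forall>t\<in>{0..T}. \<forall>x. b t x \<le> \<beta> t x \<and> 0 \<le> \<sigma> t x \<and> \<sigma> t x \<le> \<theta> t x" and o: "le_icv M X0 Y0"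
    unfolding le_diricv_def
  proof (intro conjI allI impI)
    show "integrable M (\<lambda>\<omega>. euler_path ch T m s b \<sigma> G X0 \<omega> i)" if "i < Suc m" for i
      by (rule path_int[OF regs(1,3) X0 assms(7) that])
    show "integrable M (\<lambda>\<omega>. euler_path ch T m s \<beta> \<theta> G Y0 \<omega> i)" if "i < Suc m" for i
      by (rule path_int[OF regs(2,4) Y0 assms(8) that])
    fix f assume f: "dir_convex (Suc m) f \<and> nondecreasing_each (Suc m) f"
    then have F: "D.inc_class (cylinder (Suc m) f)" using inc by blast
    show "neg_part_integrable M (\<lambda>\<omega>. f (euler_path ch T m s b \<sigma> G X0 \<omega>))"
      unfolding path by (rule D.inc_neg_part[OF F dep lip[OF regs(1,3)] X0 assms(7)])
    show "neg_part_integrable M (\<lambda>\<omega>. f (euler_path ch T m s \<beta> \<theta> G Y0 \<omega>))"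
      unfolding path by (rule D.inc_neg_part[OF F dep lip[OF regs(2,4)] Y0 assms(8)])
    show "ext_expectation M (\<lambda>\<omega>. f (euler_path ch T m s b \<sigma> G X0 \<omega>)) \<le> ext_expectation M (\<lambda>\<omega>. f (euler_path ch T m s \<beta> \<theta> G Y0 \<omega>))"
      unfolding path
    proof (rule D.inc_comparison[OF F dep lip[OF regs(1,3)] lip[OF regs(2,4)] X0 assms(7) Y0 assms(8)])
      show "ext_expectation M (\<lambda>\<omega>. \<psi> (X0 \<omega>)) \<le> ext_expectation M (\<lambda>\<omega>. \<psi> (Y0 \<omega>))"
        if "convex_on UNIV \<psi>" "mono \<psi>" for \<psi> :: "real \<Rightarrow> real"
        using o that unfolding le_icv_def by blast
      show "?\<mu> b k x \<le> ?\<mu> \<beta> k x" if "k < m" for k x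
        by (rule drift_map_mono_coeff[OF T m that regs(1,2)]) (use le in blast)
      show "\<bar>?\<rho> \<sigma> k x\<bar> \<le> \<bar>?\<rho> \<theta> k x\<bar>" if "k < m" for k x
        by (rule spread_mono_coeff[OF T m that regs(3,4)]) (use le in \<open>metis abs_of_nonneg order_trans\<close>)
      show "convex_scheme m s (?\<mu> b) (?\<rho> \<sigma>) \<and> (\<forall>k<m. convex_on UNIV (?\<mu> b k)) \<or>
        convex_scheme m s (?\<mu> \<beta>) (?\<rho> \<theta>) \<and> (\<forall>k<m. convex_on UNIV (?\<mu> \<beta> k))"
        using assms(13) scheme[OF regs(1,3)] scheme[OF regs(2,4)] by blast
    qed
  qed

  have b_part: "((\<forall>t\<in>{0..T}. \<forall>x. 0 \<le> \<sigma> t x \<and> \<sigma> t x \<le> \<theta> t x) \<and> le_cvx M X0 Y0 \<longrightarrow>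
           le_dircvx M (Suc m) (euler_path ch T m s b \<sigma> G X0) (euler_path ch T m s \<beta> \<theta> G Y0)) \<and>
        (cond_conv T b \<sigma> \<and> admissible T m s b \<sigma> \<longrightarrow>
           (\<forall>f. dir_convex (Suc m) f \<longrightarrow>
              (s < \<infinity> \<longrightarrow>
                (\<forall>x. neg_part_integrable M (\<lambda>\<omega>. f (euler_path ch T m s b \<sigma> G (\<lambda>_. x) \<omega>)))) \<and>
              convex_ext (\<lambda>x. ext_expectation M (\<lambda>\<omega>. f (euler_path ch T m s b \<sigma> G (\<lambda>_. x) \<omega>))))) \<and>
        (cond_conv T \<beta> \<theta> \<and> admissible T m s \<beta> \<theta> \<longrightarrow>
           (\<forall>f. dir_convex (Suc m) f \<longrightarrow>
              (s < \<infinity> \<longrightarrow>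
                (\<forall>y. neg_part_integrable M (\<lambda>\<omega>. f (euler_path ch T m s \<beta> \<theta> G (\<lambda>_. y) \<omega>)))) \<and>
              convex_ext (\<lambda>y. ext_expectation M (\<lambda>\<omega>. f (euler_path ch T m s \<beta> \<theta> G (\<lambda>_. y) \<omega>)))))"
    if lin: "\<forall>t\<in>{0..T}. \<forall>x. b t x = lam t + mu t * x \<and> \<beta> t x = lam t + mu t * x" for lam mu :: "real \<Rightarrow> real"
  proof -
    have drift_eq: "?\<mu> b k = ?\<mu> \<beta> k" if "k < m" for k
      by (rule ext, rule antisym)
        (rule drift_map_mono_coeff[OF T m that regs(1,2)] drift_map_mono_coeff[OF T m that regs(2,1)], use lin in simp)+
    have aff: "\<exists>a c. \<forall>x. ?\<mu> b k x = a + c * x" "\<exists>a c. \<forall>x. ?\<mu> \<beta> k x = a + c * x" if "k < m" for k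
      using drift_map_affine[OF T m that regs(1), of lam mu ch] drift_map_affine[OF T m that regs(2), of lam mu ch] lin
      by auto
    have aff_inc: "D.affine_increasing (?\<mu> B)" if c: "convex_scheme m s (?\<mu> B) \<rho>"
      and a: "\<And>k. k < m \<Longrightarrow> \<exists>a c. \<forall>x. ?\<mu> B k x = a + c * x" for B \<rho>
      unfolding D.affine_increasing_def
    proof (intro allI impI)
      fix k assume k: "k < m"
      obtain a c' where ac: "\<And>x. ?\<mu> B k x = a + c' * x" using a[OF k] by blast
      have "?\<mu> B k 0 \<le> ?\<mu> B k 1"
        using convex_step_mono[OF convex_schemeD[OF c k], of 0 1 0] s0 by (simp add: zero_ereal_def)
      then have "0 \<le> c'" by (simp add: ac)
      then show "\<exists>a c'. 0 \<le> c' \<and> ?\<mu> B k = (\<lambda>x. a + c' * x)" using ac by blast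
    qed
    have b_single: "(s < \<infinity> \<longrightarrow> (\<forall>x. neg_part_integrable M (\<lambda>\<omega>. f (euler_path ch T m s B S G (\<lambda>_. x) \<omega>)))) \<and>
        convex_ext (\<lambda>x. ext_expectation M (\<lambda>\<omega>. f (euler_path ch T m s B S G (\<lambda>_. x) \<omega>)))"
      if r: "regular_coeff T B" "regular_coeff T S" and c: "cond_conv T B S" "admissible T m s B S"
        and a: "\<And>k. k < m \<Longrightarrow> \<exists>a c. \<forall>x. ?\<mu> B k x = a + c * x" and f: "dir_convex (Suc m) f" for B S f
    proof (cases "s < \<infinity>")
      case True
      show ?thesis
        unfolding path
        by (intro conjI impI allI D.dir_mean[OF dir[OF f] dep True lip[OF r] scheme(1)[OF r c]] a)
    next
      case False
      then have "admissible T m \<infinity> B S" using c(2) by simp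
      then have co: "D.constant_spread (?\<rho> S)"
        unfolding D.constant_spread_def using infinite_level_constant_spread[OF T m r(2)] by blast
      have "D.affine_increasing (?\<mu> B)" by (rule aff_inc[OF scheme(1)[OF r c] a])
      from D.ray_mean_convex[OF ray[OF f] lip[OF r] this co] False show ?thesis
        unfolding path by blast
    qed
    have b_order: "le_dircvx M (Suc m) (euler_path ch T m s b \<sigma> G X0) (euler_path ch T m s \<beta> \<theta> G Y0)"
      if le: "\<forall>t\<in>{0..T}. \<forall>x. 0 \<le> \<sigma> t x \<and> \<sigma> t x \<le> \<theta> t x" and o: "le_cvx M X0 Y0"
    proof -
      have spread_le: "\<bar>?\<rho> \<sigma> k x\<bar> \<le> \<bar>?\<rho> \<theta> k x\<bar>" if "k < m" for k x
        by (rule spread_mono_coeff[OF T m that regs(3,4)]) (use le in \<open>metis abs_of_nonneg order_trans\<close>)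
      have ord: "ext_expectation M (\<lambda>\<omega>. \<psi> (X0 \<omega>)) \<le> ext_expectation M (\<lambda>\<omega>. \<psi> (Y0 \<omega>))"
        if "convex_on UNIV \<psi>" for \<psi> :: "real \<Rightarrow> real"
        using o that unfolding le_cvx_def by blast
      have cs: "convex_scheme m s (?\<mu> b) (?\<rho> \<sigma>) \<or> convex_scheme m s (?\<mu> \<beta>) (?\<rho> \<theta>)"
        using assms(13) scheme(1)[OF regs(1,3)] scheme(1)[OF regs(2,4)] by blast
      have both: "ext_expectation M (\<lambda>\<omega>. f (euler_path ch T m s b \<sigma> G X0 \<omega>)) \<noteq> - \<infinity> \<and>
         ext_expectation M (\<lambda>\<omega>. f (euler_path ch T m s b \<sigma> G X0 \<omega>)) \<le> ext_expectation M (\<lambda>\<omega>. f (euler_path ch T m s \<beta> \<theta> G Y0 \<omega>))"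
        if f: "dir_convex (Suc m) f" for f
      proof (cases "s < \<infinity>")
        case True
        show ?thesis
          unfolding path
          using D.dir_comparison[OF dir[OF f] dep True lip[OF regs(1,3)] lip[OF regs(2,4)] X0 assms(7) Y0 ord drift_eq aff(1) spread_le cs]
          by blast
      next
        case False
        have "D.affine_increasing (?\<mu> b) \<or> D.affine_increasing (?\<mu> \<beta>)"
          using cs aff_inc[OF _ aff(1)] aff_inc[OF _ aff(2)] by blast
        then have ai: "D.affine_increasing (?\<mu> b)" using drift_eq by (simp add: D.affine_increasing_def)
        have co: "D.constant_spread (?\<rho> \<sigma>) \<or> D.constant_spread (?\<rho> \<theta>)"
          using assms(13) False infinite_level_constant_spread[OF T m regs(3), where ch = ch]
            infinite_level_constant_spread[OF T m regs(4), where ch = ch]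
          unfolding D.constant_spread_def by (metis ereal_infty_less(1))
        show ?thesis
          unfolding path
          using D.ray_not_minf[OF ray[OF f] lip[OF regs(1,3)] X0 assms(7) ai]
            D.ray_comparison[OF ray[OF f] lip[OF regs(1,3)] lip[OF regs(2,4)] X0 Y0 ord drift_eq ai spread_le co]
          by blast
      qed
      show ?thesis
        unfolding le_dircvx_def
        using path_int[OF regs(1,3) X0 assms(7)] path_int[OF regs(2,4) Y0 assms(8)] both by force
    qed
    show ?thesis
      using b_order b_single[OF regs(1,3) _ _ aff(1)] b_single[OF regs(2,4) _ _ aff(2)] by blast
  qed
  show ?thesis
    using a_order a_single[OF regs(1,3)] a_single[OF regs(2,4)] b_part by blast
qed

end
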